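(* Let $1\le p\le\infty$ and let $(X,d,\mu)$ be an infinitesimally doubling metric measure space which is $p$-thick quasiconvex with constant $C\ge1$. Then there exists a metric $d_p$ on $X$ such that $X_p:=(X,d_p,\mu)$ is $p$-thick geodesic and $d\le d_p\le Cd$. Moreover, $d_p$ is minimal among metrics $\rho\ge d$ on $X$ for which $(X,\rho,\mu)$ is $p$-thick geodesic, i.e. $d_p\le\rho$ for every such $\rho$.
   Context: A metric measure space $(X,d,\mu)$ is a proper metric space with a Borel regular outer measure $\mu$ such that every open ball has positive finite measure. It is infinitesimally doubling if $\limsup_{r\to0}\mu(B(x,2r))/\mu(B(x,r))<\infty$ for $\mu$-a.e. $x$. Curves are continuous maps $\gamma:[0,1]\to X$ with length $\ell(\gamma)$. For a curve family $\Gamma$ and $1\le p<\infty$, $\operatorname{Mod}_p\Gamma=\inf\int\rho^p\,d\mu$ over Borel $\rho:X\to[0,\infty]$ with $\int_\gamma\rho\ge1$ for all $\gamma\in\Gamma$; $\operatorname{Mod}_\infty\Gamma=\inf\|\rho\|_{L^\infty(\mu)}$ over the same $\rho$. For $E,F\subset X$ and $C\ge1$, $\Gamma(E,F;C)$ is the family of curves with $\gamma(0)\in E$, $\gamma(1)\in F$, $\ell(\gamma)\le C\,d(\gamma(0),\gamma(1))$. $X$ is $p$-thick quasiconvex with constant $C$ if $\operatorname{Mod}_p\Gamma(E,F;C)>0$ for all measurable $E,F\subset X$ of positive measure; it is $p$-thick geodesic if it is $p$-thick quasiconvex with constant $C$ for every $C>1$. *)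

theory Defs
  imports "HOL-Analysis.Analysis"
begin

definition mtop :: "('a \<Rightarrow> 'a \<Rightarrow> real) \<Rightarrow> 'a topology" where
  "mtop d = Metric_space.mtopology UNIV d"

definition borel_of_metric :: "('a \<Rightarrow> 'a \<Rightarrow> real) \<Rightarrow> 'a measure" where
  "borel_of_metric d = sigma UNIV {U. openin (mtop d) U}"

definition oball :: "('a \<Rightarrow> 'a \<Rightarrow> real) \<Rightarrow> 'a \<Rightarrow> real \<Rightarrow> 'a set" where
  "oball d x r = {y. d x y < r}"

definition mms :: "('a \<Rightarrow> 'a \<Rightarrow> real) \<Rightarrow> 'a measure \<Rightarrow> bool" where
  "mms d M \<longleftrightarrow>
     Metric_space UNIV d \<and>
     (\<forall>S. closedin (mtop d) S \<and> Metric_space.mbounded UNIV d S \<longrightarrow> compactin (mtop d) S) \<and>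
     space M = UNIV \<and>
     sets (borel_of_metric d) \<subseteq> sets M \<and>
     (\<forall>A B. B \<in> sets M \<and> emeasure M B = 0 \<and> A \<subseteq> B \<longrightarrow> A \<in> sets M) \<and>
     (\<forall>A \<in> sets M. \<exists>B \<in> sets (borel_of_metric d). A \<subseteq> B \<and> emeasure M B = emeasure M A) \<and>
     (\<forall>x r. r > 0 \<longrightarrow> 0 < emeasure M (oball d x r) \<and> emeasure M (oball d x r) < \<infinity>)"

definition inf_doubling :: "('a \<Rightarrow> 'a \<Rightarrow> real) \<Rightarrow> 'a measure \<Rightarrow> bool" where
  "inf_doubling d M \<longleftrightarrow>
     (AE x in M. Limsup (at_right 0)
        (\<lambda>r. ereal (measure M (oball d x (2 * r)) / measure M (oball d x r))) < \<infinity>)"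

definition is_curve :: "('a \<Rightarrow> 'a \<Rightarrow> real) \<Rightarrow> (real \<Rightarrow> 'a) \<Rightarrow> bool" where
  "is_curve d \<gamma> \<longleftrightarrow> continuous_map (top_of_set {0..1}) (mtop d) \<gamma>"

definition seg_length :: "('a \<Rightarrow> 'a \<Rightarrow> real) \<Rightarrow> (real \<Rightarrow> 'a) \<Rightarrow> real \<Rightarrow> real \<Rightarrow> ereal" where
  "seg_length d \<gamma> a b = (SUP P \<in> {(n, t). t 0 = a \<and> t n = b \<and> (\<forall>i<n. t i \<le> t (Suc i))}.
        ereal (\<Sum>i < fst P. d (\<gamma> (snd P i)) (\<gamma> (snd P (Suc i)))))"

definition curve_length :: "('a \<Rightarrow> 'a \<Rightarrow> real) \<Rightarrow> (real \<Rightarrow> 'a) \<Rightarrow> ereal" where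
  "curve_length d \<gamma> = seg_length d \<gamma> 0 1"

text \<open>Arc-length parametrisation of a rectifiable curve: \<gamma> = arclen_param d \<gamma> o s_\<gamma>.\<close>
definition arclen_param :: "('a \<Rightarrow> 'a \<Rightarrow> real) \<Rightarrow> (real \<Rightarrow> 'a) \<Rightarrow> real \<Rightarrow> 'a" where
  "arclen_param d \<gamma> s = \<gamma> (SOME t. t \<in> {0..1} \<and> seg_length d \<gamma> 0 t = ereal s)"

text \<open>Line integral \<integral>_\<gamma> \<rho> ds (meaningful for rectifiable curves).\<close>
definition line_integral :: "('a \<Rightarrow> 'a \<Rightarrow> real) \<Rightarrow> ('a \<Rightarrow> ennreal) \<Rightarrow> (real \<Rightarrow> 'a) \<Rightarrow> ennreal" where
  "line_integral d \<rho> \<gamma> =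
     (\<integral>\<^sup>+ s. indicator {0..real_of_ereal (curve_length d \<gamma>)} s * \<rho> (arclen_param d \<gamma> s) \<partial>lborel)"

definition admissible :: "('a \<Rightarrow> 'a \<Rightarrow> real) \<Rightarrow> (real \<Rightarrow> 'a) set \<Rightarrow> ('a \<Rightarrow> ennreal) \<Rightarrow> bool" where
  "admissible d \<Gamma> \<rho> \<longleftrightarrow> \<rho> \<in> borel_measurable (borel_of_metric d) \<and>
     (\<forall>\<gamma> \<in> \<Gamma>. 1 \<le> line_integral d \<rho> \<gamma>)"

definition enn_pow :: "ennreal \<Rightarrow> real \<Rightarrow> ennreal" where
  "enn_pow x q = (if x = \<infinity> then \<infinity> else ennreal (enn2real x powr q))"

definition Linf_norm :: "'a measure \<Rightarrow> ('a \<Rightarrow> ennreal) \<Rightarrow> ennreal" where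
  "Linf_norm M \<rho> = Inf {c. AE x in M. \<rho> x \<le> c}"

definition modulus :: "ennreal \<Rightarrow> ('a \<Rightarrow> 'a \<Rightarrow> real) \<Rightarrow> 'a measure \<Rightarrow> (real \<Rightarrow> 'a) set \<Rightarrow> ennreal" where
  "modulus p d M \<Gamma> =
     (if p = \<infinity> then Inf {Linf_norm M \<rho> | \<rho>. admissible d \<Gamma> \<rho>}
      else Inf {(\<integral>\<^sup>+ x. enn_pow (\<rho> x) (enn2real p) \<partial>M) | \<rho>. admissible d \<Gamma> \<rho>})"

definition curve_family :: "('a \<Rightarrow> 'a \<Rightarrow> real) \<Rightarrow> 'a set \<Rightarrow> 'a set \<Rightarrow> real \<Rightarrow> (real \<Rightarrow> 'a) set" where
  "curve_family d E F C = {\<gamma>. is_curve d \<gamma> \<and> \<gamma> 0 \<in> E \<and> \<gamma> 1 \<in> F \<and>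
       curve_length d \<gamma> \<le> ereal (C * d (\<gamma> 0) (\<gamma> 1))}"

definition thick_quasiconvex :: "ennreal \<Rightarrow> ('a \<Rightarrow> 'a \<Rightarrow> real) \<Rightarrow> 'a measure \<Rightarrow> real \<Rightarrow> bool" where
  "thick_quasiconvex p d M C \<longleftrightarrow>
     (\<forall>E F. E \<in> sets M \<and> F \<in> sets M \<and> 0 < emeasure M E \<and> 0 < emeasure M F \<longrightarrow>
        0 < modulus p d M (curve_family d E F C))"

definition thick_geodesic :: "ennreal \<Rightarrow> ('a \<Rightarrow> 'a \<Rightarrow> real) \<Rightarrow> 'a measure \<Rightarrow> bool" where
  "thick_geodesic p d M \<longleftrightarrow> (\<forall>C > 1. thick_quasiconvex p d M C)"

end

(* Call a C-Lipschitz function u a test function if |u(x) - u(y)| is at most the length of p-almost every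
   rectifiable curve from x to y, and let dp(x,y) be the supremum of |u(x) - u(y)| over test functions u.
   The triangle inequality, d <= dp <= C d and minimality are then immediate.

   If Mod_p of the dp-curves from E to F of length at most lam * dp vanished for some lam > 1, take a
   function g of finite energy whose integral along all of them is infinite, and enlarge it so that
   curves with finite g-integral have the same length for dp as for d. The d-distance v from E along
   such curves is 1-Lipschitz along p-almost every curve. Once v is known to be measurable, thick
   quasiconvexity makes it C-Lipschitz off a null set, so it agrees almost everywhere with a test
   function, whence v <= dp(e, .) for almost every e in E; but v >= lam * dp(E, .) on F, a contradiction
   when E is small.

   Measurability of v is the delicate point: for p < infinity g is replaced by a lower semicontinuous
   majorant, for p = infinity by a G_delta null set, so that being a good curve becomes an
   F_sigma-delta condition on a compact set of Lipschitz curves, and the set of end points is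
   measurable by a capacitability argument. *)
theory Submission
  imports Defs "HOL-Library.Diagonal_Subsequence"
begin

text \<open>Thickness concerns sets of positive measure, \<open>dp\<close> single points. The
  everywhere valid Lipschitz bound on test functions bridges the two: values are fixed at each
  point, and moving an end point a little costs little.

  Exceptional families can be discarded only countably often, while \<open>dp\<close> is a supremum
  over a possibly uncountable set. Separability and the common Lipschitz bound reduce it to
  countably many test functions, whose exceptional families merge into one; off it the bound holds
  on every subarc, which is why lengths for \<open>d\<close> and \<open>dp\<close> agree.

  Thickness makes v Lipschitz because sets of positive measure near x, where v is small, and near y,
  where v is large, are joined by a curve of length about C times the distance of x and y, and v
  cannot grow by more than that length. Null sets do no harm: p-almost every curve spends no time in
  a given one.

  In the last comparison a curve may start anywhere in E, an error of at most C times its diameter.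
  The factor lam - 1 beats this only if E and F have positive distance, so that distance is secured
  before the diameter is chosen.\<close>

section \<open>Contractions of the real line and Lebesgue measure\<close>

lemma emeasure_ge_dist_connected:
  fixes I :: "real set"
  assumes "connected I" "I \<in> sets lborel" "x \<in> I" "y \<in> I"
  shows "ennreal \<bar>x - y\<bar> \<le> emeasure lborel I"
proof -
  have *: "ennreal (b - a) \<le> emeasure lborel I" if "a \<in> I" "b \<in> I" "a \<le> b" for a b
  proof -
    have "{a..b} \<subseteq> I"
      using assms(1) that connected_contains_Icc by blast
    then have "emeasure lborel {a..b} \<le> emeasure lborel I"
      using assms(2) by (intro emeasure_mono)
    then show ?thesis
      using that by simp
  qed
  show ?thesis
    using *[of x y] *[of y x] assms by (cases "x \<le> y") auto
qed

text \<open>The closed interval of length \<open>w\<close> starting at \<open>Inf X\<close> does the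
  job. Working with a cover means that the measurability of \<open>X\<close>, later an image under a
  contraction, never comes up.\<close>

lemma small_diameter_cover:
  fixes X :: "real set"
  assumes "\<And>x y. x \<in> X \<Longrightarrow> y \<in> X \<Longrightarrow> ennreal \<bar>x - y\<bar> \<le> w"
  shows "\<exists>J \<in> sets lborel. X \<subseteq> J \<and> emeasure lborel J \<le> w"
proof (cases "X = {} \<or> w = \<infinity>")
  case True
  then show ?thesis
    by (auto intro: bexI[of _ "{}"] bexI[of _ UNIV])
next
  case False
  then obtain r where r: "w = ennreal r" "0 \<le> r"
    by (cases w) auto
  have b: "\<bar>x - y\<bar> \<le> r" if "x \<in> X" "y \<in> X" for x y
    using assms[OF that] r by simp
  obtain z where z: "z \<in> X"
    using False by auto
  have bdd: "bdd_below X"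
    by (rule bdd_belowI[of _ "z - r"]) (use b[OF z] in \<open>force\<close>)
  have "x \<le> Inf X + r" if "x \<in> X" for x
  proof -
    have "x - r \<le> Inf X"
      by (rule cInf_greatest) (use False b[OF that] in \<open>force\<close>)+
    then show ?thesis by simp
  qed
  then have "X \<subseteq> {Inf X..Inf X + r}"
    using cInf_lower[OF _ bdd] by auto
  then show ?thesis
    using r by (intro bexI[of _ "{Inf X..Inf X + r}"]) auto
qed

text \<open>An open set slightly larger than \<open>A\<close> is a countable disjoint union of
  intervals, and a contraction maps each of them to a set of diameter at most its length. The image
  of \<open>A\<close> need not be a Borel set, hence the Borel set \<open>B\<close> inside
  it.\<close>

lemma emeasure_contraction_image:
  fixes S :: "real \<Rightarrow> real"
  assumes S: "\<And>s t. \<bar>S s - S t\<bar> \<le> \<bar>s - t\<bar>"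
    and A: "A \<in> sets borel" and B: "B \<in> sets borel" "B \<subseteq> S ` A"
  shows "emeasure lborel B \<le> emeasure lborel A"
proof (rule ennreal_le_epsilon)
  fix e :: real assume e: "0 < e"
  obtain T where T: "open T" "A \<subseteq> T" "emeasure lebesgue (T - A) < ennreal e"
    proof -
    have "A \<in> sets lebesgue"
      using A by (intro sets_completionI_sets) simp
    from sets_lebesgue_outer_open[OF this e] show ?thesis
      using that by blast
  qed
  have emTA: "emeasure lborel (T - A) = emeasure lebesgue (T - A)"
    using T(1) A by (subst emeasure_completion) auto
  define X where "X n = (if n \<in> to_nat_on (components T) ` components T
    then from_nat_into (components T) n else {})" for n
  have cnt: "countable (components T)"
  proof (rule countable_disjoint_open_subsets)
    show "open S" if "S \<in> components T" for S
      using open_components[OF T(1) that] .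
    show "disjoint (components T)"
      unfolding pairwise_def disjnt_def using components_nonoverlap by blast
  qed
  have fn: "from_nat_into (components T) (to_nat_on (components T) c) = c" if "c \<in> components T" for c
    using cnt that by simp
  have X: "X n = {} \<or> X n \<in> components T" for n
    using fn by (auto simp: X_def)
  have UX: "(\<Union>n. X n) = T"
  proof
    show "(\<Union>n. X n) \<subseteq> T"
      using X in_components_subset by fastforce
    have "c \<subseteq> (\<Union>n. X n)" if "c \<in> components T" for c
    proof -
      have "X (to_nat_on (components T) c) = c"
        using that fn by (simp add: X_def)
      then show ?thesis by blast
    qed
    then show "T \<subseteq> (\<Union>n. X n)"
      using Union_components[of T] by blast
  qed
  have disj: "disjoint_family X"
  proof (unfold disjoint_family_on_def, intro ballI impI)
    fix m n :: nat assume mn: "m \<noteq> n"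
    show "X m \<inter> X n = {}"
    proof (cases "X m = {} \<or> X n = {}")
      case False
      then obtain c c' where c: "c \<in> components T" "m = to_nat_on (components T) c" "X m = c"
          and c': "c' \<in> components T" "n = to_nat_on (components T) c'" "X n = c'"
        using fn by (auto simp: X_def split: if_splits)
      then show ?thesis
        using mn components_nonoverlap by blast
    qed auto
  qed
  have meas: "X n \<in> sets borel" for n
    using X[of n] open_components[OF T(1)] by auto
  have conn: "connected (X n)" for n
    using X[of n] in_components_connected by auto
  have "\<exists>J \<in> sets lborel. S ` X n \<subseteq> J \<and> emeasure lborel J \<le> emeasure lborel (X n)" for n
  proof (rule small_diameter_cover)
    fix x y assume "x \<in> S ` X n" "y \<in> S ` X n"
    then obtain s t where st: "s \<in> X n" "t \<in> X n" "x = S s" "y = S t" by auto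
    have "ennreal \<bar>x - y\<bar> \<le> ennreal \<bar>s - t\<bar>"
      using S st by (simp add: ennreal_leI)
    also have "\<dots> \<le> emeasure lborel (X n)"
      using conn meas st by (intro emeasure_ge_dist_connected) auto
    finally show "ennreal \<bar>x - y\<bar> \<le> emeasure lborel (X n)" .
  qed
  then obtain J where J: "\<And>n. J n \<in> sets lborel" "\<And>n. S ` X n \<subseteq> J n"
    "\<And>n. emeasure lborel (J n) \<le> emeasure lborel (X n)"
    by metis
  have "B \<subseteq> (\<Union>n. J n)"
  proof
    fix y assume "y \<in> B"
    then obtain a where "a \<in> A" and y: "y = S a"
      using B(2) by auto
    then obtain n where "a \<in> X n"
      using T(2) UX by auto
    then show "y \<in> (\<Union>n. J n)"
      using J(2)[of n] y by auto
  qed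
  then have "emeasure lborel B \<le> emeasure lborel (\<Union>n. J n)"
    using J(1) by (intro emeasure_mono) auto
  also have "\<dots> \<le> (\<Sum>n. emeasure lborel (J n))"
    using J(1) by (intro emeasure_subadditive_countably) auto
  also have "\<dots> \<le> (\<Sum>n. emeasure lborel (X n))"
    using J(3) by (intro suminf_le) auto
  also have "\<dots> = emeasure lborel T"
    using suminf_emeasure[of X lborel] meas disj UX by (simp add: image_subset_iff)
  also have "\<dots> = emeasure lborel (A \<union> (T - A))"
    using T(2) by (simp add: Un_absorb1)
  also have "\<dots> \<le> emeasure lborel A + emeasure lborel (T - A)"
    using A T(1) by (intro emeasure_subadditive) auto
  also have "\<dots> \<le> emeasure lborel A + ennreal e"
    using T(3) emTA by (intro add_left_mono) (simp add: less_imp_le)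
  finally show "emeasure lborel B \<le> emeasure lborel A + ennreal e" .
qed

text \<open>By the preceding inequality, the push-forward under \<open>S\<close> of Lebesgue measure
  on \<open>{0..L}\<close> dominates Lebesgue measure on \<open>{0..l}\<close>; the claim integrates
  \<open>f\<close> against both.\<close>

lemma nn_integral_contraction:
  fixes S :: "real \<Rightarrow> real" and f :: "real \<Rightarrow> ennreal"
  assumes S: "\<And>s t. \<bar>S s - S t\<bar> \<le> \<bar>s - t\<bar>"
    and onto: "{0..l} \<subseteq> S ` {0..L}"
    and f: "(\<lambda>s. indicator {0..l} s * f s) \<in> borel_measurable borel"
  shows "(\<integral>\<^sup>+ s. indicator {0..l} s * f s \<partial>lborel) \<le> (\<integral>\<^sup>+ s. indicator {0..L} s * f (S s) \<partial>lborel)"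
proof -
  have "continuous_on UNIV S"
    by (rule lipschitz_on_continuous_on[of 1]) (use S in \<open>auto simp: dist_real_def lipschitz_on_def\<close>)
  then have Sm [measurable]: "S \<in> borel_measurable borel"
    by (rule borel_measurable_continuous_onI)
  define N where "N = distr (density lborel (indicator {0..L})) borel S"
  define N0 where "N0 = density lborel (indicator {0..l} :: real \<Rightarrow> ennreal)"
  define F where "F s = indicator {0..l} s * f s" for s
  have F [measurable]: "F \<in> borel_measurable borel"
    using f by (simp add: F_def[abs_def])
  have le: "N0 \<le> N"
  proof (subst le_measure)
    show "sets N0 = sets N" by (simp add: N0_def N_def)
    show "\<forall>A\<in>sets N0. emeasure N0 A \<le> emeasure N A"
    proof
      fix B assume "B \<in> sets N0"
      then have B [measurable]: "B \<in> sets borel" by (simp add: N0_def)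
      have "emeasure N0 B = emeasure lborel ({0..l} \<inter> B)"
        by (simp add: N0_def emeasure_restricted)
      also have "\<dots> \<le> emeasure lborel ({0..L} \<inter> S -` B)"
      proof (rule emeasure_contraction_image[OF S])
        show "{0..L} \<inter> S -` B \<in> sets borel"
          using measurable_sets_borel[OF Sm B] by auto
        show "{0..l} \<inter> B \<subseteq> S ` ({0..L} \<inter> S -` B)"
          using onto by blast
      qed (use B in auto)
      also have "\<dots> = emeasure N B"
        using measurable_sets_borel[OF Sm B]
        by (simp add: N_def emeasure_distr emeasure_restricted)
      finally show "emeasure N0 B \<le> emeasure N B" .
    qed
  qed
  have "(\<integral>\<^sup>+ s. indicator {0..l} s * f s \<partial>lborel) = (\<integral>\<^sup>+ s. F s \<partial>N0)"
    unfolding N0_def by (subst nn_integral_density) (auto intro!: nn_integral_cong simp: F_def indicator_def)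
  also have "\<dots> \<le> (\<integral>\<^sup>+ s. F s \<partial>N)"
    using le by (intro nn_integral_mono_measure) (auto simp: N0_def N_def)
  also have "\<dots> = (\<integral>\<^sup>+ s. indicator {0..L} s * F (S s) \<partial>lborel)"
    unfolding N_def by (subst nn_integral_distr, simp_all add: nn_integral_density)
  also have "\<dots> \<le> (\<integral>\<^sup>+ s. indicator {0..L} s * f (S s) \<partial>lborel)"
    by (intro nn_integral_mono) (auto simp: F_def indicator_def)
  finally show ?thesis .
qed

lemma sum_lessThan_add:
  fixes n m :: nat
  shows "(\<Sum>i<n + m. f i) = (\<Sum>i<n. f i) + (\<Sum>i<m. f (n + i) :: real)"
  by (induction m) (simp_all add: add.assoc)

section \<open>Topology, Borel sets and curves of a metric on a whole type\<close>

locale full_metric = Metric_space UNIV d for d :: "'a \<Rightarrow> 'a \<Rightarrow> real"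
begin

lemma tri: "d x z \<le> d x y + d y z"
  by (rule triangle) auto

lemma dist_diff: "\<bar>d x y - d x' y'\<bar> \<le> d x x' + d y y'"
  using tri[of x y x'] tri[of x' y y'] tri[of x' y' x] tri[of x y' y]
  by (simp add: commute[of x' x] commute[of y' y] abs_le_iff)

lemma mtop_eq: "mtop d = mtopology"
  by (simp add: mtop_def)

lemma mball_eq: "mball x r = oball d x r"
  by (auto simp: oball_def)

lemma openin_mtop: "openin (mtop d) U \<longleftrightarrow> (\<forall>x\<in>U. \<exists>r>0. oball d x r \<subseteq> U)"
  by (simp add: mtop_eq openin_mtopology mball_eq Ball_def)

lemma openin_oball: "openin (mtop d) (oball d x r)"
  using openin_mball[of x r] by (simp add: mtop_eq mball_eq)

lemma sets_borel_of_metric: "sets (borel_of_metric d) = sigma_sets UNIV {U. openin (mtop d) U}"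
  by (simp add: borel_of_metric_def)

lemma space_borel_of_metric [simp]: "space (borel_of_metric d) = UNIV"
  by (simp add: borel_of_metric_def)

lemma open_in_borel: "openin (mtop d) U \<Longrightarrow> U \<in> sets (borel_of_metric d)"
  by (simp add: sets_borel_of_metric sigma_sets.Basic)

lemma closed_in_borel: "closedin (mtop d) U \<Longrightarrow> U \<in> sets (borel_of_metric d)"
proof -
  assume "closedin (mtop d) U"
  then have "openin (mtop d) (UNIV - U)"
    by (simp add: closedin_def mtop_eq)
  from sets.compl_sets[OF open_in_borel[OF this]] show ?thesis
    by (simp add: Diff_Diff_Int)
qed

lemma limitin_mtop: "limitin (mtop d) x l sequentially \<longleftrightarrow> (\<lambda>n. d (x n) l) \<longlonglongrightarrow> 0"
  by (simp add: mtop_eq limitin_metric_dist_null)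

lemma is_curve_iff:
  "is_curve d \<gamma> \<longleftrightarrow> (\<forall>t\<in>{0..1}. \<forall>e>0. \<exists>\<delta>>0. \<forall>s\<in>{0..1}. \<bar>s - t\<bar> < \<delta> \<longrightarrow> d (\<gamma> s) (\<gamma> t) < e)"
proof
  assume c: "is_curve d \<gamma>"
  show "\<forall>t\<in>{0..1}. \<forall>e>0. \<exists>\<delta>>0. \<forall>s\<in>{0..1}. \<bar>s - t\<bar> < \<delta> \<longrightarrow> d (\<gamma> s) (\<gamma> t) < e"
  proof (intro ballI allI impI)
    fix t e :: real assume t: "t \<in> {0..1}" and e: "0 < e"
    have "openin (top_of_set {0..1}) {s \<in> {0..1}. \<gamma> s \<in> oball d (\<gamma> t) e}"
      using c openin_oball[of "\<gamma> t" e] by (simp add: is_curve_def continuous_map_def)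
    moreover have "t \<in> {s \<in> {0..1}. \<gamma> s \<in> oball d (\<gamma> t) e}"
      using t e by (simp add: oball_def)
    ultimately obtain \<delta> where "\<delta> > 0" "\<forall>s\<in>{0..1}. dist s t < \<delta> \<longrightarrow> s \<in> {s \<in> {0..1}. \<gamma> s \<in> oball d (\<gamma> t) e}"
      unfolding openin_euclidean_subtopology_iff by meson
    then show "\<exists>\<delta>>0. \<forall>s\<in>{0..1}. \<bar>s - t\<bar> < \<delta> \<longrightarrow> d (\<gamma> s) (\<gamma> t) < e"
      by (intro exI[of _ \<delta>]) (simp add: oball_def dist_real_def commute[of "\<gamma> t"])
  qed
next
  assume *: "\<forall>t\<in>{0..1}. \<forall>e>0. \<exists>\<delta>>0. \<forall>s\<in>{0..1}. \<bar>s - t\<bar> < \<delta> \<longrightarrow> d (\<gamma> s) (\<gamma> t) < e"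
  show "is_curve d \<gamma>"
    unfolding is_curve_def continuous_map_def
  proof (intro conjI allI impI)
    show "\<gamma> \<in> topspace (top_of_set {0..1}) \<rightarrow> topspace (mtop d)"
      by (simp add: mtop_eq)
    fix U assume U: "openin (mtop d) U"
    show "openin (top_of_set {0..1}) {x \<in> topspace (top_of_set {0..1}). \<gamma> x \<in> U}"
      unfolding openin_euclidean_subtopology_iff
    proof (intro conjI ballI)
      fix t assume "t \<in> {x \<in> topspace (top_of_set {0..1}). \<gamma> x \<in> U}"
      then have t: "t \<in> {0..1}" "\<gamma> t \<in> U" by auto
      then obtain r where r: "r > 0" "oball d (\<gamma> t) r \<subseteq> U"
        using U by (auto simp: openin_mtop)
      obtain \<delta> where \<delta>: "\<delta> > 0" "\<And>s. s \<in> {0..1} \<Longrightarrow> \<bar>s - t\<bar> < \<delta> \<Longrightarrow> d (\<gamma> s) (\<gamma> t) < r"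
        using * t r by blast
      show "\<exists>e>0. \<forall>x'\<in>{0..1}. dist x' t < e \<longrightarrow> x' \<in> {x \<in> topspace (top_of_set {0..1}). \<gamma> x \<in> U}"
        using \<delta> r by (intro exI[of _ \<delta>]) (auto simp: dist_real_def oball_def subset_iff commute)
    qed auto
  qed
qed

subsection \<open>Length of curves\<close>

definition partition :: "real \<Rightarrow> real \<Rightarrow> nat \<Rightarrow> (nat \<Rightarrow> real) \<Rightarrow> bool" where
  "partition a b n t \<longleftrightarrow> t 0 = a \<and> t n = b \<and> (\<forall>i<n. t i \<le> t (Suc i))"

definition psum :: "(real \<Rightarrow> 'a) \<Rightarrow> nat \<Rightarrow> (nat \<Rightarrow> real) \<Rightarrow> real" where
  "psum \<gamma> n t = (\<Sum>i<n. d (\<gamma> (t i)) (\<gamma> (t (Suc i))))"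

lemma seg_length_alt: "seg_length d \<gamma> a b = (SUP (n, t) \<in> {(n, t). partition a b n t}. ereal (psum \<gamma> n t))"
  by (simp add: seg_length_def partition_def psum_def case_prod_beta)

lemma seg_ge: "partition a b n t \<Longrightarrow> ereal (psum \<gamma> n t) \<le> seg_length d \<gamma> a b"
  unfolding seg_length_alt by (rule SUP_upper2[of "(n, t)"]) auto

lemma seg_le: "(\<And>n t. partition a b n t \<Longrightarrow> ereal (psum \<gamma> n t) \<le> B) \<Longrightarrow> seg_length d \<gamma> a b \<le> B"
  unfolding seg_length_alt by (rule SUP_least) auto

lemma seg_less_iff: "c < seg_length d \<gamma> a b \<longleftrightarrow> (\<exists>n t. partition a b n t \<and> c < ereal (psum \<gamma> n t))"
  unfolding seg_length_alt by (auto simp: less_SUP_iff)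

lemma partition_mono:
  assumes "partition a b n t" "i \<le> j" "j \<le> n"
  shows "t i \<le> t j"
  using assms(2,3)
proof (induction j rule: dec_induct)
  case (step k)
  then have "t k \<le> t (Suc k)"
    using assms(1) by (simp add: partition_def)
  with step show ?case by simp
qed simp

lemma partition_bounds:
  assumes "partition a b n t" "i \<le> n"
  shows "a \<le> t i" "t i \<le> b"
  using partition_mono[OF assms(1), of 0 i] partition_mono[OF assms(1), of i n] assms
  by (auto simp: partition_def)

lemma partition_trivial: "a \<le> b \<Longrightarrow> partition a b 1 (\<lambda>i. if i = 0 then a else b)"
  by (simp add: partition_def)

lemma seg_dist: "a \<le> b \<Longrightarrow> ereal (d (\<gamma> a) (\<gamma> b)) \<le> seg_length d \<gamma> a b"
  using seg_ge[OF partition_trivial[of a b], of \<gamma>] by (simp add: psum_def)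

lemma seg_nonneg: "a \<le> b \<Longrightarrow> 0 \<le> seg_length d \<gamma> a b"
  using seg_dist[of a b \<gamma>] nonneg[of "\<gamma> a" "\<gamma> b"] by (meson ereal_less_eq(5) order_trans)

text \<open>Clamping at \<open>b\<close> splits a partition without inserting a point: both halves
  keep the index range \<open>n\<close>, and the terms beyond \<open>b\<close> become zero. Only the
  step that crosses \<open>b\<close> then needs the triangle inequality.\<close>

lemma partition_min: "partition a c n t \<Longrightarrow> a \<le> b \<Longrightarrow> b \<le> c \<Longrightarrow> partition a b n (\<lambda>i. min b (t i))"
  by (auto simp: partition_def min_def)

lemma partition_max: "partition a c n t \<Longrightarrow> a \<le> b \<Longrightarrow> b \<le> c \<Longrightarrow> partition b c n (\<lambda>i. max b (t i))"
  by (force simp: partition_def max_def)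

lemma psum_split:
  assumes "partition a c n t"
  shows "psum \<gamma> n t \<le> psum \<gamma> n (\<lambda>i. min b (t i)) + psum \<gamma> n (\<lambda>i. max b (t i))"
  unfolding psum_def sum.distrib[symmetric]
proof (rule sum_mono)
  fix i assume "i \<in> {..<n}"
  then have "t i \<le> t (Suc i)"
    using assms by (simp add: partition_def)
  then show "d (\<gamma> (t i)) (\<gamma> (t (Suc i)))
      \<le> d (\<gamma> (min b (t i))) (\<gamma> (min b (t (Suc i)))) + d (\<gamma> (max b (t i))) (\<gamma> (max b (t (Suc i))))"
    using tri[of "\<gamma> (t i)" "\<gamma> (t (Suc i))" "\<gamma> b"] by (auto simp: min_def max_def)
qed

lemma partition_concat:
  assumes "partition a b n t" "partition b c m u"
  shows "partition a c (n + m) (\<lambda>i. if i \<le> n then t i else u (i - n))"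
    and "psum \<gamma> (n + m) (\<lambda>i. if i \<le> n then t i else u (i - n)) = psum \<gamma> n t + psum \<gamma> m u"
proof -
  define v where "v i = (if i \<le> n then t i else u (i - n))" for i
  have v2: "v (n + i) = u i" for i
    using assms by (auto simp: v_def partition_def)
  have v1: "v i = t i" if "i \<le> n" for i
    using that by (simp add: v_def)
  have "v i \<le> v (Suc i)" if "i < n + m" for i
  proof (cases "i < n")
    case True
    then show ?thesis using assms(1) by (simp add: v_def partition_def)
  next
    case False
    define j where "j = i - n"
    have "i = n + j" "j < m"
      using that False by (auto simp: j_def)
    then show ?thesis
      using assms(2) v2[of j] v2[of "Suc j"] by (simp add: partition_def)
  qed
  moreover have "v 0 = a" "v (n + m) = c"
    using v1[of 0] v2[of m] assms by (auto simp: partition_def)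
  ultimately show "partition a c (n + m) (\<lambda>i. if i \<le> n then t i else u (i - n))"
    unfolding v_def[symmetric] partition_def by blast
  have "psum \<gamma> (n + m) v = (\<Sum>i<n. d (\<gamma> (v i)) (\<gamma> (v (Suc i)))) + (\<Sum>i<m. d (\<gamma> (v (n + i))) (\<gamma> (v (n + Suc i))))"
    unfolding psum_def using sum_lessThan_add[of "\<lambda>i. d (\<gamma> (v i)) (\<gamma> (v (Suc i)))" n m] by simp
  also have "\<dots> = psum \<gamma> n t + psum \<gamma> m u"
    unfolding psum_def v2 using v1 by auto
  finally show "psum \<gamma> (n + m) (\<lambda>i. if i \<le> n then t i else u (i - n)) = psum \<gamma> n t + psum \<gamma> m u"
    unfolding v_def[symmetric] .
qed

lemma seg_add:
  assumes "a \<le> b" "b \<le> c"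
  shows "seg_length d \<gamma> a c = seg_length d \<gamma> a b + seg_length d \<gamma> b c"
proof (rule antisym)
  show "seg_length d \<gamma> a c \<le> seg_length d \<gamma> a b + seg_length d \<gamma> b c"
  proof (rule seg_le)
    fix n t assume p: "partition a c n t"
    have "ereal (psum \<gamma> n t) \<le> ereal (psum \<gamma> n (\<lambda>i. min b (t i))) + ereal (psum \<gamma> n (\<lambda>i. max b (t i)))"
      using psum_split[OF p] by simp
    also have "\<dots> \<le> seg_length d \<gamma> a b + seg_length d \<gamma> b c"
      using p assms by (intro add_mono seg_ge partition_min partition_max)
    finally show "ereal (psum \<gamma> n t) \<le> seg_length d \<gamma> a b + seg_length d \<gamma> b c" .
  qed
  show "seg_length d \<gamma> a b + seg_length d \<gamma> b c \<le> seg_length d \<gamma> a c"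
  proof (cases "seg_length d \<gamma> a c")
    case (real r)
    have le: "psum \<gamma> n t + psum \<gamma> m u \<le> r" if "partition a b n t" "partition b c m u" for n t m u
      using seg_ge[OF partition_concat(1)[OF that], of \<gamma>] partition_concat(2)[OF that, of \<gamma>] real by simp
    \<comment> \<open>The two suprema are taken one after the other, because a length may be moved
      across an inequality in \<open>ereal\<close> only once it is known to be finite.\<close>
    have "seg_length d \<gamma> a b \<le> ereal (r - psum \<gamma> m u)" if "partition b c m u" for m u
      by (rule seg_le) (use le[OF _ that] in force)
    then have *: "seg_length d \<gamma> a b + ereal (psum \<gamma> m u) \<le> r" if "partition b c m u" for m u
      using that by (cases "seg_length d \<gamma> a b") (auto simp: algebra_simps)
    obtain x where x: "seg_length d \<gamma> a b = ereal x"
      using *[OF partition_trivial[OF assms(2)]] seg_nonneg[OF assms(1), of \<gamma>]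
      by (cases "seg_length d \<gamma> a b") auto
    have "seg_length d \<gamma> b c \<le> ereal (r - x)"
      by (rule seg_le) (use * x in \<open>force simp: algebra_simps\<close>)
    then show ?thesis
      using x real by (cases "seg_length d \<gamma> b c") auto
  qed (use seg_nonneg[of a c \<gamma>] assms in auto)
qed

lemma seg_self: "seg_length d \<gamma> a a = 0"
proof (rule antisym)
  show "seg_length d \<gamma> a a \<le> 0"
  proof (rule seg_le)
    fix n t assume p: "partition a a n t"
    have "t i = a" if "i \<le> n" for i
      using partition_bounds[OF p that] by simp
    then have "psum \<gamma> n t = 0"
      by (simp add: psum_def)
    then show "ereal (psum \<gamma> n t) \<le> 0" by simp
  qed
qed (simp add: seg_nonneg)

text \<open>One statement for both clamps: \<open>min\<close> cuts a partition off at a moving end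
  point, \<open>max\<close> at a moving starting point.\<close>

lemma psum_clamp_tendsto:
  assumes c: "is_curve d \<gamma>" and f: "f = min \<or> f = max"
    and t0: "t0 \<in> {0..1}" and t: "\<And>i. i \<le> n \<Longrightarrow> t i \<in> {0..1}"
  shows "((\<lambda>s. psum \<gamma> n (\<lambda>i. f s (t i))) \<longlongrightarrow> psum \<gamma> n (\<lambda>i. f t0 (t i))) (at t0 within {0..1})"
  unfolding psum_def
proof (rule tendsto_sum)
  fix i assume i: "i \<in> {..<n}"
  have ev: "eventually (\<lambda>s. d (\<gamma> (f s a)) (\<gamma> (f t0 a)) < e) (at t0 within {0..1})"
    if a: "a \<in> {0..1}" and e: "e > 0" for a e
  proof -
    have "f t0 a \<in> {0..1}"
      using f a t0 by (auto simp: min_def max_def)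
    then obtain \<delta> where \<delta>: "\<delta> > 0" "\<And>s. s \<in> {0..1} \<Longrightarrow> \<bar>s - f t0 a\<bar> < \<delta> \<Longrightarrow> d (\<gamma> s) (\<gamma> (f t0 a)) < e"
      using c e unfolding is_curve_iff by blast
    show ?thesis
      unfolding eventually_at
    proof (intro exI[of _ \<delta>] conjI ballI impI)
      fix s assume s: "s \<in> {0..1}" "s \<noteq> t0 \<and> dist s t0 < \<delta>"
      show "d (\<gamma> (f s a)) (\<gamma> (f t0 a)) < e"
        by (rule \<delta>(2)) (use f s a in \<open>auto simp: min_def max_def dist_real_def\<close>)
    qed (use \<delta> in auto)
  qed
  show "((\<lambda>s. d (\<gamma> (f s (t i))) (\<gamma> (f s (t (Suc i))))) \<longlongrightarrow> d (\<gamma> (f t0 (t i))) (\<gamma> (f t0 (t (Suc i))))) (at t0 within {0..1})"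
  proof (rule tendstoI)
    fix e :: real assume e: "e > 0"
    have "eventually (\<lambda>s. d (\<gamma> (f s (t i))) (\<gamma> (f t0 (t i))) < e / 2) (at t0 within {0..1})"
      by (rule ev) (use i e t[of i] in auto)
    moreover have "eventually (\<lambda>s. d (\<gamma> (f s (t (Suc i)))) (\<gamma> (f t0 (t (Suc i)))) < e / 2) (at t0 within {0..1})"
      by (rule ev) (use i e t[of "Suc i"] in auto)
    ultimately show "eventually (\<lambda>s. dist (d (\<gamma> (f s (t i))) (\<gamma> (f s (t (Suc i))))) (d (\<gamma> (f t0 (t i))) (\<gamma> (f t0 (t (Suc i))))) < e) (at t0 within {0..1})"
      by eventually_elim (smt (verit) dist_diff dist_real_def field_sum_of_halves)
  qed
qed

end

section \<open>Arc length along a rectifiable curve\<close>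

locale rectifiable = full_metric d for d :: "'a \<Rightarrow> 'a \<Rightarrow> real" +
  fixes \<gamma> :: "real \<Rightarrow> 'a"
  assumes curve: "is_curve d \<gamma>" and finite_length: "curve_length d \<gamma> < \<infinity>"
begin

definition len :: "real \<Rightarrow> real" where
  "len t = real_of_ereal (seg_length d \<gamma> 0 t)"

lemma seg_real:
  assumes "0 \<le> a" "a \<le> b" "b \<le> 1"
  shows "seg_length d \<gamma> a b = ereal (len b - len a)"
proof -
  have split: "seg_length d \<gamma> 0 1 = seg_length d \<gamma> 0 a + (seg_length d \<gamma> a b + seg_length d \<gamma> b 1)"
    using seg_add[of 0 a 1 \<gamma>] seg_add[of a b 1 \<gamma>] assms by simp
  have fin: "seg_length d \<gamma> 0 1 < \<infinity>"
    using finite_length by (simp add: curve_length_def)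
  have "0 \<le> seg_length d \<gamma> 0 a" "0 \<le> seg_length d \<gamma> a b" "0 \<le> seg_length d \<gamma> b 1"
    using assms by (auto intro: seg_nonneg)
  then obtain x y z where "seg_length d \<gamma> 0 a = ereal x" "seg_length d \<gamma> a b = ereal y" "seg_length d \<gamma> b 1 = ereal z"
    using fin unfolding split
    by (cases "seg_length d \<gamma> 0 a"; cases "seg_length d \<gamma> a b"; cases "seg_length d \<gamma> b 1") auto
  then show ?thesis
    using seg_add[of 0 a b \<gamma>] assms by (simp add: len_def)
qed

lemma len_0: "len 0 = 0"
  by (simp add: len_def seg_self)

lemma curve_length_eq: "curve_length d \<gamma> = ereal (len 1)"
  using seg_real[of 0 1] by (simp add: curve_length_def len_0)

lemma len_mono: "0 \<le> a \<Longrightarrow> a \<le> b \<Longrightarrow> b \<le> 1 \<Longrightarrow> len a \<le> len b"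
  using seg_real[of a b] seg_nonneg[of a b \<gamma>] by simp

lemma dist_le_len_diff: "a \<in> {0..1} \<Longrightarrow> b \<in> {0..1} \<Longrightarrow> d (\<gamma> a) (\<gamma> b) \<le> \<bar>len a - len b\<bar>"
proof (induction a b rule: linorder_wlog)
  case (le a b)
  then show ?case
    using seg_dist[of a b \<gamma>] seg_real[of a b] by simp
next
  case (sym a b)
  then show ?case
    by (simp add: commute[of "\<gamma> b"] abs_minus_commute)
qed

(* Partial sums of a fixed partition, clamped at t, are continuous in t. Hence both the length up to t
   and the length from t on are lower semicontinuous, and their sum is constant. *)
lemma len_continuous: "continuous_on {0..1} len"
  unfolding continuous_on_def
proof (intro ballI order_tendstoI)
  fix t0 c assume t0: "t0 \<in> {0..1::real}" and c: "c < len t0"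
  then have "ereal c < seg_length d \<gamma> 0 t0"
    using seg_real[of 0 t0] by (simp add: len_0)
  then obtain n t where p: "partition 0 t0 n t" and g: "c < psum \<gamma> n t"
    unfolding seg_less_iff by auto
  have b: "t i \<in> {0..1}" "min t0 (t i) = t i" if "i \<le> n" for i
    using partition_bounds[OF p that] t0 by auto
  have eq: "psum \<gamma> n (\<lambda>i. min t0 (t i)) = psum \<gamma> n t"
    by (simp add: psum_def b(2))
  have "((\<lambda>s. psum \<gamma> n (\<lambda>i. min s (t i))) \<longlongrightarrow> psum \<gamma> n t) (at t0 within {0..1})"
    using psum_clamp_tendsto[where f = min and n = n and t = t, OF curve _ t0 b(1)] eq by simp
  then have "eventually (\<lambda>s. c < psum \<gamma> n (\<lambda>i. min s (t i))) (at t0 within {0..1})"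
    using g by (rule order_tendstoD)
  moreover have "eventually (\<lambda>s. s \<in> {0..1}) (at t0 within {0..1})"
    by (simp add: eventually_at_filter)
  ultimately show "eventually (\<lambda>s. c < len s) (at t0 within {0..1})"
  proof eventually_elim
    case (elim s)
    show ?case
    proof (cases "s \<le> t0")
      case True
      have "ereal (psum \<gamma> n (\<lambda>i. min s (t i))) \<le> seg_length d \<gamma> 0 s"
        by (rule seg_ge[OF partition_min[OF p]]) (use elim True in auto)
      then show ?thesis
        using elim seg_real[of 0 s] by (simp add: len_0)
    next
      case False
      then show ?thesis
        using len_mono[of t0 s] c t0 elim by auto
    qed
  qed
next
  fix t0 c assume t0: "t0 \<in> {0..1::real}" and c: "len t0 < c"
  then have "ereal (len 1 - c) < seg_length d \<gamma> t0 1"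
    using seg_real[of t0 1] by simp
  then obtain n t where p: "partition t0 1 n t" and g: "len 1 - c < psum \<gamma> n t"
    unfolding seg_less_iff by auto
  have b: "t i \<in> {0..1}" "max t0 (t i) = t i" if "i \<le> n" for i
    using partition_bounds[OF p that] t0 by auto
  have eq: "psum \<gamma> n (\<lambda>i. max t0 (t i)) = psum \<gamma> n t"
    by (simp add: psum_def b(2))
  have "((\<lambda>s. psum \<gamma> n (\<lambda>i. max s (t i))) \<longlongrightarrow> psum \<gamma> n t) (at t0 within {0..1})"
    using psum_clamp_tendsto[where f = max and n = n and t = t, OF curve _ t0 b(1)] eq by simp
  then have "eventually (\<lambda>s. len 1 - c < psum \<gamma> n (\<lambda>i. max s (t i))) (at t0 within {0..1})"
    using g by (rule order_tendstoD)
  moreover have "eventually (\<lambda>s. s \<in> {0..1}) (at t0 within {0..1})"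
    by (simp add: eventually_at_filter)
  ultimately show "eventually (\<lambda>s. len s < c) (at t0 within {0..1})"
  proof eventually_elim
    case (elim s)
    show ?case
    proof (cases "t0 \<le> s")
      case True
      have "ereal (psum \<gamma> n (\<lambda>i. max s (t i))) \<le> seg_length d \<gamma> s 1"
        by (rule seg_ge[OF partition_max[OF p]]) (use elim True in auto)
      then show ?thesis
        using elim seg_real[of s 1] by simp
    next
      case False
      then show ?thesis
        using len_mono[of s t0] c t0 elim by auto
    qed
  qed
qed

lemma len_surj:
  assumes "s \<in> {0..len 1}"
  shows "\<exists>t\<in>{0..1}. len t = s"
  using IVT'[of len 0 s 1] assms len_continuous by (auto simp: len_0)

lemma arclen_param_eq:
  assumes "s \<in> {0..len 1}"
  obtains t where "t \<in> {0..1}" "len t = s" "arclen_param d \<gamma> s = \<gamma> t"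
proof -
  have ex: "\<exists>t. t \<in> {0..1} \<and> seg_length d \<gamma> 0 t = ereal s"
    using len_surj[OF assms] seg_real[of 0] by (force simp: len_0)
  define t where "t = (SOME t. t \<in> {0..1} \<and> seg_length d \<gamma> 0 t = ereal s)"
  have "t \<in> {0..1} \<and> seg_length d \<gamma> 0 t = ereal s"
    unfolding t_def by (rule someI_ex[OF ex])
  then show thesis
    by (intro that[of t]) (auto simp: len_def arclen_param_def t_def)
qed

lemma arclen_param_lipschitz:
  assumes "s \<in> {0..len 1}" "s' \<in> {0..len 1}"
  shows "d (arclen_param d \<gamma> s) (arclen_param d \<gamma> s') \<le> \<bar>s - s'\<bar>"
  using arclen_param_eq[OF assms(1)] arclen_param_eq[OF assms(2)] dist_le_len_diff by metis

text \<open>The choice inside \<open>arclen_param\<close> may return a different parameter with the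
  same value of \<open>len\<close>. The curve has the same value there, since distances are bounded
  by differences of \<open>len\<close>.\<close>

lemma arclen_param_len:
  assumes "t \<in> {0..1}"
  shows "arclen_param d \<gamma> (len t) = \<gamma> t"
proof -
  have "len t \<in> {0..len 1}"
    using len_mono[of 0 t] len_mono[of t 1] assms by (auto simp: len_0)
  then obtain t' where "t' \<in> {0..1}" "len t' = len t" "arclen_param d \<gamma> (len t) = \<gamma> t'"
    by (rule arclen_param_eq)
  moreover from this have "d (\<gamma> t') (\<gamma> t) \<le> 0"
    using dist_le_len_diff[of t' t] assms by simp
  ultimately show ?thesis
    using nonneg[of "\<gamma> t'" "\<gamma> t"] by (metis UNIV_I order_antisym zero)
qed

end

(* The curve is the restriction of c to [0,L]; c is 1-Lipschitz on the whole line so that no domain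
   has to be carried along. *)
definition lip_curve :: "('a \<Rightarrow> 'a \<Rightarrow> real) \<Rightarrow> real \<Rightarrow> (real \<Rightarrow> 'a) \<Rightarrow> bool" where
  "lip_curve d L c \<longleftrightarrow> 0 \<le> L \<and> (\<forall>s t. d (c s) (c t) \<le> \<bar>s - t\<bar>)"

definition arc_int :: "('a \<Rightarrow> ennreal) \<Rightarrow> real \<Rightarrow> (real \<Rightarrow> 'a) \<Rightarrow> ennreal" where
  "arc_int g L c = (\<integral>\<^sup>+ s. indicator {0..L} s * g (c s) \<partial>lborel)"

lemma arc_int_mono: "(\<And>x. g x \<le> h x) \<Longrightarrow> arc_int g L c \<le> arc_int h L c"
  unfolding arc_int_def by (intro nn_integral_mono mult_left_mono) auto

section \<open>Passing between curves on the unit interval and 1-Lipschitz curves\<close>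

context full_metric
begin

lemma lip_curve_measurable:
  assumes "lip_curve d L c"
  shows "c \<in> measurable borel (borel_of_metric d)"
  unfolding borel_of_metric_def
proof (rule measurable_measure_of)
  fix U assume "U \<in> {U. openin (mtop d) U}"
  then have U: "\<forall>x\<in>U. \<exists>r>0. oball d x r \<subseteq> U"
    by (simp add: openin_mtop)
  have "open (c -` U)"
    unfolding open_dist
  proof
    fix t assume "t \<in> c -` U"
    then obtain r where r: "r > 0" "oball d (c t) r \<subseteq> U"
      using U by auto
    show "\<exists>e>0. \<forall>s. dist s t < e \<longrightarrow> s \<in> c -` U"
    proof (intro exI[of _ r] conjI allI impI)
      fix s assume "dist s t < r"
      moreover have "d (c t) (c s) \<le> dist s t"
        using assms by (simp add: lip_curve_def dist_real_def commute[of "c t"])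
      ultimately have "c s \<in> oball d (c t) r"
        by (simp add: oball_def)
      then show "s \<in> c -` U"
        using r(2) by auto
    qed (use r in auto)
  qed
  then show "c -` U \<inter> space borel \<in> sets borel"
    by simp
qed auto

lemma arc_integrand_measurable:
  fixes g :: "'a \<Rightarrow> ennreal"
  assumes "lip_curve d L c" "g \<in> borel_measurable (borel_of_metric d)"
  shows "(\<lambda>s. indicator {0..l} s * g (c s)) \<in> borel_measurable borel"
  by (intro borel_measurable_times_ennreal borel_measurable_indicator
      measurable_compose[OF lip_curve_measurable[OF assms(1)] assms(2)]) simp

lemma arc_int_cmult:
  assumes "lip_curve d L c" "g \<in> borel_measurable (borel_of_metric d)"
  shows "arc_int (\<lambda>x. a * g x) L c = a * arc_int g L c"
proof -
  have "arc_int (\<lambda>x. a * g x) L c = (\<integral>\<^sup>+ s. a * (indicator {0..L} s * g (c s)) \<partial>lborel)"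
    unfolding arc_int_def by (intro nn_integral_cong) (simp add: mult.left_commute)
  also have "\<dots> = a * arc_int g L c"
    unfolding arc_int_def using arc_integrand_measurable[OF assms] by (intro nn_integral_cmult) simp
  finally show ?thesis .
qed

lemma rectifiable_lip_curve:
  assumes "is_curve d \<gamma>" "curve_length d \<gamma> < \<infinity>"
  obtains L c where "lip_curve d L c" "c 0 = \<gamma> 0" "c L = \<gamma> 1" "curve_length d \<gamma> = ereal L"
    "\<And>g. line_integral d g \<gamma> = arc_int g L c"
proof -
  interpret rectifiable d \<gamma>
    using assms by unfold_locales
  define L where "L = len 1"
  \<comment> \<open>Clamping extends the arc-length parametrisation by constants, so the Lipschitz
    bound holds on the whole line.\<close>
  define c where "c s = arclen_param d \<gamma> (max 0 (min L s))" for s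
  have L: "0 \<le> L"
    using len_mono[of 0 1] by (simp add: L_def len_0)
  have "d (c s) (c t) \<le> \<bar>s - t\<bar>" for s t
  proof -
    have "d (c s) (c t) \<le> \<bar>max 0 (min L s) - max 0 (min L t)\<bar>"
      unfolding c_def using L by (intro arclen_param_lipschitz) (auto simp: L_def)
    then show ?thesis by linarith
  qed
  then have "lip_curve d L c"
    using L by (simp add: lip_curve_def)
  moreover have "c 0 = \<gamma> 0" "c L = \<gamma> 1"
    using arclen_param_len[of 0] arclen_param_len[of 1] L by (auto simp: c_def L_def len_0)
  moreover have "line_integral d g \<gamma> = arc_int g L c" for g
    unfolding line_integral_def arc_int_def curve_length_eq
    by (intro nn_integral_cong) (auto simp: c_def L_def indicator_def)
  ultimately show thesis
    using that curve_length_eq L_def by blast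
qed

text \<open>\<open>c\<close> need not be parametrised by arc length, so its trace may be shorter
  than \<open>L\<close> and only inequalities can hold. They point the right way: an infinite line
  integral forces an infinite \<open>arc_int\<close>.\<close>

lemma lip_curve_reparam:
  assumes c: "lip_curve d L c"
  defines "\<gamma> \<equiv> \<lambda>t. c (L * t)"
  shows "is_curve d \<gamma>" "curve_length d \<gamma> \<le> ereal L"
    "\<And>g. g \<in> borel_measurable (borel_of_metric d) \<Longrightarrow> line_integral d g \<gamma> \<le> arc_int g L c"
proof -
  have L: "0 \<le> L" and lip: "\<And>s t. d (c s) (c t) \<le> \<bar>s - t\<bar>"
    using c by (auto simp: lip_curve_def)
  have lip': "d (\<gamma> s) (\<gamma> t) \<le> L * \<bar>s - t\<bar>" for s t
    using lip[of "L * s" "L * t"] L by (simp add: \<gamma>_def abs_mult right_diff_distrib[symmetric])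
  show curve: "is_curve d \<gamma>"
    unfolding is_curve_iff
  proof (intro ballI allI impI)
    fix t e :: real assume e: "0 < e"
    show "\<exists>\<delta>>0. \<forall>s\<in>{0..1}. \<bar>s - t\<bar> < \<delta> \<longrightarrow> d (\<gamma> s) (\<gamma> t) < e"
    proof (intro exI[of _ "e / (L + 1)"] conjI ballI impI)
      fix s assume "\<bar>s - t\<bar> < e / (L + 1)"
      then have "\<bar>s - t\<bar> * (L + 1) < e"
        using L by (simp add: pos_less_divide_eq)
      moreover have "d (\<gamma> s) (\<gamma> t) \<le> \<bar>s - t\<bar> * (L + 1)"
        using lip'[of s t] by (simp add: algebra_simps)
      ultimately show "d (\<gamma> s) (\<gamma> t) < e" by simp
    qed (use e L in auto)
  qed
  have seg: "seg_length d \<gamma> a b \<le> ereal (L * (b - a))" for a b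
  proof (rule seg_le)
    fix n t assume p: "partition a b n t"
    have "psum \<gamma> n t \<le> (\<Sum>i<n. L * (t (Suc i) - t i))"
      unfolding psum_def
    proof (rule sum_mono)
      fix i assume "i \<in> {..<n}"
      then show "d (\<gamma> (t i)) (\<gamma> (t (Suc i))) \<le> L * (t (Suc i) - t i)"
        using lip'[of "t i" "t (Suc i)"] p by (simp add: partition_def)
    qed
    also have "\<dots> = L * (t n - t 0)"
      by (simp add: sum_distrib_left[symmetric] sum_lessThan_telescope)
    finally show "ereal (psum \<gamma> n t) \<le> ereal (L * (b - a))"
      using p by (simp add: partition_def)
  qed
  show cl: "curve_length d \<gamma> \<le> ereal L"
    using seg[of 0 1] by (simp add: curve_length_def)
  then have fin: "curve_length d \<gamma> < \<infinity>"
    by (rule order_le_less_trans) simp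
  interpret R: rectifiable d \<gamma>
    using curve fin by unfold_locales
  fix g :: "'a \<Rightarrow> ennreal" assume g: "g \<in> borel_measurable (borel_of_metric d)"
  have len1: "0 \<le> R.len 1" "R.len 1 \<le> L"
    using R.len_mono[of 0 1] cl by (auto simp: R.len_0 R.curve_length_eq)
  show "line_integral d g \<gamma> \<le> arc_int g L c"
  proof (cases "L = 0")
    \<comment> \<open>A constant curve: rescaling by \<open>L\<close> is impossible, and the domain
      of integration is a single point.\<close>
    case True
    then have "R.len 1 = 0" using len1 by simp
    then have "AE s in lborel. indicator {0..R.len 1} s * g (arclen_param d \<gamma> s) = 0"
      by (intro eventually_mono[OF AE_lborel_singleton[of "0::real"]]) (simp add: indicator_def)
    then have "line_integral d g \<gamma> = (\<integral>\<^sup>+ s. 0 \<partial>(lborel :: real measure))"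
      unfolding line_integral_def R.curve_length_eq real_of_ereal.simps by (rule nn_integral_cong_AE)
    then show ?thesis by simp
  next
    case False
    then have L: "L > 0" using L by simp
    define cl where "cl s = max 0 (min 1 (s / L))" for s
    \<comment> \<open>\<open>S s\<close> is the arc length that \<open>\<gamma>\<close> has covered
      at the parameter \<open>s\<close> of \<open>c\<close>. It is a contraction onto the arc-length
      interval, as \<open>nn_integral_contraction\<close> requires.\<close>
    define S where "S s = R.len (cl s)" for s
    have cl01: "cl s \<in> {0..1}" for s
      by (simp add: cl_def)
    have len_lip: "\<bar>R.len a - R.len b\<bar> \<le> L * \<bar>a - b\<bar>" if "a \<in> {0..1}" "b \<in> {0..1}" for a b
      using that
    proof (induction a b rule: linorder_wlog)
      case (le a b)
      then show ?case
        using R.seg_real[of a b] seg[of a b] R.len_mono[of a b] by simp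
    next
      case (sym a b)
      then show ?case by (simp add: abs_minus_commute)
    qed
    have "\<bar>S s - S t\<bar> \<le> \<bar>s - t\<bar>" for s t
    proof -
      have "\<bar>S s - S t\<bar> \<le> L * \<bar>cl s - cl t\<bar>"
        unfolding S_def by (rule len_lip) (rule cl01)+
      also have "\<dots> \<le> L * \<bar>s / L - t / L\<bar>"
        using L by (intro mult_left_mono) (auto simp: cl_def)
      also have "\<dots> = \<bar>s - t\<bar>"
        using L by (simp add: diff_divide_distrib[symmetric])
      finally show ?thesis .
    qed
    moreover have "{0..R.len 1} \<subseteq> S ` {0..L}"
    proof
      fix s assume "s \<in> {0..R.len 1}"
      then obtain t where t: "t \<in> {0..1}" "R.len t = s"
        using R.len_surj by blast
      then have "S (L * t) = s" "L * t \<in> {0..L}"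
        using L by (auto simp: S_def cl_def mult_left_le)
      then show "s \<in> S ` {0..L}" by blast
    qed
    moreover have "(\<lambda>s. indicator {0..R.len 1} s * g (arclen_param d \<gamma> s)) \<in> borel_measurable borel"
    proof -
      define c' where "c' s = arclen_param d \<gamma> (max 0 (min (R.len 1) s))" for s
      have "lip_curve d (R.len 1) c'"
        unfolding lip_curve_def
      proof (intro conjI allI)
        fix s t
        have "d (c' s) (c' t) \<le> \<bar>max 0 (min (R.len 1) s) - max 0 (min (R.len 1) t)\<bar>"
          unfolding c'_def using len1 by (intro R.arclen_param_lipschitz) auto
        then show "d (c' s) (c' t) \<le> \<bar>s - t\<bar>" by linarith
      qed (rule len1)
      then have "(\<lambda>s. indicator {0..R.len 1} s * g (c' s)) \<in> borel_measurable borel"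
        using g by (rule arc_integrand_measurable)
      also have "(\<lambda>s. indicator {0..R.len 1} s * g (c' s)) = (\<lambda>s. indicator {0..R.len 1} s * g (arclen_param d \<gamma> s))"
        by (auto simp: fun_eq_iff indicator_def c'_def)
      finally show ?thesis .
    qed
    ultimately have "line_integral d g \<gamma> \<le> (\<integral>\<^sup>+ s. indicator {0..L} s * g (arclen_param d \<gamma> (S s)) \<partial>lborel)"
      unfolding line_integral_def R.curve_length_eq real_of_ereal.simps
      by (rule nn_integral_contraction)
    also have "\<dots> = arc_int g L c"
      unfolding arc_int_def
    proof (intro nn_integral_cong)
      fix s :: real
      show "indicator {0..L} s * g (arclen_param d \<gamma> (S s)) = indicator {0..L} s * g (c s)"
      proof (cases "s \<in> {0..L}")
        case True
        then have "cl s = s / L" using L by (simp add: cl_def)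
        then have "arclen_param d \<gamma> (S s) = \<gamma> (s / L)"
          using R.arclen_param_len[OF cl01[of s]] by (simp add: S_def)
        then show ?thesis using L by (simp add: \<gamma>_def)
      qed simp
    qed
    finally show ?thesis .
  qed
qed

end

subsection \<open>The functional minimised by the modulus\<close>

definition energy :: "ennreal \<Rightarrow> 'a measure \<Rightarrow> ('a \<Rightarrow> ennreal) \<Rightarrow> ennreal" where
  "energy p M g = (if p = \<infinity> then Linf_norm M g else (\<integral>\<^sup>+ x. enn_pow (g x) (enn2real p) \<partial>M))"

text \<open>The degree of homogeneity of \<open>energy\<close>, which takes no p-th root: p for
  finite p, and 1 for the essential supremum.\<close>

definition expo :: "ennreal \<Rightarrow> real" where
  "expo p = (if p = \<infinity> then 1 else enn2real p)"

lemma modulus_eq: "modulus p d M \<Gamma> = Inf {energy p M \<rho> | \<rho>. admissible d \<Gamma> \<rho>}"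
  by (simp add: modulus_def energy_def)

lemma expo_ge_1: "1 \<le> p \<Longrightarrow> 1 \<le> expo p"
  by (cases p) (auto simp: expo_def)

lemma enn_pow_le_iff:
  assumes "0 < q" "0 \<le> s"
  shows "enn_pow x q \<le> ennreal s \<longleftrightarrow> x \<le> ennreal (s powr (1 / q))"
proof (cases x)
  case (real r)
  have "r powr q \<le> s \<longleftrightarrow> r \<le> s powr (1 / q)"
  proof
    assume "r powr q \<le> s"
    then have "(r powr q) powr (1 / q) \<le> s powr (1 / q)"
      using assms by (intro powr_mono2) auto
    then show "r \<le> s powr (1 / q)"
      using assms real by (simp add: powr_powr)
  next
    assume "r \<le> s powr (1 / q)"
    then have "r powr q \<le> (s powr (1 / q)) powr q"
      using assms real by (intro powr_mono2) auto
    then show "r powr q \<le> s"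
      using assms real by (simp add: powr_powr)
  qed
  then show ?thesis
    using real assms by (simp add: enn_pow_def)
next
  case top
  then show ?thesis by (simp add: enn_pow_def top_unique)
qed

text \<open>\<open>enn_pow_le_iff\<close> is a Galois connection, so a common bound on the powers
  pulls back to the functions, passes to their supremum and is pushed forward again.\<close>

lemma enn_pow_SUP_le:
  assumes "0 < q"
  shows "enn_pow (SUP n. f n) q \<le> (SUP n. enn_pow (f n) q)"
proof (cases "SUP n. enn_pow (f n) q")
  case (real s)
  have "f n \<le> ennreal (s powr (1 / q))" for n
    using enn_pow_le_iff[OF assms real(1), of "f n"] SUP_upper[of n UNIV "\<lambda>n. enn_pow (f n) q"] real(2) by simp
  then have "(SUP n. f n) \<le> ennreal (s powr (1 / q))"
    by (rule SUP_least)
  then show ?thesis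
    using enn_pow_le_iff[OF assms real(1)] real(2) by simp
next
  case top
  show ?thesis unfolding top by simp
qed

lemma enn_pow_cmult:
  assumes "0 < a"
  shows "enn_pow (ennreal a * x) q = ennreal (a powr q) * enn_pow x q"
proof (cases x)
  case (real r)
  then show ?thesis
    using assms by (simp add: enn_pow_def ennreal_mult[symmetric] powr_mult ennreal_mult_eq_top_iff)
next
  case top
  then show ?thesis
    using assms by (simp add: enn_pow_def ennreal_mult_top)
qed

lemma enn_pow_measurable [measurable]:
  assumes [measurable]: "g \<in> borel_measurable M"
  shows "(\<lambda>x. enn_pow (g x) q) \<in> borel_measurable M"
  unfolding enn_pow_def by measurable

text \<open>The infimum that defines the norm is attained: intersect the sets of full measure that
  belong to the bounds \<open>r + 1 / Suc n\<close>.\<close>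

lemma AE_le_Linf_norm: "AE x in M. g x \<le> Linf_norm M g"
proof -
  have ae: "AE x in M. g x \<le> c" if c: "Linf_norm M g < c" for c
  proof -
    obtain c' where "c' < c" "AE x in M. g x \<le> c'"
      using c unfolding Linf_norm_def Inf_less_iff by auto
    then show ?thesis
      by (auto elim!: eventually_mono intro: order_trans less_imp_le)
  qed
  show ?thesis
  proof (cases "Linf_norm M g")
    case (real r)
    have "AE x in M. \<forall>n. g x \<le> ennreal (r + 1 / Suc n)"
      unfolding AE_all_countable
      by (intro allI ae) (use real in \<open>simp add: ennreal_less_iff\<close>)
    then show ?thesis
    proof eventually_elim
      case (elim x)
      have "g x \<le> ennreal r"
      proof (rule ennreal_le_epsilon)
        fix e :: real assume "0 < e"
        then obtain n where "1 / Suc n < e"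
          using nat_approx_posE by blast
        then have "ennreal (r + 1 / Suc n) \<le> ennreal r + ennreal e"
          using real \<open>0 < e\<close> by (simp add: ennreal_plus[symmetric] ennreal_leI del: ennreal_plus)
        then show "g x \<le> ennreal r + ennreal e"
          using elim order_trans by blast
      qed
      then show ?case using real by simp
    qed
  qed simp
qed

lemma Linf_norm_le: "AE x in M. g x \<le> c \<Longrightarrow> Linf_norm M g \<le> c"
  unfolding Linf_norm_def by (rule Inf_lower) simp

lemma energy_cmult:
  assumes "1 \<le> p" "0 < a" "g \<in> borel_measurable M"
  shows "energy p M (\<lambda>x. ennreal a * g x) \<le> ennreal (a powr expo p) * energy p M g"
proof (cases "p = \<infinity>")
  case True
  have "Linf_norm M (\<lambda>x. ennreal a * g x) \<le> ennreal a * Linf_norm M g"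
    by (rule Linf_norm_le) (use AE_le_Linf_norm[of g M] in \<open>auto elim!: eventually_mono intro: mult_left_mono\<close>)
  then show ?thesis using True assms by (simp add: energy_def expo_def)
next
  case False
  then show ?thesis
    using assms by (simp add: energy_def expo_def enn_pow_cmult nn_integral_cmult)
qed

lemma term_le_suminf: "f n \<le> (\<Sum>n. f n :: ennreal)"
  using sum_le_suminf[of f "{n}"] by simp

text \<open>Combining functions by suprema instead of sums makes the energy countably subadditive
  without Minkowski's inequality: a power of a supremum is at most the sum of the powers.\<close>

lemma energy_SUP_le:
  assumes "1 \<le> p" and [measurable]: "\<And>n. g n \<in> borel_measurable M"
  shows "energy p M (\<lambda>x. SUP n. g n x) \<le> (\<Sum>n::nat. energy p M (g n))"
proof (cases "p = \<infinity>")
  case True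
  have "Linf_norm M (\<lambda>x. SUP n. g n x) \<le> (\<Sum>n. Linf_norm M (g n))"
  proof (rule Linf_norm_le)
    have "AE x in M. \<forall>n. g n x \<le> Linf_norm M (g n)"
      unfolding AE_all_countable by (intro allI AE_le_Linf_norm)
    then show "AE x in M. (SUP n. g n x) \<le> (\<Sum>n. Linf_norm M (g n))"
      by eventually_elim (intro SUP_least, rule order_trans[OF _ term_le_suminf], auto)
  qed
  then show ?thesis using True by (simp add: energy_def)
next
  case False
  define q where "q = enn2real p"
  have q: "0 < q"
    using expo_ge_1[OF assms(1)] False by (simp add: q_def expo_def)
  have "(\<integral>\<^sup>+ x. enn_pow (SUP n. g n x) q \<partial>M) \<le> (\<integral>\<^sup>+ x. (\<Sum>n. enn_pow (g n x) q) \<partial>M)"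
    by (intro nn_integral_mono order_trans[OF enn_pow_SUP_le[OF q]] SUP_least term_le_suminf)
  also have "\<dots> = (\<Sum>n. \<integral>\<^sup>+ x. enn_pow (g n x) q \<partial>M)"
    by (rule nn_integral_suminf) measurable
  finally show ?thesis
    using False by (simp add: energy_def q_def)
qed

subsection \<open>Metric measure spaces and exceptional curves\<close>

lemma suminf_half_powers: "(\<Sum>n. ennreal ((1 / 2) ^ n)) < \<infinity>"
proof -
  have "(\<Sum>n. ennreal ((1 / 2) ^ n)) = ennreal (\<Sum>n. (1 / 2) ^ n)"
    by (intro suminf_ennreal2) (auto intro: summable_geometric)
  then show ?thesis by simp
qed

locale mms_space = full_metric d for d :: "'a \<Rightarrow> 'a \<Rightarrow> real" +
  fixes M :: "'a measure" and p :: ennreal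
  assumes mms: "mms d M" and p: "1 \<le> p"
begin

lemma space_M [simp]: "space M = UNIV"
  using mms by (simp add: mms_def)

lemma borel_sets_M: "B \<in> sets (borel_of_metric d) \<Longrightarrow> B \<in> sets M"
  using mms unfolding mms_def by blast

lemma complete_M: "B \<in> sets M \<Longrightarrow> emeasure M B = 0 \<Longrightarrow> A \<subseteq> B \<Longrightarrow> A \<in> sets M"
  using mms unfolding mms_def by blast

lemma borel_hull: "A \<in> sets M \<Longrightarrow> \<exists>B \<in> sets (borel_of_metric d). A \<subseteq> B \<and> emeasure M B = emeasure M A"
  using mms unfolding mms_def by blast

lemma oball_pos: "r > 0 \<Longrightarrow> 0 < emeasure M (oball d x r)"
  using mms unfolding mms_def by blast

lemma oball_fin: "emeasure M (oball d x r) < top"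
proof (cases "r > 0")
  case False
  then have "oball d x r = {}"
    using order_trans[OF _ nonneg[of x]] by (simp add: oball_def not_less)
  then show ?thesis by simp
next
  case True
  then show ?thesis
    using mms by (simp add: mms_def)
qed

lemma borel_measurable_M: "g \<in> borel_measurable (borel_of_metric d) \<Longrightarrow> g \<in> borel_measurable M"
  using borel_sets_M by (auto simp: measurable_def)

text \<open>"For p-almost every curve" is expressed throughout as "for every curve along which a
  fixed small function has finite integral".\<close>

definition small :: "('a \<Rightarrow> ennreal) \<Rightarrow> bool" where
  "small g \<longleftrightarrow> g \<in> borel_measurable (borel_of_metric d) \<and> energy p M g < \<infinity>"

lemma small_SUP:
  assumes meas: "\<And>n. g n \<in> borel_measurable (borel_of_metric d)"
    and le: "\<And>n. energy p M (g n) \<le> ennreal ((1 / 2) ^ n)"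
  shows "small (\<lambda>x. SUP n::nat. g n x)"
proof -
  have "energy p M (\<lambda>x. SUP n. g n x) \<le> (\<Sum>n. energy p M (g n))"
    using meas borel_measurable_M p by (intro energy_SUP_le) auto
  also have "\<dots> \<le> (\<Sum>n. ennreal ((1 / 2) ^ n))"
    using le by (intro suminf_le) auto
  also note suminf_half_powers
  finally show ?thesis
    using meas by (simp add: small_def)
qed

text \<open>Countable unions of exceptional families are exceptional. A positive factor does not
  affect finiteness of an integral, so each \<open>g n\<close> may be scaled until its energy is at
  most \<open>(1 / 2) ^ n\<close> before the supremum is taken.\<close>

lemma small_countable:
  assumes "\<And>n::nat. small (g n)"
  obtains h where "small h"
    "\<And>n L c. lip_curve d L c \<Longrightarrow> arc_int h L c < \<infinity> \<Longrightarrow> arc_int (g n) L c < \<infinity>"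
proof -
  have meas: "g n \<in> borel_measurable (borel_of_metric d)" for n
    using assms by (simp add: small_def)
  have "\<exists>a>0. energy p M (\<lambda>x. ennreal a * g n x) \<le> ennreal ((1 / 2) ^ n)" for n
  proof -
    obtain e where e: "0 \<le> e" "energy p M (g n) = ennreal e"
      using assms[of n] by (cases "energy p M (g n)") (auto simp: small_def)
    \<comment> \<open>Solves \<open>a powr expo p * (e + 1) = (1 / 2) ^ n\<close>; the added 1
      guards against energy zero.\<close>
    define a where "a = ((1 / 2) ^ n / (e + 1)) powr (1 / expo p)"
    have a: "a > 0" using e by (simp add: a_def)
    have "a powr expo p = (1 / 2) ^ n / (e + 1)"
      using expo_ge_1[OF p] e by (simp add: a_def powr_powr)
    then have *: "a powr expo p * e \<le> (1 / 2) ^ n"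
      using mult_left_le[of "e / (e + 1)" "(1 / 2) ^ n"] e by (simp add: mult.commute)
    have "energy p M (\<lambda>x. ennreal a * g n x) \<le> ennreal (a powr expo p) * ennreal e"
      using energy_cmult[OF p a borel_measurable_M[OF meas[of n]]] e by simp
    also have "\<dots> \<le> ennreal ((1 / 2) ^ n)"
      using * e by (simp add: ennreal_mult[symmetric] ennreal_leI)
    finally show ?thesis using a by blast
  qed
  then obtain a where a: "\<And>n. a n > 0" "\<And>n. energy p M (\<lambda>x. ennreal (a n) * g n x) \<le> ennreal ((1 / 2) ^ n)"
    by metis
  define h where "h x = (SUP n. ennreal (a n) * g n x)" for x
  have "small h"
    unfolding h_def by (rule small_SUP) (use meas a in auto)
  moreover have "arc_int (g n) L c < \<infinity>" if c: "lip_curve d L c" and h: "arc_int h L c < \<infinity>" for n L c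
  proof -
    have "ennreal (a n) * arc_int (g n) L c \<le> arc_int h L c"
      unfolding arc_int_cmult[OF c meas, symmetric]
      by (rule arc_int_mono) (auto simp: h_def intro: SUP_upper)
    then have "ennreal (a n) * arc_int (g n) L c < \<infinity>"
      using h by (rule order_le_less_trans)
    then show ?thesis
      using a(1)[of n] by (auto simp: ennreal_mult_less_top less_top)
  qed
  ultimately show thesis
    using that by blast
qed

text \<open>Choose admissible functions of energy so small that the multiple by \<open>Suc n\<close>
  still has energy at most \<open>(1 / 2) ^ n\<close>. The supremum of these multiples is small, and
  its integral along each curve of the family exceeds every natural number.\<close>

lemma exceptional_of_modulus_0:
  assumes "modulus p d M (curve_family d E F C) = 0"
  obtains g where "small g"
    "\<And>L c. \<lbrakk>lip_curve d L c; c 0 \<in> E; c L \<in> F; L \<le> C * d (c 0) (c L)\<rbrakk> \<Longrightarrow> arc_int g L c = \<infinity>"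
proof -
  let ?\<Gamma> = "curve_family d E F C"
  have "\<exists>\<rho>. admissible d ?\<Gamma> \<rho> \<and> energy p M (\<lambda>x. ennreal (Suc n) * \<rho> x) \<le> ennreal ((1 / 2) ^ n)" for n
  proof -
    define e where "e = (1 / 2) ^ n / (real (Suc n) powr expo p)"
    have "e > 0" by (simp add: e_def)
    then have "Inf {energy p M \<rho> | \<rho>. admissible d ?\<Gamma> \<rho>} < ennreal e"
      using assms by (simp add: modulus_eq)
    then obtain \<rho> where \<rho>: "admissible d ?\<Gamma> \<rho>" "energy p M \<rho> < ennreal e"
      unfolding Inf_less_iff by auto
    have "energy p M (\<lambda>x. ennreal (Suc n) * \<rho> x) \<le> ennreal (real (Suc n) powr expo p) * energy p M \<rho>"
      using \<rho>(1) by (intro energy_cmult p borel_measurable_M) (auto simp: admissible_def)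
    also have "\<dots> \<le> ennreal (real (Suc n) powr expo p) * ennreal e"
      using \<rho>(2) by (intro mult_left_mono) auto
    also have "\<dots> = ennreal ((1 / 2) ^ n)"
      by (simp add: ennreal_mult[symmetric] e_def)
    finally show ?thesis using \<rho>(1) by blast
  qed
  then obtain \<rho> where \<rho>: "\<And>n. admissible d ?\<Gamma> (\<rho> n)"
    "\<And>n. energy p M (\<lambda>x. ennreal (Suc n) * \<rho> n x) \<le> ennreal ((1 / 2) ^ n)"
    by metis
  define g where "g x = (SUP n. ennreal (Suc n) * \<rho> n x)" for x
  have meas: "\<rho> n \<in> borel_measurable (borel_of_metric d)" for n
    using \<rho>(1) by (simp add: admissible_def)
  have small: "small g"
    unfolding g_def by (rule small_SUP) (use meas \<rho> in auto)
  have "line_integral d g \<gamma> = \<infinity>" if \<gamma>: "\<gamma> \<in> ?\<Gamma>" for \<gamma>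
  proof -
    have "is_curve d \<gamma>" "curve_length d \<gamma> \<le> ereal (C * d (\<gamma> 0) (\<gamma> 1))"
      using \<gamma> by (auto simp: curve_family_def)
    moreover from this have "curve_length d \<gamma> < \<infinity>"
      using order_le_less_trans by fastforce
    ultimately obtain L c where c: "lip_curve d L c" "\<And>g. line_integral d g \<gamma> = arc_int g L c"
      using rectifiable_lip_curve by metis
    have "of_nat n \<le> arc_int g L c" for n
    proof -
      have "of_nat n \<le> ennreal (Suc n) * 1"
        by (simp add: ennreal_of_nat_eq_real_of_nat ennreal_leI)
      also have "\<dots> \<le> ennreal (Suc n) * arc_int (\<rho> n) L c"
        using \<rho>(1)[of n] \<gamma> c(2) by (intro mult_left_mono) (auto simp: admissible_def)
      also have "\<dots> \<le> arc_int g L c"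
        unfolding arc_int_cmult[OF c(1) meas, symmetric]
        by (rule arc_int_mono) (auto simp: g_def intro: SUP_upper)
      finally show ?thesis .
    qed
    then have "arc_int g L c = top"
      by (meson ennreal_Ex_less_of_nat leD less_top)
    then show ?thesis
      using c(2) by simp
  qed
  then have "arc_int g L c = \<infinity>"
    if c: "lip_curve d L c" "c 0 \<in> E" "c L \<in> F" "L \<le> C * d (c 0) (c L)" for L c
  proof -
    note r = lip_curve_reparam[OF c(1)]
    have "curve_length d (\<lambda>t. c (L * t)) \<le> ereal (C * d (c 0) (c L))"
      using r(2) c(4) order_trans by fastforce
    then have "(\<lambda>t. c (L * t)) \<in> ?\<Gamma>"
      using r(1) c by (simp add: curve_family_def)
    then have "line_integral d g (\<lambda>t. c (L * t)) = \<infinity>"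
      using \<open>\<And>\<gamma>. \<gamma> \<in> ?\<Gamma> \<Longrightarrow> line_integral d g \<gamma> = \<infinity>\<close> by blast
    then show ?thesis
      using r(3)[of g] small by (simp add: small_def top_unique)
  qed
  then show thesis
    using small that by blast
qed

text \<open>If \<open>g\<close> had infinite integral along all these curves, every positive
  multiple of it would be admissible. For factors \<open>a \<le> 1\<close> the energy is at most
  \<open>a * e\<close>, so the modulus would be 0.\<close>

lemma good_curve_of_modulus_pos:
  assumes "0 < modulus p d M (curve_family d E F C)" "small g"
  obtains L c where "lip_curve d L c" "c 0 \<in> E" "c L \<in> F" "L \<le> C * d (c 0) (c L)" "arc_int g L c < \<infinity>"
proof (rule ccontr)
  note thesisI = that
  let ?\<Gamma> = "curve_family d E F C"
  assume "\<not> thesis"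
  then have no: "arc_int g L c = \<infinity>"
    if "lip_curve d L c" "c 0 \<in> E" "c L \<in> F" "L \<le> C * d (c 0) (c L)" for L c
    using thesisI[OF that] \<open>\<not> thesis\<close> by (cases "arc_int g L c") auto
  have g: "g \<in> borel_measurable (borel_of_metric d)"
    using assms(2) by (simp add: small_def)
  obtain e where e: "0 \<le> e" "energy p M g = ennreal e"
    using assms(2) by (cases "energy p M g") (auto simp: small_def)
  have le: "modulus p d M ?\<Gamma> \<le> ennreal (a * e)" if a: "0 < a" "a \<le> 1" for a
  proof -
    have "admissible d ?\<Gamma> (\<lambda>x. ennreal a * g x)"
      unfolding admissible_def
    proof (intro conjI ballI)
      fix \<gamma> assume \<gamma>: "\<gamma> \<in> ?\<Gamma>"
      then have *: "is_curve d \<gamma>" "curve_length d \<gamma> \<le> ereal (C * d (\<gamma> 0) (\<gamma> 1))" "\<gamma> 0 \<in> E" "\<gamma> 1 \<in> F"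
        by (auto simp: curve_family_def)
      moreover from this have "curve_length d \<gamma> < \<infinity>"
        using order_le_less_trans by fastforce
      ultimately obtain L c where c: "lip_curve d L c" "c 0 = \<gamma> 0" "c L = \<gamma> 1" "curve_length d \<gamma> = ereal L"
        "\<And>g. line_integral d g \<gamma> = arc_int g L c"
        using rectifiable_lip_curve by metis
      have "arc_int g L c = \<infinity>"
        by (rule no) (use c * in auto)
      then show "1 \<le> line_integral d (\<lambda>x. ennreal a * g x) \<gamma>"
        using a by (simp add: c(5) arc_int_cmult[OF c(1) g] ennreal_mult_top)
    qed (use g in auto)
    then have "modulus p d M ?\<Gamma> \<le> energy p M (\<lambda>x. ennreal a * g x)"
      unfolding modulus_eq by (intro Inf_lower) blast
    also have "\<dots> \<le> ennreal (a powr expo p) * ennreal e"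
      using energy_cmult[OF p a(1) borel_measurable_M[OF g]] e by simp
    also have "\<dots> \<le> ennreal (a * e)"
    proof -
      have "a powr expo p \<le> a powr 1"
        using a expo_ge_1[OF p] by (intro powr_mono') auto
      then show ?thesis
        using a e by (simp add: ennreal_mult[symmetric] ennreal_leI mult_right_mono)
    qed
    finally show ?thesis .
  qed
  \<comment> \<open>The modulus itself may be infinite; a finite positive lower bound is enough to
    choose the factor \<open>a\<close>.\<close>
  obtain m where m: "0 < m" "ennreal m \<le> modulus p d M ?\<Gamma>"
  proof (cases "modulus p d M ?\<Gamma>")
    case (real r)
    then show ?thesis using assms(1) that[of r] by simp
  next
    case top
    then show ?thesis using that[of 1] by simp
  qed
  define a where "a = min 1 (m / (2 * (e + 1)))"
  have a: "0 < a" "a \<le> 1" using m e by (auto simp: a_def)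
  have "a * e \<le> m / (2 * (e + 1)) * e"
    using e by (intro mult_right_mono) (auto simp: a_def)
  also have "\<dots> < m"
    using m e by (simp add: field_simps add_nonneg_pos)
  finally have "ennreal (a * e) < ennreal m"
    using m(1) by (simp add: ennreal_lessI)
  then show False
    using le[OF a] m(2) by (meson leD order_trans)
qed

end

section \<open>Lower semicontinuity, compact balls and a countable dense set\<close>

lemma suminf_scaled_half_powers:
  assumes "0 \<le> e"
  shows "(\<Sum>n. ennreal (e * (1 / 2) ^ Suc n)) = ennreal e"
proof (rule suminf_ennreal_eq)
  show "(\<lambda>n. e * (1 / 2) ^ Suc n) sums e"
    using sums_mult[OF power_half_series, of e] by simp
qed (use assms in simp)

definition lsc :: "('a \<Rightarrow> 'a \<Rightarrow> real) \<Rightarrow> ('a \<Rightarrow> ennreal) \<Rightarrow> bool" where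
  "lsc d w \<longleftrightarrow> (\<forall>a. openin (mtop d) {x. a < w x})"

lemma (in full_metric) lsc_measurable: "lsc d w \<Longrightarrow> w \<in> borel_measurable (borel_of_metric d)"
  by (rule borel_measurableI_greater) (auto simp: lsc_def intro: open_in_borel)

lemma (in full_metric) lsc_SUP_indicator:
  assumes "\<And>n. openin (mtop d) (U n)"
  shows "lsc d (\<lambda>x. SUP n. a n * indicator (U n) x)"
  unfolding lsc_def
proof
  fix b
  have "{x. b < (SUP n. a n * indicator (U n) x)} = (\<Union>n. {x. b < a n * indicator (U n) x})"
    by (auto simp: less_SUP_iff)
  also have "openin (mtop d) \<dots>"
  proof (rule openin_Union, safe)
    fix n
    have "{x. b < a n * indicator (U n) x} = (if b < a n then U n else {})"
      by (auto simp: indicator_def)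
    then show "openin (mtop d) {x. b < a n * indicator (U n) x}"
      using assms by simp
  qed
  finally show "openin (mtop d) {x. b < (SUP n. a n * indicator (U n) x)}" .
qed

context mms_space
begin

lemma open_sets_M: "openin (mtop d) U \<Longrightarrow> U \<in> sets M"
  by (intro borel_sets_M open_in_borel)

lemma oball_sets_M: "oball d x r \<in> sets M"
  by (intro open_sets_M openin_oball)

lemma UN_oball: "(\<Union>n. oball d x (real n)) = UNIV"
proof -
  have "y \<in> (\<Union>n. oball d x (real n))" for y
    using reals_Archimedean2[of "d x y"] by (auto simp: oball_def)
  then show ?thesis by blast
qed

lemma compactin_closedin: "compactin (mtop d) K \<Longrightarrow> closedin (mtop d) K"
  unfolding mtop_eq by (rule compactin_imp_closedin[OF Hausdorff_space_mtopology])

lemma proper: "closedin (mtop d) S \<Longrightarrow> mbounded S \<Longrightarrow> compactin (mtop d) S"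
  using mms[unfolded mms_def, THEN conjunct2, THEN conjunct1] by simp

lemma compactin_mcball: "compactin (mtop d) (mcball x r)"
  unfolding mtop_eq by (rule proper[unfolded mtop_eq, OF closedin_mcball mbounded_mcball])

lemma bounded_subsequence:
  fixes x :: "nat \<Rightarrow> 'a"
  assumes "\<And>n. d o' (x n) \<le> R"
  obtains l r where "strict_mono (r :: nat \<Rightarrow> nat)" "(\<lambda>n. d (x (r n)) l) \<longlonglongrightarrow> 0"
proof -
  have "range x \<subseteq> mcball o' R"
    using assms by auto
  then obtain l r where "strict_mono (r :: nat \<Rightarrow> nat)" "limitin mtopology (x \<circ> r) l sequentially"
    using compactin_mcball[of o' R] unfolding mtop_eq compactin_sequentially by blast
  then show thesis
    using that limitin_mtop[of "x \<circ> r" l] by (simp add: mtop_eq)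
qed

text \<open>Closed balls are compact by properness, hence totally bounded; the finite nets of mesh
  \<open>1 / Suc m\<close> in the balls of radius n together form the dense set.\<close>

lemma countable_dense:
  obtains D where "countable D" "\<And>x e. e > 0 \<Longrightarrow> \<exists>q\<in>D. d x q < e"
proof -
  fix o' :: 'a
  have "\<exists>K. finite K \<and> mcball o' (real n) \<subseteq> (\<Union>x\<in>K. mball x (1 / Suc m))" for n m
    using compactin_imp_mtotally_bounded[OF compactin_mcball[unfolded mtop_eq], of o' "real n"]
    unfolding mtotally_bounded_def by (metis of_nat_0_less_iff zero_less_Suc zero_less_divide_1_iff)
  then obtain K where K: "\<And>n m. finite (K n m)" "\<And>n m. mcball o' (real n) \<subseteq> (\<Union>x\<in>K n m. mball x (1 / Suc m))"
    by metis
  show thesis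
  proof (rule that)
    show "countable (\<Union>n m. K n m)"
      using K(1) by (intro countable_UN) (auto intro: countable_finite)
    fix x and e :: real assume "e > 0"
    then obtain m where m: "1 / Suc m < e"
      using nat_approx_posE by blast
    obtain n where "d o' x \<le> real n"
      using real_arch_simple by blast
    then have "x \<in> mcball o' (real n)" by simp
    then obtain q where "q \<in> K n m" "d q x < 1 / Suc m"
      using K(2) by fastforce
    then show "\<exists>q\<in>(\<Union>n m. K n m). d x q < e"
      using m by (intro bexI[of _ q]) (auto simp: commute[of x])
  qed
qed

subsection \<open>Regularity of the measure\<close>

text \<open>Approximation from inside by closed and from outside by open sets is proved at once,
  which makes the induction over the sigma-algebra symmetric under complements. The ball keeps all
  measures finite, so that continuity from above applies.\<close>

lemma regular_in_ball:
  assumes "A \<in> sets (borel_of_metric d)" "0 < e"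
  shows "\<exists>F U. closedin (mtop d) F \<and> openin (mtop d) U \<and> F \<subseteq> A \<and> A \<subseteq> U
    \<and> emeasure M ((U - F) \<inter> oball d z R) \<le> ennreal e"
proof -
  define B where "B = oball d z R"
  have B: "B \<in> sets M" "emeasure M B < \<infinity>"
    by (auto simp: B_def oball_sets_M oball_fin)
  have finB: "emeasure M (X \<inter> B) < \<infinity>" for X
    using emeasure_mono[of "X \<inter> B" B M] B by (auto intro: order_le_less_trans)
  have cl: "F \<in> sets M" if "closedin (mtop d) F" for F
    using that by (intro borel_sets_M closed_in_borel)
  have vanish: "\<exists>n. emeasure M (X n \<inter> B) \<le> ennreal e"
    if "decseq X" "\<And>n. X n \<in> sets M" "(\<Inter>n. X n) = {}" "0 < e" for X and e :: real
  proof -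
    have "(\<lambda>n. emeasure M (X n \<inter> B)) \<longlonglongrightarrow> emeasure M (\<Inter>n. X n \<inter> B)"
    proof (rule Lim_emeasure_decseq)
      show "decseq (\<lambda>n. X n \<inter> B)"
        using that(1) by (auto simp: decseq_def)
      show "emeasure M (X i \<inter> B) \<noteq> \<infinity>" for i
        using finB[of "X i"] by simp
    qed (use that B in auto)
    moreover have "(\<Inter>n. X n \<inter> B) = {}"
      using that(3) by blast
    ultimately have "(\<lambda>n. emeasure M (X n \<inter> B)) \<longlonglongrightarrow> 0" by simp
    then have "eventually (\<lambda>n. emeasure M (X n \<inter> B) < ennreal e) sequentially"
      by (rule order_tendstoD) (use that(4) in simp)
    then show ?thesis
      by (auto simp: eventually_sequentially intro: less_imp_le)
  qed
  have "A \<in> sigma_sets UNIV {U. openin (mtop d) U}"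
    using assms by (simp add: sets_borel_of_metric)
  then have "\<forall>e>0. \<exists>F U. closedin (mtop d) F \<and> openin (mtop d) U \<and> F \<subseteq> A \<and> A \<subseteq> U
    \<and> emeasure M ((U - F) \<inter> B) \<le> ennreal e"
  proof (induction rule: sigma_sets.induct)
    case (Basic U)
    then have U: "openin (mtop d) U" by simp
    \<comment> \<open>Open neighbourhoods of the complement of \<open>U\<close>; their closed
      complements exhaust \<open>U\<close>.\<close>
    define V where "V n = (\<Union>y\<in>- U. oball d y (1 / Suc n))" for n :: nat
    have V: "openin (mtop d) (V n)" for n
      unfolding V_def by (intro openin_Union) (auto intro: openin_oball)
    have F: "closedin (mtop d) (- V n)" for n
      using V[of n] by (simp add: closedin_def mtop_eq Compl_eq_Diff_UNIV Diff_Diff_Int)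
    have FU: "- V n \<subseteq> U" for n
    proof
      fix x assume "x \<in> - V n"
      then have "x \<notin> oball d x (1 / Suc n) \<or> x \<in> U" by (auto simp: V_def)
      then show "x \<in> U" by (simp add: oball_def)
    qed
    show ?case
    proof (intro allI impI)
      fix e :: real assume e: "0 < e"
      have "\<exists>n. emeasure M ((U - (- V n)) \<inter> B) \<le> ennreal e"
      proof (rule vanish[OF _ _ _ e])
        have "V n \<subseteq> V m" if "m \<le> n" for m n
        proof -
          have "1 / real (Suc n) \<le> 1 / real (Suc m)"
            using that by (simp add: frac_le)
          then have "oball d y (1 / Suc n) \<subseteq> oball d y (1 / Suc m)" for y
            by (auto simp: oball_def)
          then show ?thesis unfolding V_def by blast
        qed
        then show "decseq (\<lambda>n. U - - V n)"
          unfolding decseq_def by blast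
        show "U - - V n \<in> sets M" for n
          using open_sets_M[OF U] open_sets_M[OF V[of n]] cl[OF F] by blast
        show "(\<Inter>n. U - - V n) = {}"
        proof (rule ccontr)
          assume "(\<Inter>n. U - - V n) \<noteq> {}"
          then obtain x where x: "x \<in> U" "\<And>n. x \<in> V n" by blast
          obtain r where r: "r > 0" "oball d x r \<subseteq> U"
            using U x(1) by (auto simp: openin_mtop)
          obtain n where n: "1 / Suc n < r"
            using r(1) nat_approx_posE by blast
          obtain y where "y \<notin> U" "d y x < 1 / Suc n"
            using x(2)[of n] by (auto simp: V_def oball_def)
          then have "y \<in> oball d x r"
            using n by (simp add: oball_def commute[of x])
          then show False using r \<open>y \<notin> U\<close> by blast
        qed
      qed
      then show "\<exists>F U'. closedin (mtop d) F \<and> openin (mtop d) U' \<and> F \<subseteq> U \<and> U \<subseteq> U'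
          \<and> emeasure M ((U' - F) \<inter> B) \<le> ennreal e"
        using U F FU by (metis order_refl)
    qed
  next
    case Empty
    show ?case
      by (intro allI impI exI[of _ "{}"]) auto
  next
    case (Compl A)
    show ?case
    proof (intro allI impI)
      fix e :: real assume "0 < e"
      then obtain F U where FU: "closedin (mtop d) F" "openin (mtop d) U" "F \<subseteq> A" "A \<subseteq> U"
        "emeasure M ((U - F) \<inter> B) \<le> ennreal e"
        using Compl.IH[rule_format, OF \<open>0 < e\<close>] by (elim exE conjE) (rule that)
      have "closedin (mtop d) (UNIV - U)" "openin (mtop d) (UNIV - F)"
        using FU(1,2) by (auto simp: closedin_def mtop_eq Diff_Diff_Int)
      moreover have "(UNIV - F) - (UNIV - U) = U - F" by blast
      ultimately show "\<exists>F U. closedin (mtop d) F \<and> openin (mtop d) U \<and> F \<subseteq> UNIV - A \<and> UNIV - A \<subseteq> U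
          \<and> emeasure M ((U - F) \<inter> B) \<le> ennreal e"
        using FU by (intro exI[of _ "UNIV - U"] exI[of _ "UNIV - F"]) auto
    qed
  next
    case (Union A)
    show ?case
    proof (intro allI impI)
      fix e :: real assume e: "0 < e"
      have "\<forall>i. \<exists>F U. closedin (mtop d) F \<and> openin (mtop d) U \<and> F \<subseteq> A i \<and> A i \<subseteq> U
          \<and> emeasure M ((U - F) \<inter> B) \<le> ennreal (e / 2 * (1 / 2) ^ Suc i)"
        using Union.IH e by simp
      then obtain F U where FU: "\<And>i. closedin (mtop d) (F i)" "\<And>i. openin (mtop d) (U i)"
        "\<And>i. F i \<subseteq> A i" "\<And>i. A i \<subseteq> U i"
        "\<And>i. emeasure M ((U i - F i) \<inter> B) \<le> ennreal (e / 2 * (1 / 2) ^ Suc i)"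
        by metis
      \<comment> \<open>Only finite unions of the closed sets are closed. One half of
        \<open>e\<close> pays for the gaps between \<open>U i\<close> and \<open>F i\<close>, the
        other half for the tail \<open>X n\<close> that is cut off.\<close>
      define X where "X n = (\<Union>i. F i) - (\<Union>i\<le>n. F i)" for n :: nat
      have clF: "closedin (mtop d) (\<Union>i\<le>n. F i)" for n
        using FU(1) by (intro closedin_Union) auto
      have XM: "X n \<in> sets M" for n
        unfolding X_def using cl[OF FU(1)] cl[OF clF] by (intro sets.Diff sets.countable_UN) auto
      have "\<exists>n. emeasure M (X n \<inter> B) \<le> ennreal (e / 2)"
      proof (rule vanish)
        show "decseq X"
          unfolding decseq_def X_def by (meson Diff_mono UN_mono atMost_subset_iff order_refl)
        show "(\<Inter>n. X n) = {}"
          unfolding X_def by blast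
      qed (use XM e in auto)
      then obtain n where n: "emeasure M (X n \<inter> B) \<le> ennreal (e / 2)" by blast
      define G where "G = (\<Union>i\<le>n. F i)"
      have meas: "(U i - F i) \<inter> B \<in> sets M" for i
        using open_sets_M[OF FU(2)] cl[OF FU(1)] B by blast
      have UNm: "(\<Union>i. (U i - F i) \<inter> B) \<in> sets M"
        using meas by (intro sets.countable_UN) auto
      have "((\<Union>i. U i) - G) \<inter> B \<subseteq> (\<Union>i. (U i - F i) \<inter> B) \<union> (X n \<inter> B)"
        unfolding X_def G_def by blast
      then have "emeasure M (((\<Union>i. U i) - G) \<inter> B) \<le> emeasure M ((\<Union>i. (U i - F i) \<inter> B) \<union> (X n \<inter> B))"
        by (rule emeasure_mono) (rule sets.Un[OF UNm sets.Int[OF XM B(1)]])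
      also have "\<dots> \<le> emeasure M (\<Union>i. (U i - F i) \<inter> B) + emeasure M (X n \<inter> B)"
        by (rule emeasure_subadditive[OF UNm sets.Int[OF XM B(1)]])
      also have "\<dots> \<le> (\<Sum>i. ennreal (e / 2 * (1 / 2) ^ Suc i)) + ennreal (e / 2)"
      proof (rule add_mono)
        have "emeasure M (\<Union>i. (U i - F i) \<inter> B) \<le> (\<Sum>i. emeasure M ((U i - F i) \<inter> B))"
          using meas by (intro emeasure_subadditive_countably) auto
        also have "\<dots> \<le> (\<Sum>i. ennreal (e / 2 * (1 / 2) ^ Suc i))"
          using FU(5) by (intro suminf_le) auto
        finally show "emeasure M (\<Union>i. (U i - F i) \<inter> B) \<le> (\<Sum>i. ennreal (e / 2 * (1 / 2) ^ Suc i))" .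
      qed (rule n)
      also have "\<dots> = ennreal (e / 2) + ennreal (e / 2)"
        using e by (subst suminf_scaled_half_powers) auto
      also have "\<dots> = ennreal (e / 2 + e / 2)"
        using e by (intro ennreal_plus[symmetric]) auto
      also have "\<dots> = ennreal e"
        by simp
      finally have "emeasure M (((\<Union>i. U i) - G) \<inter> B) \<le> ennreal e" .
      moreover have "closedin (mtop d) G" "openin (mtop d) (\<Union>i. U i)"
        using clF FU(2) by (auto simp: G_def intro: openin_Union)
      moreover have "G \<subseteq> (\<Union>i. A i)"
        unfolding G_def by (rule UN_mono[OF subset_UNIV FU(3)])
      moreover have "(\<Union>i. A i) \<subseteq> (\<Union>i. U i)"
        by (rule UN_mono[OF order_refl FU(4)])
      ultimately show "\<exists>F U. closedin (mtop d) F \<and> openin (mtop d) U \<and> F \<subseteq> (\<Union>i. A i) \<and> (\<Union>i. A i) \<subseteq> U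
          \<and> emeasure M ((U - F) \<inter> B) \<le> ennreal e"
        by (intro exI conjI)
    qed
  qed
  then show ?thesis
    using assms(2) unfolding B_def by blast
qed

text \<open>\<open>A\<close> may have infinite measure, so it is treated ball by ball with errors
  summing to \<open>e\<close>. It need not be Borel, so \<open>regular_in_ball\<close> is applied to
  a Borel hull, which differs from the piece of \<open>A\<close> by a null set.\<close>

lemma outer_regular:
  assumes A: "A \<in> sets M" and e: "0 < e"
  obtains U where "openin (mtop d) U" "A \<subseteq> U" "emeasure M (U - A) \<le> ennreal e"
proof -
  fix z :: 'a
  define B where "B j = oball d z (real j)" for j :: nat
  have B: "B j \<in> sets M" "emeasure M (B j) < \<infinity>" for j
    by (auto simp: B_def oball_sets_M oball_fin)
  have "\<exists>V. openin (mtop d) V \<and> A \<inter> B j \<subseteq> V \<and> emeasure M (V - A) \<le> ennreal (e * (1 / 2) ^ Suc j)" for j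
  proof -
    have AB: "A \<inter> B j \<in> sets M" using A B by blast
    then obtain H where H: "H \<in> sets (borel_of_metric d)" "A \<inter> B j \<subseteq> H" "emeasure M H = emeasure M (A \<inter> B j)"
      using borel_hull by metis
    have "e * (1 / 2) ^ Suc j > 0" using e by simp
    from regular_in_ball[OF H(1) this, of z "real j"] obtain U where
      U: "openin (mtop d) U" "H \<subseteq> U"
      and U3: "\<exists>F. closedin (mtop d) F \<and> F \<subseteq> H \<and> emeasure M ((U - F) \<inter> B j) \<le> ennreal (e * (1 / 2) ^ Suc j)"
      unfolding B_def by blast
    then obtain F where F: "closedin (mtop d) F" "F \<subseteq> H" "emeasure M ((U - F) \<inter> B j) \<le> ennreal (e * (1 / 2) ^ Suc j)"
      by blast
    have HM: "H \<in> sets M" and UM: "U \<in> sets M" and FM: "F \<in> sets M"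
      using borel_sets_M[OF H(1)] open_sets_M[OF U(1)] borel_sets_M[OF closed_in_borel[OF F(1)]] by auto
    have "emeasure M (A \<inter> B j) < \<infinity>"
      using emeasure_mono[of "A \<inter> B j" "B j" M] B by (auto intro: order_le_less_trans)
    then have null: "emeasure M (H - A \<inter> B j) = 0"
      using H(2,3) HM AB by (subst emeasure_Diff) auto
    have "emeasure M (U \<inter> B j - A) \<le> emeasure M ((U - F) \<inter> B j \<union> (H - A \<inter> B j))"
      using HM AB UM FM B F(2) by (intro emeasure_mono) auto
    also have "\<dots> \<le> emeasure M ((U - F) \<inter> B j) + emeasure M (H - A \<inter> B j)"
      using HM AB UM FM B by (intro emeasure_subadditive) auto
    also have "\<dots> \<le> ennreal (e * (1 / 2) ^ Suc j)"
      using F(3) null by simp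
    finally have "emeasure M (U \<inter> B j - A) \<le> ennreal (e * (1 / 2) ^ Suc j)" .
    moreover have "openin (mtop d) (U \<inter> B j)"
      using U(1) by (simp add: B_def openin_Int openin_oball)
    ultimately show ?thesis
      using H(2) U(2) by blast
  qed
  then obtain V where V: "\<And>j. openin (mtop d) (V j)" "\<And>j. A \<inter> B j \<subseteq> V j"
    "\<And>j. emeasure M (V j - A) \<le> ennreal (e * (1 / 2) ^ Suc j)"
    by metis
  have "A \<subseteq> (\<Union>j. V j)"
  proof
    fix x assume "x \<in> A"
    moreover have "x \<in> (\<Union>j. oball d z (real j))"
      by (simp add: UN_oball)
    then obtain j where "x \<in> B j"
      by (auto simp: B_def)
    ultimately show "x \<in> (\<Union>j. V j)"
      using V(2)[of j] by auto
  qed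
  moreover have "emeasure M ((\<Union>j. V j) - A) \<le> ennreal e"
  proof -
    have eq: "(\<Union>j. V j) - A = (\<Union>j. V j - A)" by blast
    have "emeasure M ((\<Union>j. V j) - A) \<le> (\<Sum>j. emeasure M (V j - A))"
      unfolding eq by (rule emeasure_subadditive_countably) (use open_sets_M[OF V(1)] A in auto)
    also have "\<dots> \<le> (\<Sum>j. ennreal (e * (1 / 2) ^ Suc j))"
      using V(3) by (intro suminf_le) auto
    also have "\<dots> = ennreal e"
      using e by (intro suminf_scaled_half_powers) simp
    finally show ?thesis .
  qed
  moreover have "openin (mtop d) (\<Union>j. V j)"
    using V(1) by (intro openin_Union) auto
  ultimately show thesis
    using that by blast
qed

text \<open>From a closed ball, compact by properness, remove an open set that contains the part of
  the ball outside \<open>E\<close>. By outer regularity it can be taken to meet \<open>E\<close> in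
  measure at most \<open>m\<close>, less than the measure of \<open>E\<close> inside the
  ball.\<close>

lemma compact_of_positive_measure:
  assumes E: "E \<in> sets M" "0 < emeasure M E"
  obtains K where "compactin (mtop d) K" "K \<subseteq> E" "0 < emeasure M K"
proof -
  fix z :: 'a
  define B where "B j = mcball z (real j)" for j :: nat
  have clB: "closedin (mtop d) (B j)" for j
    by (simp add: B_def mtop_eq)
  have B: "B j \<in> sets M" for j
    using clB by (intro borel_sets_M closed_in_borel)
  have "\<exists>j. emeasure M (E \<inter> B j) \<noteq> 0"
  proof (rule ccontr)
    assume "\<not> ?thesis"
    then have "emeasure M (\<Union>j. E \<inter> B j) = 0"
      using E B by (intro emeasure_UN_eq_0) auto
    moreover have "(\<Union>j. E \<inter> B j) = E"
    proof -
      have "oball d z (real n) \<subseteq> B n" for n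
        by (simp add: B_def oball_def subset_iff less_imp_le)
      then have "UNIV \<subseteq> (\<Union>j. B j)"
        unfolding UN_oball[of z, symmetric] by (rule UN_mono[OF order_refl])
      then show ?thesis by blast
    qed
    ultimately show False using E(2) by simp
  qed
  then obtain j where j: "emeasure M (E \<inter> B j) \<noteq> 0" by blast
  have "\<exists>m>0. ennreal m < emeasure M (E \<inter> B j)"
  proof -
    have "0 < emeasure M (E \<inter> B j)"
      using j by (simp add: zero_less_iff_neq_zero)
    then obtain y where y: "0 < y" "y < emeasure M (E \<inter> B j)"
      using dense by blast
    then show ?thesis
      by (cases y) auto
  qed
  then obtain m where m: "m > 0" "ennreal m < emeasure M (E \<inter> B j)" by blast
  have BE: "B j - E \<in> sets M" using B E by blast
  obtain U where U: "openin (mtop d) U" "B j - E \<subseteq> U" "emeasure M (U - (B j - E)) \<le> ennreal m"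
    using outer_regular[OF BE m(1)] by blast
  define K where "K = B j - U"
  have K: "closedin (mtop d) K"
    unfolding K_def using clB U(1) by (rule closedin_diff)
  have KM: "K \<in> sets M"
    using K by (intro borel_sets_M closed_in_borel)
  have "compactin (mtop d) K"
    using K mbounded_subset[OF mbounded_mcball, of K z "real j"] by (intro proper) (simp_all add: K_def B_def)
  moreover have "K \<subseteq> E"
    using U(2) by (auto simp: K_def)
  moreover have "0 < emeasure M K"
  proof (rule ccontr)
    assume "\<not> 0 < emeasure M K"
    then have 0: "emeasure M K = 0" by simp
    have "emeasure M (E \<inter> B j) \<le> emeasure M (K \<union> (U - (B j - E)))"
      using KM open_sets_M[OF U(1)] BE by (intro emeasure_mono) (auto simp: K_def)
    also have "\<dots> \<le> emeasure M K + emeasure M (U - (B j - E))"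
      using KM open_sets_M[OF U(1)] BE by (intro emeasure_subadditive) auto
    also have "\<dots> \<le> ennreal m"
      using 0 U(3) by simp
    finally show False using m(2) by simp
  qed
  ultimately show thesis using that by blast
qed

subsection \<open>Lower semicontinuous gauges\<close>

lemma lsc_small_majorant:
  assumes fin: "p \<noteq> \<infinity>" and g: "small g"
  obtains U :: "nat \<Rightarrow> 'a set" and a :: "nat \<Rightarrow> ennreal"
  where "\<And>n. openin (mtop d) (U n)" "\<And>x. g x \<le> (SUP n. a n * indicator (U n) x)"
    "energy p M (\<lambda>x. SUP n. a n * indicator (U n) x) < \<infinity>"
proof -
  define q where "q = enn2real p"
  have q: "1 \<le> q"
    using expo_ge_1[OF p] fin by (simp add: q_def expo_def)
  have gM: "g \<in> borel_measurable M"
    using g by (auto simp: small_def intro: borel_measurable_M)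
  \<comment> \<open>\<open>int_decode\<close> lists all integer exponents, negative ones included,
    so every finite positive value of \<open>g\<close> has a level.\<close>
  define t where "t n = (2::real) powr (of_int (int_decode n))" for n :: nat
  have t: "t n > 0" for n by (simp add: t_def)
  \<comment> \<open>The value infinity is put into every level, which makes the supremum over the
    levels infinite where \<open>g\<close> is.\<close>
  define A where "A n = {x. ennreal (t n) < g x \<and> (g x \<le> ennreal (2 * t n) \<or> g x = \<infinity>)}" for n
  have A: "A n \<in> sets M" for n
  proof -
    have "{x \<in> space M. ennreal (t n) < g x \<and> (g x \<le> ennreal (2 * t n) \<or> g x = \<infinity>)} \<in> sets M"
      using gM by measurable
    then show ?thesis by (simp add: A_def)
  qed
  have pos: "(1 / 2) ^ n / (2 * t n) powr q > 0" for n
    using t[of n] by simp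
  have "\<exists>U. openin (mtop d) U \<and> A n \<subseteq> U \<and> emeasure M (U - A n) \<le> ennreal ((1 / 2) ^ n / (2 * t n) powr q)" for n
    using outer_regular[OF A pos] by metis
  then obtain U where U: "\<And>n. openin (mtop d) (U n)" "\<And>n. A n \<subseteq> U n"
    "\<And>n. emeasure M (U n - A n) \<le> ennreal ((1 / 2) ^ n / (2 * t n) powr q)"
    by metis
  have ge: "g x \<le> (SUP n. ennreal (2 * t n) * indicator (U n) x)" for x
  proof (cases "g x")
    case (real y)
    show ?thesis
    proof (cases "y = 0")
      case False
      with real have y: "y > 0" by simp
      \<comment> \<open>The lower bound in \<open>A\<close> is strict and the upper one is not, so a
        value that equals a power of two belongs to the level below it; hence the ceiling minus
        one.\<close>
      define k where "k = \<lceil>log 2 y\<rceil> - 1"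
      define n where "n = int_encode k"
      have k: "of_int k < log 2 y" "log 2 y \<le> of_int k + 1"
        unfolding k_def by linarith+
      have tn: "t n = 2 powr of_int k"
        by (simp add: t_def n_def)
      have "2 powr of_int k < 2 powr log 2 y"
        using k(1) by simp
      then have 1: "t n < y"
        using y tn by simp
      have "2 powr log 2 y \<le> 2 powr (of_int k + 1)"
        using k(2) by simp
      then have 2: "y \<le> 2 * t n"
        using y tn by (simp add: powr_add)
      have "x \<in> A n"
        using 1 2 real t[of n] by (simp add: A_def ennreal_less_iff)
      then have "x \<in> U n" using U(2) by blast
      then have "g x \<le> ennreal (2 * t n) * indicator (U n) x"
        using 2 real by (simp add: ennreal_leI)
      then show ?thesis
        by (rule SUP_upper2[OF UNIV_I])
    qed (use real in simp)
  next
    case top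
    have "of_nat m \<le> (SUP n. ennreal (2 * t n) * indicator (U n) x)" for m
    proof -
      define n where "n = int_encode (int m)"
      have "x \<in> A n" using top by (simp add: A_def)
      then have "x \<in> U n" using U(2) by blast
      have "real m \<le> 2 ^ m"
        by (meson less_imp_le of_nat_less_two_power)
      also have "\<dots> \<le> 2 * 2 ^ m"
        by simp
      finally have "real m \<le> 2 * t n"
        by (simp add: t_def n_def powr_realpow)
      then have "of_nat m \<le> ennreal (2 * t n) * indicator (U n) x"
        using \<open>x \<in> U n\<close> by (simp add: ennreal_of_nat_eq_real_of_nat ennreal_leI)
      then show ?thesis
        by (rule SUP_upper2[OF UNIV_I])
    qed
    then have "(SUP n. ennreal (2 * t n) * indicator (U n) x) = top"
      by (meson ennreal_Ex_less_of_nat leD less_top)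
    then show ?thesis by (rule ssubst) simp
  qed
  have UM: "U n \<in> sets M" for n
    using U(1) by (rule open_sets_M)
  have en: "energy p M (\<lambda>x. ennreal (2 * t n) * indicator (U n) x)
      \<le> (\<integral>\<^sup>+ x. ennreal ((2 * t n) powr q) * indicator (A n) x \<partial>M) + ennreal ((1 / 2) ^ n)" for n
  proof -
    have "energy p M (\<lambda>x. ennreal (2 * t n) * indicator (U n) x)
        = (\<integral>\<^sup>+ x. ennreal ((2 * t n) powr q) * indicator (U n) x \<partial>M)"
      using fin t[of n] q unfolding energy_def
      by (auto intro!: nn_integral_cong simp: enn_pow_def q_def indicator_def)
    also have "\<dots> = ennreal ((2 * t n) powr q) * emeasure M (U n)"
      using UM by (simp add: nn_integral_cmult_indicator)
    finally have 1: "energy p M (\<lambda>x. ennreal (2 * t n) * indicator (U n) x) = ennreal ((2 * t n) powr q) * emeasure M (U n)" .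
    have "emeasure M (U n) \<le> emeasure M (A n) + emeasure M (U n - A n)"
      using emeasure_subadditive[of "A n" M "U n - A n"] UM A U(2)[of n] by (simp add: Un_absorb1)
    also have "\<dots> \<le> emeasure M (A n) + ennreal ((1 / 2) ^ n / (2 * t n) powr q)"
      using U(3) by (intro add_left_mono)
    finally have "ennreal ((2 * t n) powr q) * emeasure M (U n)
      \<le> ennreal ((2 * t n) powr q) * (emeasure M (A n) + ennreal ((1 / 2) ^ n / (2 * t n) powr q))"
      by (rule mult_left_mono) simp
    also have "ennreal ((2 * t n) powr q) * (emeasure M (A n) + ennreal ((1 / 2) ^ n / (2 * t n) powr q))
      = ennreal ((2 * t n) powr q) * emeasure M (A n) + ennreal ((1 / 2) ^ n)"
      using t[of n] by (simp add: distrib_left ennreal_mult[symmetric])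
    also have "\<dots> = (\<integral>\<^sup>+ x. ennreal ((2 * t n) powr q) * indicator (A n) x \<partial>M) + ennreal ((1 / 2) ^ n)"
      using A by (simp add: nn_integral_cmult_indicator)
    finally show ?thesis
      unfolding 1 .
  qed
  \<comment> \<open>A finite value lies in at most one level, where \<open>2 * t n\<close> is below
    \<open>2 * g x\<close>; at an infinite value the right-hand side is infinite.\<close>
  have pointwise: "(\<Sum>n. ennreal ((2 * t n) powr q) * indicator (A n) x) \<le> enn_pow (ennreal 2 * g x) q" for x
  proof (cases "g x")
    case (real y)
    show ?thesis
    proof (cases "\<exists>m. x \<in> A m")
      case True
      then obtain m where m: "x \<in> A m" by blast
      have y: "t m < y" "y \<le> 2 * t m"
        using m real t[of m] by (auto simp: A_def ennreal_less_iff)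
      have uniq: "n = m" if "x \<in> A n" for n
      proof -
        have z: "t n < y" "y \<le> 2 * t n"
          using that real t[of n] by (auto simp: A_def ennreal_less_iff)
        have "2 powr of_int (int_decode n) < (2::real) powr (of_int (int_decode m) + 1)"
          using z(1) y(2) by (simp add: t_def powr_add)
        moreover have "2 powr of_int (int_decode m) < (2::real) powr (of_int (int_decode n) + 1)"
          using y(1) z(2) by (simp add: t_def powr_add)
        ultimately have "int_decode n = int_decode m"
          by simp
        then show ?thesis
          by (metis int_decode_inverse)
      qed
      have "(\<Sum>n. ennreal ((2 * t n) powr q) * indicator (A n) x)
          = (\<Sum>n\<in>{m}. ennreal ((2 * t n) powr q) * indicator (A n) x)"
        by (rule suminf_finite) (use uniq in \<open>auto simp: indicator_def\<close>)
      also have "\<dots> = ennreal ((2 * t m) powr q)"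
        using m by simp
      also have "\<dots> \<le> ennreal ((2 * y) powr q)"
        using y t[of m] q by (intro ennreal_leI powr_mono2) auto
      also have "\<dots> = enn_pow (ennreal 2 * g x) q"
        using real by (simp add: enn_pow_def ennreal_mult[symmetric] ennreal_mult_eq_top_iff del: ennreal_numeral)
      finally show ?thesis .
    next
      case False
      then show ?thesis by simp
    qed
  next
    case top
    then show ?thesis
      by (simp add: enn_pow_def ennreal_mult_top del: ennreal_numeral)
  qed
  have sum_le: "(\<Sum>n. \<integral>\<^sup>+ x. ennreal ((2 * t n) powr q) * indicator (A n) x \<partial>M) \<le> ennreal (2 powr expo p) * energy p M g"
  proof -
    have "(\<Sum>n. \<integral>\<^sup>+ x. ennreal ((2 * t n) powr q) * indicator (A n) x \<partial>M)
        = (\<integral>\<^sup>+ x. (\<Sum>n. ennreal ((2 * t n) powr q) * indicator (A n) x) \<partial>M)"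
      using A by (intro nn_integral_suminf[symmetric] borel_measurable_times_ennreal borel_measurable_indicator) auto
    also have "\<dots> \<le> (\<integral>\<^sup>+ x. enn_pow (ennreal 2 * g x) q \<partial>M)"
      by (intro nn_integral_mono pointwise)
    also have "\<dots> = energy p M (\<lambda>x. ennreal 2 * g x)"
      using fin by (simp add: energy_def q_def)
    also have "\<dots> \<le> ennreal (2 powr expo p) * energy p M g"
      using gM by (intro energy_cmult p) auto
    finally show ?thesis .
  qed
  have "energy p M (\<lambda>x. SUP n. ennreal (2 * t n) * indicator (U n) x)
      \<le> (\<Sum>n. energy p M (\<lambda>x. ennreal (2 * t n) * indicator (U n) x))"
    using UM by (intro energy_SUP_le p borel_measurable_times_ennreal borel_measurable_indicator) auto
  also have "\<dots> \<le> (\<Sum>n. (\<integral>\<^sup>+ x. ennreal ((2 * t n) powr q) * indicator (A n) x \<partial>M) + ennreal ((1 / 2) ^ n))"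
    using en by (intro suminf_le) auto
  also have "\<dots> = (\<Sum>n. \<integral>\<^sup>+ x. ennreal ((2 * t n) powr q) * indicator (A n) x \<partial>M) + (\<Sum>n. ennreal ((1 / 2) ^ n))"
    by (rule suminf_add[symmetric]) auto
  also have "\<dots> \<le> ennreal (2 powr expo p) * energy p M g + (\<Sum>n. ennreal ((1 / 2) ^ n))"
    using sum_le by (rule add_right_mono)
  also have "\<dots> < \<infinity>"
    using g suminf_half_powers unfolding small_def by (auto simp: ennreal_mult_less_top)
  finally show thesis
    by (rule that[OF U(1) ge])
qed

(* For finite p the gauge is w k = h / (k + 1) with h lower semicontinuous, and a curve is good iff its
   h-integral is finite; for infinite p the w k are indicators of open sets decreasing to a null set,
   and a curve is good iff it spends no time in that null set. *)
definition good :: "(nat \<Rightarrow> 'a \<Rightarrow> ennreal) \<Rightarrow> real \<Rightarrow> (real \<Rightarrow> 'a) \<Rightarrow> bool" where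
  "good w L c \<longleftrightarrow> (INF k. arc_int (w k) L c) = 0"

definition gauge :: "(nat \<Rightarrow> 'a \<Rightarrow> ennreal) \<Rightarrow> bool" where
  "gauge w \<longleftrightarrow> (\<forall>k. lsc d (w k)) \<and> (\<forall>k x. w (Suc k) x \<le> w k x)"

lemma gauge_finite_p:
  assumes fin: "p \<noteq> \<infinity>" and g: "small g"
  obtains w h where "gauge w" "small h"
    "\<And>L c. lip_curve d L c \<Longrightarrow> good w L c \<Longrightarrow> arc_int g L c < \<infinity>"
    "\<And>L c. lip_curve d L c \<Longrightarrow> arc_int h L c < \<infinity> \<Longrightarrow> good w L c"
proof -
  obtain U and a :: "nat \<Rightarrow> ennreal" where U: "\<And>n. openin (mtop d) (U n)"
    and ge: "\<And>x. g x \<le> (SUP n. a n * indicator (U n) x)"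
    and en: "energy p M (\<lambda>x. SUP n. a n * indicator (U n) x) < \<infinity>"
    by (rule lsc_small_majorant[OF fin g]) (rule that)
  define h where "h x = (SUP n. a n * indicator (U n) x)" for x
  have "lsc d h"
    unfolding h_def using U by (rule lsc_SUP_indicator)
  then have hm: "h \<in> borel_measurable (borel_of_metric d)"
    by (rule lsc_measurable)
  have small: "small h"
    using hm en by (simp add: small_def h_def[abs_def])
  define b where "b k = ennreal (1 / Suc k)" for k
  define w where "w k x = b k * h x" for k x
  have "lsc d (w k)" for k
  proof -
    have "w k = (\<lambda>x. SUP n. (b k * a n) * indicator (U n) x)"
      by (simp add: w_def h_def SUP_mult_left_ennreal mult.assoc fun_eq_iff)
    then show ?thesis
      using lsc_SUP_indicator[OF U] by simp
  qed
  moreover have "w (Suc k) x \<le> w k x" for k x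
  proof -
    have "1 / real (Suc (Suc k)) \<le> 1 / real (Suc k)"
      by (intro divide_left_mono) auto
    then show ?thesis
      unfolding w_def b_def by (intro mult_right_mono ennreal_leI) auto
  qed
  ultimately have "gauge w"
    by (simp add: gauge_def)
  have int: "arc_int (w k) L c = b k * arc_int h L c" if "lip_curve d L c" for k L c
    unfolding w_def using arc_int_cmult[OF that hm] .
  have b: "(\<lambda>k. b k * ennreal r) \<longlonglongrightarrow> 0" for r
  proof -
    have "(\<lambda>k. 1 / real (Suc k) * r) \<longlonglongrightarrow> 0 * r"
      by (intro tendsto_mult tendsto_const LIMSEQ_Suc lim_1_over_n)
    then have "(\<lambda>k. ennreal (1 / real (Suc k) * r)) \<longlonglongrightarrow> ennreal (0 * r)"
      by (rule tendsto_ennrealI)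
    then show ?thesis
      by (simp add: b_def ennreal_mult'[symmetric])
  qed
  show thesis
  proof (rule that[OF \<open>gauge w\<close> small])
    fix L c assume c: "lip_curve d L c"
    show "arc_int g L c < \<infinity>" if "good w L c"
    proof -
      have "arc_int h L c \<noteq> top"
      proof
        assume "arc_int h L c = top"
        then have "(INF k. arc_int (w k) L c) = top"
          using int[OF c] by (simp add: b_def ennreal_mult_top)
        then show False using that by (simp add: good_def)
      qed
      then have "arc_int h L c < \<infinity>"
        by (simp add: less_top)
      moreover have "arc_int g L c \<le> arc_int h L c"
        using ge by (intro arc_int_mono) (simp add: h_def)
      ultimately show ?thesis
        by (rule le_less_trans[rotated])
    qed
    show "good w L c" if fin: "arc_int h L c < \<infinity>"
    proof -
      obtain r where r: "arc_int h L c = ennreal r"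
        using fin by (cases "arc_int h L c") auto
      have "(INF k. arc_int (w k) L c) \<le> 0"
      proof (rule LIMSEQ_le_const[OF b[of r]])
        show "\<exists>N. \<forall>n\<ge>N. (INF k. arc_int (w k) L c) \<le> b n * ennreal r"
          using int[OF c] r by (auto intro!: exI[of _ 0] INF_lower2)
      qed
      then show ?thesis by (simp add: good_def)
    qed
  qed
qed

text \<open>Finite energy means that \<open>g \<le> C\<close> off a null set \<open>N\<close>, so a
  curve spending no time in \<open>N\<close> has integral at most \<open>C * L\<close>. Outer
  regularity puts \<open>N\<close> inside a null intersection \<open>G\<close> of open sets, and
  \<open>\<infinity> * indicator G\<close> excludes the curves that spend time in
  \<open>G\<close>.\<close>

lemma gauge_infinite_p:
  assumes inf: "p = \<infinity>" and g: "small g"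
  obtains w h where "gauge w" "small h"
    "\<And>L c. lip_curve d L c \<Longrightarrow> good w L c \<Longrightarrow> arc_int g L c < \<infinity>"
    "\<And>L c. lip_curve d L c \<Longrightarrow> arc_int h L c < \<infinity> \<Longrightarrow> good w L c"
proof -
  define C where "C = Linf_norm M g"
  have C: "C < top"
    using g unfolding small_def energy_def C_def by (simp add: inf)
  have gm: "g \<in> borel_measurable (borel_of_metric d)"
    using g by (simp add: small_def)
  define N where "N = {x. C < g x}"
  have Nb: "N \<in> sets (borel_of_metric d)"
  proof -
    have "{x \<in> space (borel_of_metric d). C < g x} \<in> sets (borel_of_metric d)"
      using gm by measurable
    then show ?thesis by (simp add: N_def)
  qed
  then have NM: "N \<in> sets M" by (rule borel_sets_M)
  have N0: "emeasure M N = 0"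
    using AE_le_Linf_norm[of g M] NM AE_iff_measurable[of N M "\<lambda>x. g x \<le> C"]
    by (simp add: C_def N_def not_le)
  have "\<exists>U. openin (mtop d) U \<and> N \<subseteq> U \<and> emeasure M (U - N) \<le> ennreal (1 / Suc n)" for n
    using outer_regular[OF NM, of "1 / Suc n"] by (metis of_nat_0_less_iff zero_less_Suc zero_less_divide_1_iff)
  then obtain V where V: "\<And>n. openin (mtop d) (V n)" "\<And>n. N \<subseteq> V n" "\<And>n. emeasure M (V n - N) \<le> ennreal (1 / Suc n)"
    by metis
  \<comment> \<open>Finite intersections stay open and make the indicators decrease, as a gauge
    demands.\<close>
  define U where "U n = (\<Inter>i\<le>n. V i)" for n
  have U: "openin (mtop d) (U n)" for n
    unfolding U_def using V(1) by (intro openin_INT2) auto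
  have NU: "N \<subseteq> U n" for n
    unfolding U_def using V(2) by (intro INT_greatest)
  define G where "G = (\<Inter>n. U n)"
  have Gb: "G \<in> sets (borel_of_metric d)"
    unfolding G_def by (intro sets.countable_INT) (auto intro: open_in_borel U)
  then have GM: "G \<in> sets M" by (rule borel_sets_M)
  have NG: "N \<subseteq> G"
    unfolding G_def using NU by (intro INT_greatest)
  have G0: "emeasure M G = 0"
  proof -
    have "emeasure M G \<le> ennreal (1 / Suc n)" for n
    proof -
      have sub: "G \<subseteq> N \<union> (V n - N)"
        unfolding G_def U_def by auto
      have "emeasure M G \<le> emeasure M (N \<union> (V n - N))"
        by (rule emeasure_mono[OF sub]) (use NM open_sets_M[OF V(1)] in auto)
      also have "\<dots> \<le> emeasure M N + emeasure M (V n - N)"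
        using NM open_sets_M[OF V(1)] by (intro emeasure_subadditive) auto
      also have "\<dots> \<le> ennreal (1 / Suc n)"
        using N0 V(3) by simp
      finally show ?thesis .
    qed
    moreover have "(\<lambda>n. ennreal (1 / Suc n)) \<longlonglongrightarrow> ennreal 0"
      by (intro tendsto_ennrealI LIMSEQ_Suc lim_1_over_n)
    ultimately have "emeasure M G \<le> ennreal 0"
      by (intro LIMSEQ_le_const[of _ "ennreal 0"]) auto
    then show ?thesis by simp
  qed
  define w :: "nat \<Rightarrow> 'a \<Rightarrow> ennreal" where "w k = indicator (U k)" for k
  define h :: "'a \<Rightarrow> ennreal" where "h x = \<infinity> * indicator G x" for x
  have lscw: "lsc d (w k)" for k
    using lsc_SUP_indicator[of "\<lambda>_::nat. U k" "\<lambda>_. 1"] U by (simp add: w_def)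
  have decU: "U (Suc k) \<subseteq> U k" for k
    unfolding U_def by (intro INT_anti_mono) auto
  then have decw: "w (Suc k) x \<le> w k x" for k x
    using decU[of k] by (auto simp: w_def indicator_def)
  have gauge: "gauge w"
    using lscw decw by (simp add: gauge_def)
  have "small h"
    unfolding small_def
  proof
    show "h \<in> borel_measurable (borel_of_metric d)"
      unfolding h_def using Gb by measurable
    have "AE x in M. x \<notin> G"
      using GM G0 by (auto intro!: AE_I[of _ _ G])
    then have "AE x in M. h x \<le> 0"
      by eventually_elim (simp add: h_def)
    then show "energy p M h < \<infinity>"
      using inf Linf_norm_le[of h 0 M] by (simp add: energy_def)
  qed
  have wm: "w k \<in> borel_measurable (borel_of_metric d)" for k
    using lscw by (rule lsc_measurable)
  show thesis
  proof (rule that[OF gauge \<open>small h\<close>])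
    fix L c assume c: "lip_curve d L c"
    note cm = arc_integrand_measurable[OF c]
    show "arc_int g L c < \<infinity>" if "good w L c"
    proof -
      have Nm: "indicator N \<in> borel_measurable (borel_of_metric d)"
        using Nb by simp
      have "arc_int (indicator N) L c \<le> (INF k. arc_int (w k) L c)"
      proof (rule INF_greatest)
        fix k show "arc_int (indicator N) L c \<le> arc_int (w k) L c"
          using NU[of k] by (intro arc_int_mono) (auto simp: w_def indicator_def)
      qed
      then have 0: "arc_int (indicator N) L c = 0"
        using that by (simp add: good_def)
      have Nm': "(\<lambda>s. indicator {0..L} s * indicator N (c s) :: ennreal) \<in> borel_measurable lborel"
        using cm[OF Nm] by simp
      have gle: "g x \<le> C + \<infinity> * indicator N x" for x
        by (cases "x \<in> N") (auto simp: N_def not_less)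
      have "arc_int g L c \<le> arc_int (\<lambda>x. C + \<infinity> * indicator N x) L c"
        by (rule arc_int_mono) (rule gle)
      also have "\<dots> = (\<integral>\<^sup>+ s. C * indicator {0..L} s + \<infinity> * (indicator {0..L} s * indicator N (c s)) \<partial>lborel)"
        unfolding arc_int_def by (intro nn_integral_cong) (simp add: indicator_def)
      also have "\<dots> = (\<integral>\<^sup>+ s. C * indicator {0..L} s \<partial>lborel) + (\<integral>\<^sup>+ s. \<infinity> * (indicator {0..L} s * indicator N (c s)) \<partial>lborel)"
        by (rule nn_integral_add[OF _ borel_measurable_times_ennreal[OF borel_measurable_const Nm']]) simp
      also have "(\<integral>\<^sup>+ s. \<infinity> * (indicator {0..L} s * indicator N (c s)) \<partial>lborel) = \<infinity> * arc_int (indicator N) L c"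
        unfolding arc_int_def using cm[OF Nm] by (intro nn_integral_cmult) simp
      also have "\<dots> = 0" using 0 by simp
      also have "(\<integral>\<^sup>+ s. C * indicator {0..L} s \<partial>lborel) = C * ennreal L"
        using c by (simp add: nn_integral_cmult_indicator lip_curve_def)
      also have "C * ennreal L + 0 < \<infinity>"
        using C by (simp add: ennreal_mult_less_top)
      finally show ?thesis .
    qed
    show "good w L c" if fin: "arc_int h L c < \<infinity>"
    proof -
      have Gm: "indicator G \<in> borel_measurable (borel_of_metric d)"
        using Gb by simp
      have "arc_int h L c = \<infinity> * arc_int (indicator G) L c"
        unfolding h_def using c Gm by (rule arc_int_cmult)
      then have 0: "arc_int (indicator G) L c = 0"
        using fin by (simp add: ennreal_top_mult split: if_splits)
      \<comment> \<open>Finiteness of the \<open>h\<close>-integral controls only the time in the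
        limit set \<open>G\<close>. Monotone convergence from above carries this back to the open
        sets; it needs a finite first integral, which the finite length \<open>L\<close>
        provides.\<close>
      have "(\<integral>\<^sup>+ s. (INF k. indicator {0..L} s * w k (c s)) \<partial>lborel)
          = (INF k. \<integral>\<^sup>+ s. indicator {0..L} s * w k (c s) \<partial>lborel)"
      proof (rule nn_integral_monotone_convergence_INF_decseq)
        show "decseq (\<lambda>k s. indicator {0..L} s * w k (c s))"
          using decw by (auto intro!: decseq_SucI le_funI mult_left_mono)
        show "(\<lambda>s. indicator {0..L} s * w k (c s)) \<in> borel_measurable lborel" for k
          using cm[OF wm] by simp
        have "(\<integral>\<^sup>+ s. indicator {0..L} s * w 0 (c s) \<partial>lborel) \<le> (\<integral>\<^sup>+ s. indicator {0..L} s \<partial>lborel)"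
          by (intro nn_integral_mono) (auto simp: w_def indicator_def)
        also have "\<dots> < \<infinity>"
          using c by (simp add: lip_curve_def)
        finally show "(\<integral>\<^sup>+ s. indicator {0..L} s * w 0 (c s) \<partial>lborel) < \<infinity>" .
      qed
      also have "(\<lambda>s. INF k. indicator {0..L} s * w k (c s)) = (\<lambda>s. indicator {0..L} s * indicator G (c s))"
      proof
        fix s
        have "(INF k. indicator (U k) (c s)) = (indicator G (c s) :: ennreal)"
        proof (cases "c s \<in> G")
          case True
          then have "\<And>k. c s \<in> U k" by (auto simp: G_def)
          then show ?thesis using True by simp
        next
          case False
          then obtain k where "c s \<notin> U k" by (auto simp: G_def)
          then have "(INF k. indicator (U k) (c s)) \<le> (0 :: ennreal)"
            by (intro INF_lower2[of k]) auto
          then show ?thesis using False by simp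
        qed
        then show "(INF k. indicator {0..L} s * w k (c s)) = indicator {0..L} s * indicator G (c s)"
          by (auto simp: w_def indicator_def)
      qed
      finally show ?thesis
        using 0 by (simp add: good_def arc_int_def)
    qed
  qed
qed

lemma gauge_exists:
  assumes "small g"
  obtains w h where "gauge w" "small h"
    "\<And>L c. lip_curve d L c \<Longrightarrow> good w L c \<Longrightarrow> arc_int g L c < \<infinity>"
    "\<And>L c. lip_curve d L c \<Longrightarrow> arc_int h L c < \<infinity> \<Longrightarrow> good w L c"
proof (cases "p = \<infinity>")
  case True
  show thesis
    by (rule gauge_infinite_p[OF True assms]) (rule that)
next
  case False
  show thesis
    by (rule gauge_finite_p[OF False assms]) (rule that)
qed

subsection \<open>Operations on curves\<close>

lemma arc_int_affine:
  assumes c: "lip_curve d L c" and g: "g \<in> borel_measurable (borel_of_metric d)" and k: "k = 1 \<or> k = - 1"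
  shows "(\<integral>\<^sup>+ s. indicator {a..b} s * g (c s) \<partial>lborel) = (\<integral>\<^sup>+ s. indicator {a..b} (t + k * s) * g (c (t + k * s)) \<partial>lborel)"
proof -
  have m: "(\<lambda>s. indicator {a..b} s * g (c s)) \<in> borel_measurable borel"
    by (intro borel_measurable_times_ennreal borel_measurable_indicator
        measurable_compose[OF lip_curve_measurable[OF c] g]) simp
  show ?thesis
    using nn_integral_real_affine[OF m, of k t] k by auto
qed

lemma lip_curve_sub:
  assumes "lip_curve d L c" "0 \<le> a" "a \<le> b" "b \<le> L"
  shows "lip_curve d (b - a) (\<lambda>s. c (a + s))"
    and "g \<in> borel_measurable (borel_of_metric d) \<Longrightarrow> arc_int g (b - a) (\<lambda>s. c (a + s)) \<le> arc_int g L c"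
proof -
  show "lip_curve d (b - a) (\<lambda>s. c (a + s))"
    using assms unfolding lip_curve_def by (auto dest: spec[of _ "a + _"]) (metis add_diff_cancel_left)
  assume g: "g \<in> borel_measurable (borel_of_metric d)"
  have "arc_int g (b - a) (\<lambda>s. c (a + s)) = (\<integral>\<^sup>+ s. indicator {a..b} (a + 1 * s) * g (c (a + 1 * s)) \<partial>lborel)"
    unfolding arc_int_def by (intro nn_integral_cong) (auto simp: indicator_def)
  also have "\<dots> = (\<integral>\<^sup>+ s. indicator {a..b} s * g (c s) \<partial>lborel)"
    using arc_int_affine[OF assms(1) g, of 1 a b a] by simp
  also have "\<dots> \<le> arc_int g L c"
    unfolding arc_int_def using assms by (intro nn_integral_mono) (auto simp: indicator_def)
  finally show "arc_int g (b - a) (\<lambda>s. c (a + s)) \<le> arc_int g L c" .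
qed

lemma lip_curve_reverse:
  assumes "lip_curve d L c"
  shows "lip_curve d L (\<lambda>s. c (L - s))"
    and "g \<in> borel_measurable (borel_of_metric d) \<Longrightarrow> arc_int g L (\<lambda>s. c (L - s)) = arc_int g L c"
proof -
  have "d (c (L - s)) (c (L - t)) \<le> \<bar>s - t\<bar>" for s t
  proof -
    have "d (c (L - s)) (c (L - t)) \<le> \<bar>(L - s) - (L - t)\<bar>"
      using assms unfolding lip_curve_def by blast
    then show ?thesis by linarith
  qed
  then show "lip_curve d L (\<lambda>s. c (L - s))"
    using assms by (simp add: lip_curve_def)
  assume g: "g \<in> borel_measurable (borel_of_metric d)"
  have "arc_int g L (\<lambda>s. c (L - s)) = (\<integral>\<^sup>+ s. indicator {0..L} (L + (- 1) * s) * g (c (L + (- 1) * s)) \<partial>lborel)"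
    unfolding arc_int_def by (intro nn_integral_cong) (auto simp: indicator_def)
  also have "\<dots> = arc_int g L c"
    unfolding arc_int_def by (rule arc_int_affine[OF assms g, symmetric]) simp
  finally show "arc_int g L (\<lambda>s. c (L - s)) = arc_int g L c" .
qed

definition join :: "real \<Rightarrow> (real \<Rightarrow> 'a) \<Rightarrow> (real \<Rightarrow> 'a) \<Rightarrow> real \<Rightarrow> 'a" where
  "join L c1 c2 s = (if s \<le> L then c1 s else c2 (s - L))"

lemma lip_curve_join:
  assumes c1: "lip_curve d L1 c1" and c2: "lip_curve d L2 c2" and eq: "c1 L1 = c2 0"
  shows "lip_curve d (L1 + L2) (join L1 c1 c2)"
    and "g \<in> borel_measurable (borel_of_metric d) \<Longrightarrow>
      arc_int g (L1 + L2) (join L1 c1 c2) \<le> arc_int g L1 c1 + arc_int g L2 c2"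
proof -
  have l1: "d (c1 s) (c1 t) \<le> \<bar>s - t\<bar>" and l2: "d (c2 s) (c2 t) \<le> \<bar>s - t\<bar>" for s t
    using c1 c2 by (auto simp: lip_curve_def)
  have "d (join L1 c1 c2 s) (join L1 c1 c2 t) \<le> \<bar>s - t\<bar>" for s t
  proof (induction s t rule: linorder_wlog)
    case (le s t)
    consider "t \<le> L1" | "s \<le> L1" "L1 < t" | "L1 < s"
      using le by linarith
    then show ?case
    proof cases
      case 1
      then show ?thesis using l1[of s t] le by (simp add: join_def)
    next
      case 2
      have "d (c1 s) (c2 (t - L1)) \<le> d (c1 s) (c1 L1) + d (c2 0) (c2 (t - L1))"
        using tri[of "c1 s" "c2 (t - L1)" "c1 L1"] eq by simp
      also have "\<dots> \<le> \<bar>s - L1\<bar> + \<bar>0 - (t - L1)\<bar>"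
        by (intro add_mono l1 l2)
      finally show ?thesis using 2 by (simp add: join_def)
    next
      case 3
      then show ?thesis using l2[of "s - L1" "t - L1"] le by (simp add: join_def)
    qed
  next
    case (sym s t)
    then show ?case by (simp add: commute[of "join L1 c1 c2 t"] abs_minus_commute)
  qed
  then show "lip_curve d (L1 + L2) (join L1 c1 c2)"
    using c1 c2 by (simp add: lip_curve_def)
  assume g: "g \<in> borel_measurable (borel_of_metric d)"
  have c2': "lip_curve d L2 (\<lambda>s. c2 (s - L1))"
  proof -
    have "d (c2 (s - L1)) (c2 (t - L1)) \<le> \<bar>s - t\<bar>" for s t
      using l2[of "s - L1" "t - L1"] by simp
    then show ?thesis using c2 by (simp add: lip_curve_def)
  qed
  have m1: "(\<lambda>s. indicator {0..L1} s * g (c1 s)) \<in> borel_measurable lborel"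
    using arc_integrand_measurable[OF c1 g] by simp
  have m2: "(\<lambda>s. indicator {L1..L1 + L2} s * g (c2 (s - L1))) \<in> borel_measurable lborel"
  proof -
    have "(\<lambda>s. indicator {L1..L1 + L2} s * g (c2 (s - L1))) \<in> borel_measurable borel"
      by (intro borel_measurable_times_ennreal borel_measurable_indicator
          measurable_compose[OF lip_curve_measurable[OF c2'] g]) simp
    then show ?thesis by simp
  qed
  have "arc_int g (L1 + L2) (join L1 c1 c2)
      \<le> (\<integral>\<^sup>+ s. indicator {0..L1} s * g (c1 s) + indicator {L1..L1 + L2} s * g (c2 (s - L1)) \<partial>lborel)"
    unfolding arc_int_def by (intro nn_integral_mono) (auto simp: indicator_def join_def)
  also have "\<dots> = arc_int g L1 c1 + (\<integral>\<^sup>+ s. indicator {L1..L1 + L2} s * g (c2 (s - L1)) \<partial>lborel)"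
    unfolding arc_int_def using m1 m2 by (rule nn_integral_add)
  also have "(\<integral>\<^sup>+ s. indicator {L1..L1 + L2} s * g (c2 (s - L1)) \<partial>lborel)
      = (\<integral>\<^sup>+ s. indicator {L1..L1 + L2} (L1 + 1 * s) * g (c2 (L1 + 1 * s - L1)) \<partial>lborel)"
    by (rule arc_int_affine[OF c2' g]) simp
  also have "\<dots> = arc_int g L2 c2"
    unfolding arc_int_def by (intro nn_integral_cong) (auto simp: indicator_def)
  finally show "arc_int g (L1 + L2) (join L1 c1 c2) \<le> arc_int g L1 c1 + arc_int g L2 c2" .
qed

lemma gauge_measurable: "gauge w \<Longrightarrow> w k \<in> borel_measurable (borel_of_metric d)"
  by (rule lsc_measurable) (simp add: gauge_def)

lemma gauge_antimono:
  assumes "gauge w" "j \<le> k"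
  shows "arc_int (w k) L c \<le> arc_int (w j) L c"
proof -
  have "w k x \<le> w j x" for x
    using assms(2) by (rule lift_Suc_antimono_le[rotated]) (use assms(1) in \<open>simp add: gauge_def\<close>)
  then show ?thesis by (rule arc_int_mono)
qed

lemma good_iff: "good w L c \<longleftrightarrow> (\<forall>e>0. \<exists>k. arc_int (w k) L c \<le> ennreal e)"
proof
  assume g: "good w L c"
  show "\<forall>e>0. \<exists>k. arc_int (w k) L c \<le> ennreal e"
  proof (intro allI impI)
    fix e :: real assume "e > 0"
    then have "(INF k. arc_int (w k) L c) < ennreal e"
      using g by (simp add: good_def)
    then show "\<exists>k. arc_int (w k) L c \<le> ennreal e"
      unfolding INF_less_iff by (auto intro: less_imp_le)
  qed
next
  assume *: "\<forall>e>0. \<exists>k. arc_int (w k) L c \<le> ennreal e"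
  have "(INF k. arc_int (w k) L c) \<le> 0"
  proof (rule ennreal_le_epsilon)
    fix e :: real assume "e > 0"
    then obtain k where "arc_int (w k) L c \<le> ennreal e" using * by auto
    then show "(INF k. arc_int (w k) L c) \<le> 0 + ennreal e"
      by (auto intro: INF_lower2)
  qed
  then show "good w L c" by (simp add: good_def)
qed

lemma good_reverse:
  assumes "gauge w" "lip_curve d L c" "good w L c"
  shows "good w L (\<lambda>s. c (L - s))"
  using assms(3) unfolding good_def lip_curve_reverse(2)[OF assms(2) gauge_measurable[OF assms(1)]] .

lemma good_join:
  assumes w: "gauge w" and c1: "lip_curve d L1 c1" "good w L1 c1" and c2: "lip_curve d L2 c2" "good w L2 c2"
    and eq: "c1 L1 = c2 0"
  shows "good w (L1 + L2) (join L1 c1 c2)"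
  unfolding good_iff
proof (intro allI impI)
  fix e :: real assume e: "e > 0"
  then have e2: "e / 2 > 0" by simp
  obtain j where j: "arc_int (w j) L1 c1 \<le> ennreal (e / 2)"
    using c1(2) e2 good_iff by blast
  obtain k where k: "arc_int (w k) L2 c2 \<le> ennreal (e / 2)"
    using c2(2) e2 good_iff by blast
  \<comment> \<open>Gauges decrease in their index, so the larger of the two indices serves both
    pieces.\<close>
  have "arc_int (w (max j k)) (L1 + L2) (join L1 c1 c2)
      \<le> arc_int (w (max j k)) L1 c1 + arc_int (w (max j k)) L2 c2"
    by (rule lip_curve_join(2)[OF c1(1) c2(1) eq gauge_measurable[OF w]])
  also have "\<dots> \<le> ennreal (e / 2) + ennreal (e / 2)"
    by (intro add_mono order_trans[OF gauge_antimono[OF w] j] order_trans[OF gauge_antimono[OF w] k]) auto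
  also have "\<dots> = ennreal (e / 2 + e / 2)"
    using e by (intro ennreal_plus[symmetric]) auto
  also have "\<dots> = ennreal e" by simp
  finally show "\<exists>k. arc_int (w k) (L1 + L2) (join L1 c1 c2) \<le> ennreal e" ..
qed

subsection \<open>Compactness for curves\<close>

text \<open>Arzela-Ascoli: properness gives limits at single parameters, a diagonal sequence handles
  all rational ones, and the common Lipschitz bound extends convergence to the rest. Pointwise
  convergence is all that the later limits use.\<close>

lemma lip_curve_subsequence:
  fixes L :: "nat \<Rightarrow> real" and c :: "nat \<Rightarrow> real \<Rightarrow> 'a"
  assumes lip: "\<And>n. lip_curve d (L n) (c n)" and E: "compactin (mtop d) E" and c0: "\<And>n. c n 0 \<in> E"
    and LT: "\<And>n. L n \<le> T"
  obtains r L' c' where "strict_mono (r :: nat \<Rightarrow> nat)" "lip_curve d L' c'" "c' 0 \<in> E" "L' \<le> T"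
    "(\<lambda>n. L (r n)) \<longlonglongrightarrow> L'" "\<And>s. (\<lambda>n. d (c (r n) s) (c' s)) \<longlonglongrightarrow> 0"
proof -
  have lip': "d (c n s) (c n t) \<le> \<bar>s - t\<bar>" for n s t
    using lip[of n] by (simp add: lip_curve_def)
  have L0: "0 \<le> L n" for n
    using lip[of n] by (simp add: lip_curve_def)
  have "mbounded E"
    using compactin_imp_mbounded E by (simp add: mtop_eq)
  then obtain z B where zB: "E \<subseteq> mcball z B"
    by (auto simp: mbounded_def)
  have bound: "d z (c n s) \<le> B + \<bar>s\<bar>" for n s
  proof -
    have "d z (c n 0) \<le> B"
      using c0[of n] zB by auto
    then show ?thesis
      using tri[of z "c n s" "c n 0"] lip'[of n 0 s] by simp
  qed
  have "\<forall>n. L n \<in> {0..T}"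
    using L0 LT by simp
  then obtain L' r0 where r0: "strict_mono (r0 :: nat \<Rightarrow> nat)" "(L \<circ> r0) \<longlonglongrightarrow> L'"
    using compact_Icc[of 0 T] unfolding compact_def by meson
  define q :: "nat \<Rightarrow> real" where "q n = of_rat (from_nat n)" for n
  interpret subseqs "\<lambda>n s. \<exists>l. (\<lambda>i. d (c (r0 (s i)) (q n)) l) \<longlonglongrightarrow> 0"
  proof
    fix n and s :: "nat \<Rightarrow> nat" assume "strict_mono s"
    obtain l r where "strict_mono (r :: nat \<Rightarrow> nat)" "(\<lambda>i. d (c (r0 (s (r i))) (q n)) l) \<longlonglongrightarrow> 0"
      using bounded_subsequence[of z "\<lambda>i. c (r0 (s i)) (q n)" "B + \<bar>q n\<bar>"] bound by metis
    then show "\<exists>r'. strict_mono r' \<and> (\<exists>l. (\<lambda>i. d (c (r0 ((s \<circ> r') i)) (q n)) l) \<longlonglongrightarrow> 0)"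
      by (auto simp: o_def)
  qed
  define r where "r n = r0 (diagseq n)" for n
  have r: "strict_mono r"
    using strict_mono_o[OF r0(1) subseq_diagseq] by (simp add: r_def[abs_def] o_def)
  have conv_q: "\<exists>l. (\<lambda>i. d (c (r i) (q n)) l) \<longlonglongrightarrow> 0" for n
  proof -
    have "\<exists>l. (\<lambda>i. d (c (r0 ((diagseq \<circ> (+) (Suc n)) i)) (q n)) l) \<longlonglongrightarrow> 0"
    proof (rule diagseq_holds)
      fix r s :: "nat \<Rightarrow> nat" and n assume "strict_mono r" "\<exists>l. (\<lambda>i. d (c (r0 (s i)) (q n)) l) \<longlonglongrightarrow> 0"
      then obtain l where "(\<lambda>i. d (c (r0 (s i)) (q n)) l) \<longlonglongrightarrow> 0" by auto
      from LIMSEQ_subseq_LIMSEQ[OF this \<open>strict_mono r\<close>]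
      show "\<exists>l. (\<lambda>i. d (c (r0 ((s \<circ> r) i)) (q n)) l) \<longlonglongrightarrow> 0"
        by (auto simp: o_def)
    qed
    \<comment> \<open>The diagonal sequence is a subsequence of the n-th one only from index
      \<open>Suc n\<close> on; the shift does not change the limit.\<close>
    then obtain l where "(\<lambda>i. d (c (r (i + Suc n)) (q n)) l) \<longlonglongrightarrow> 0"
      by (auto simp: r_def add.commute)
    then have "(\<lambda>i. d (c (r i) (q n)) l) \<longlonglongrightarrow> 0"
      by (rule LIMSEQ_offset)
    then show ?thesis ..
  qed
  have "\<exists>l. (\<lambda>i. d (c (r i) s) l) \<longlonglongrightarrow> 0" for s
  proof -
    \<comment> \<open>The candidate for the limit comes from a further subsequence. Comparing it
      with the whole sequence through a nearby rational parameter produces five terms, hence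
      \<open>e / 5\<close>.\<close>
    obtain l v where v: "strict_mono (v :: nat \<Rightarrow> nat)" "(\<lambda>i. d (c (r (v i)) s) l) \<longlonglongrightarrow> 0"
      using bounded_subsequence[of z "\<lambda>i. c (r i) s" "B + \<bar>s\<bar>"] bound by metis
    have "(\<lambda>i. d (c (r i) s) l) \<longlonglongrightarrow> 0"
    proof (rule LIMSEQ_I)
      fix e :: real assume e: "e > 0"
      obtain x where x: "s < of_rat x" "of_rat x < s + e / 5"
        using of_rat_dense[of s "s + e / 5"] e by auto
      obtain n where "x = from_nat n"
        using from_nat_to_nat by metis
      then have qn: "\<bar>s - q n\<bar> < e / 5"
        using x by (simp add: q_def)
      obtain lq where lq: "(\<lambda>i. d (c (r i) (q n)) lq) \<longlonglongrightarrow> 0"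
        using conv_q by blast
      have e5: "e / 5 > 0" using e by simp
      obtain N1 where N1: "\<And>i. i \<ge> N1 \<Longrightarrow> d (c (r i) (q n)) lq < e / 5"
        using LIMSEQ_D[OF lq e5] by auto
      obtain N2 where N2: "\<And>i. i \<ge> N2 \<Longrightarrow> d (c (r (v i)) s) l < e / 5"
        using LIMSEQ_D[OF v(2) e5] by auto
      define j where "j = max N1 N2"
      have vj: "v j \<ge> N1"
        using seq_suble[OF v(1), of j] by (simp add: j_def)
      show "\<exists>N. \<forall>i\<ge>N. norm (d (c (r i) s) l - 0) < e"
      proof (intro exI[of _ N1] allI impI)
        fix i assume i: "i \<ge> N1"
        have "d (c (r i) s) l \<le> d (c (r i) s) (c (r i) (q n)) + d (c (r i) (q n)) lq
            + (d lq (c (r (v j)) (q n)) + d (c (r (v j)) (q n)) (c (r (v j)) s)) + d (c (r (v j)) s) l"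
          using tri[of "c (r i) s" l "c (r i) (q n)"] tri[of "c (r i) (q n)" l lq]
            tri[of lq l "c (r (v j)) (q n)"] tri[of "c (r (v j)) (q n)" l "c (r (v j)) s"]
          by linarith
        also have "\<dots> < e / 5 + e / 5 + (e / 5 + e / 5) + e / 5"
          using N1[OF i] N1[OF vj] N2[of j] lip'[of "r i" s "q n"] lip'[of "r (v j)" "q n" s] qn
          by (simp add: j_def commute[of lq] abs_minus_commute)
        finally show "norm (d (c (r i) s) l - 0) < e" by simp
      qed
    qed
    then show ?thesis ..
  qed
  then obtain c' where c': "\<And>s. (\<lambda>i. d (c (r i) s) (c' s)) \<longlonglongrightarrow> 0"
    by metis
  have Lr: "(\<lambda>n. L (r n)) \<longlonglongrightarrow> L'"
    using LIMSEQ_subseq_LIMSEQ[OF r0(2) subseq_diagseq] by (simp add: r_def o_def)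
  show thesis
  proof (rule that[OF r _ _ _ Lr c'])
    have "0 \<le> L'"
      using Lr L0 by (intro LIMSEQ_le_const) auto
    moreover have "d (c' s) (c' t) \<le> \<bar>s - t\<bar>" for s t
    proof (rule LIMSEQ_le_const)
      show "(\<lambda>i. d (c (r i) s) (c' s) + \<bar>s - t\<bar> + d (c (r i) t) (c' t)) \<longlonglongrightarrow> \<bar>s - t\<bar>"
        using tendsto_add[OF tendsto_add[OF c'[of s] tendsto_const[of "\<bar>s - t\<bar>"]] c'[of t]] by simp
      show "\<exists>N. \<forall>i\<ge>N. d (c' s) (c' t) \<le> d (c (r i) s) (c' s) + \<bar>s - t\<bar> + d (c (r i) t) (c' t)"
      proof (intro exI allI impI)
        fix i
        show "d (c' s) (c' t) \<le> d (c (r i) s) (c' s) + \<bar>s - t\<bar> + d (c (r i) t) (c' t)"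
          using tri[of "c' s" "c' t" "c (r i) s"] tri[of "c (r i) s" "c' t" "c (r i) t"] lip'[of "r i" s t]
          by (simp add: commute[of "c' s"])
      qed
    qed
    ultimately show "lip_curve d L' c'"
      by (simp add: lip_curve_def)
    show "c' 0 \<in> E"
    proof (rule limitin_closedin[OF _ compactin_closedin[OF E, unfolded mtop_eq]])
      show "limitin mtopology (\<lambda>i. c (r i) 0) (c' 0) sequentially"
        using c'[of 0] limitin_mtop by (simp add: mtop_eq)
    qed (use c0 in auto)
    show "L' \<le> T"
      using Lr LT by (intro LIMSEQ_le_const2) auto
  qed
qed

text \<open>Fatou's lemma. The integrands are lower semicontinuous along the sequence except
  possibly at \<open>s = L'\<close>, where the approximating curves may already have ended; one
  point is a null set.\<close>

lemma arc_int_lsc: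
  assumes w: "lsc d w" and lip: "\<And>n. lip_curve d (L n) (c n)"
    and lim: "L \<longlonglongrightarrow> L'" "\<And>s. (\<lambda>n. d (c n s) (c' s)) \<longlonglongrightarrow> 0"
    and le: "eventually (\<lambda>n. arc_int w (L n) (c n) \<le> a) sequentially"
  shows "arc_int w L' c' \<le> a"
proof -
  have pw: "indicator {0..L'} s * w (c' s) \<le> liminf (\<lambda>n. indicator {0..L n} s * w (c n s))" if "s \<noteq> L'" for s
  proof (cases "s \<in> {0..L'}")
    case True
    then have s: "0 \<le> s" "s < L'" using that by auto
    show ?thesis
      unfolding le_Liminf_iff
    proof (intro allI impI)
      fix y assume "y < indicator {0..L'} s * w (c' s)"
      then have "y < w (c' s)" using True by simp
      moreover have "openin (mtop d) {x. y < w x}"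
        using w by (simp add: lsc_def)
      ultimately obtain e where e: "e > 0" "oball d (c' s) e \<subseteq> {x. y < w x}"
        unfolding openin_mtop by auto
      have "eventually (\<lambda>n. d (c n s) (c' s) < e) sequentially"
        using lim(2) e(1) by (rule order_tendstoD)
      moreover have "eventually (\<lambda>n. s < L n) sequentially"
        using lim(1) s(2) by (rule order_tendstoD)
      ultimately show "eventually (\<lambda>n. y < indicator {0..L n} s * w (c n s)) sequentially"
      proof eventually_elim
        case (elim n)
        then have "c n s \<in> oball d (c' s) e"
          by (simp add: oball_def commute[of "c' s"])
        then show ?case using e(2) elim s(1) by auto
      qed
    qed
  qed simp
  have "arc_int w L' c' \<le> (\<integral>\<^sup>+ s. liminf (\<lambda>n. indicator {0..L n} s * w (c n s)) \<partial>lborel)"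
    unfolding arc_int_def
    by (rule nn_integral_mono_AE, rule eventually_mono[OF AE_lborel_singleton[of L']]) (rule pw)
  also have "\<dots> \<le> liminf (\<lambda>n. arc_int w (L n) (c n))"
    unfolding arc_int_def
    by (rule nn_integral_liminf) (use arc_integrand_measurable[OF lip lsc_measurable[OF w]] in simp)
  also have "\<dots> \<le> a"
    using le by (intro Liminf_le) auto
  finally show ?thesis .
qed

text \<open>The bounds are assumed only eventually, so that the same lemma yields closedness of
  finitely many conditions and, for a sequence of curves meeting more and more conditions, a limit
  that meets them all.\<close>

lemma curve_limit:
  fixes L :: "nat \<Rightarrow> real" and c :: "nat \<Rightarrow> real \<Rightarrow> 'a" and v :: "nat \<Rightarrow> 'a \<Rightarrow> ennreal"
  assumes lip: "\<And>n. lip_curve d (L n) (c n)" and E: "compactin (mtop d) E" and c0: "\<And>n. c n 0 \<in> E"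
    and LT: "\<And>n. L n \<le> T" and z: "(\<lambda>n. d (c n (L n)) z) \<longlonglongrightarrow> 0"
    and v: "\<And>j. j \<in> J \<Longrightarrow> lsc d (v j)"
    and le: "\<And>j. j \<in> J \<Longrightarrow> eventually (\<lambda>n. arc_int (v j) (L n) (c n) \<le> a j) sequentially"
  obtains L' c' where "lip_curve d L' c'" "c' 0 \<in> E" "L' \<le> T" "c' L' = z"
    "\<And>j. j \<in> J \<Longrightarrow> arc_int (v j) L' c' \<le> a j"
proof -
  obtain r L' c' where r: "strict_mono (r :: nat \<Rightarrow> nat)" and lim: "lip_curve d L' c'" "c' 0 \<in> E" "L' \<le> T"
    "(\<lambda>n. L (r n)) \<longlonglongrightarrow> L'" "\<And>s. (\<lambda>n. d (c (r n) s) (c' s)) \<longlonglongrightarrow> 0"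
    by (rule lip_curve_subsequence[OF lip E c0 LT]) (rule that)
  have "arc_int (v j) L' c' \<le> a j" if j: "j \<in> J" for j
  proof (rule arc_int_lsc[OF v[OF j] _ lim(4,5)])
    show "lip_curve d (L (r n)) (c (r n))" for n by (rule lip)
    show "eventually (\<lambda>n. arc_int (v j) (L (r n)) (c (r n)) \<le> a j) sequentially"
      using le[OF j] r by (rule eventually_subseq[rotated])
  qed
  moreover have "c' L' = z"
  proof -
    have "d z (c' L') \<le> 0"
    proof (rule LIMSEQ_le_const)
      show "(\<lambda>n. d (c (r n) (L (r n))) z + \<bar>L (r n) - L'\<bar> + d (c (r n) L') (c' L')) \<longlonglongrightarrow> 0"
      proof -
        have "(\<lambda>n. \<bar>L (r n) - L'\<bar>) \<longlonglongrightarrow> 0"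
          using lim(4) by (simp add: LIM_zero tendsto_rabs_zero)
        from tendsto_add[OF tendsto_add[OF LIMSEQ_subseq_LIMSEQ[OF z r] this] lim(5)[of L']]
        show ?thesis by (simp add: o_def)
      qed
      show "\<exists>N. \<forall>n\<ge>N. d z (c' L') \<le> d (c (r n) (L (r n))) z + \<bar>L (r n) - L'\<bar> + d (c (r n) L') (c' L')"
      proof (intro exI allI impI)
        fix n
        have "d (c (r n) (L (r n))) (c (r n) L') \<le> \<bar>L (r n) - L'\<bar>"
          using lip[of "r n"] by (simp add: lip_curve_def)
        then show "d z (c' L') \<le> d (c (r n) (L (r n))) z + \<bar>L (r n) - L'\<bar> + d (c (r n) L') (c' L')"
          using tri[of z "c' L'" "c (r n) (L (r n))"] tri[of "c (r n) (L (r n))" "c' L'" "c (r n) L'"]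
          by (simp add: commute[of z])
      qed
    qed
    then have "d z (c' L') = 0"
      using nonneg[of z "c' L'"] by linarith
    then show ?thesis by simp
  qed
  ultimately show thesis
    using that lim(1-3) by blast
qed

subsection \<open>Measurability of the set of end points\<close>

text \<open>The union of the inner approximations and a measurable hull have the same finite
  measure, so \<open>A\<close> differs from a measurable set by a subset of a null set;
  \<open>M\<close> is complete.\<close>

lemma measurable_of_inner_approx:
  assumes fin: "outer_measure_of M A < \<infinity>"
    and inner: "\<And>a. a < outer_measure_of M A \<Longrightarrow> \<exists>K\<in>sets M. K \<subseteq> A \<and> a \<le> emeasure M K"
  shows "A \<in> sets M"
proof -
  define s where "s = outer_measure_of M A"
  obtain H where H: "H \<in> sets M" "A \<subseteq> H" "s = emeasure M H"
    using outer_measure_of_attain[of A M] by (auto simp: s_def)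
  show ?thesis
  proof (cases "s = 0")
    case True
    then show ?thesis
      using H by (intro complete_M[OF H(1) _ H(2)]) simp
  next
    case False
    then have "0 < s" by (simp add: zero_less_iff_neq_zero)
    then obtain u where u: "\<And>n. u n < s" "u \<longlonglongrightarrow> s"
      using approx_from_below_dense_linorder by blast
    have "\<exists>K\<in>sets M. K \<subseteq> A \<and> u n \<le> emeasure M K" for n
      using inner u(1) by (simp add: s_def)
    then obtain K where K: "\<And>n. K n \<in> sets M" "\<And>n. K n \<subseteq> A" "\<And>n. u n \<le> emeasure M (K n)"
      by metis
    define V where "V = (\<Union>n. K n)"
    have VM: "V \<in> sets M" and VA: "V \<subseteq> A"
      using K by (auto simp: V_def)
    have "u n \<le> emeasure M V" for n
      using K(3)[of n] emeasure_mono[of "K n" V M] VM by (auto simp: V_def intro: order_trans)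
    then have "s \<le> emeasure M V"
      using u(2) by (intro LIMSEQ_le_const2) auto
    moreover have "emeasure M V \<le> s"
      using VA H emeasure_mono[of V H M] by auto
    ultimately have "emeasure M (H - V) = 0"
      using H VM VA fin by (subst emeasure_Diff) (auto simp: s_def)
    then have "A - V \<in> sets M"
      by (rule complete_M[OF sets.Diff[OF H(1) VM]]) (use H(2) in auto)
    moreover have "A = V \<union> (A - V)" using VA by auto
    ultimately show ?thesis using VM by (metis sets.Un)
  qed
qed

(* Choosing for each j a threshold n j turns goodness into countably many closed conditions on curves;
   by compactness, projecting to end points commutes with intersecting those conditions. *)
lemma reachable_measurable:
  assumes w: "gauge w" and E: "compactin (mtop d) E"
  shows "{c L | L c. lip_curve d L c \<and> c 0 \<in> E \<and> L \<le> T \<and> good w L c} \<in> sets M"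
proof -
  define base where "base = {(L, c). lip_curve d L c \<and> c 0 \<in> E \<and> L \<le> T}"
  define \<pi> where "\<pi> X = (\<lambda>(L, c). c L) ` X" for X :: "(real \<times> (real \<Rightarrow> 'a)) set"
  define X0 where "X0 = {(L, c). (L, c) \<in> base \<and> good w L c}"
  define R where "R = \<pi> X0"
  have R_eq: "R = {c L | L c. lip_curve d L c \<and> c 0 \<in> E \<and> L \<le> T \<and> good w L c}"
    by (auto simp: R_def \<pi>_def X0_def base_def image_def)
  have "mbounded E"
    using compactin_imp_mbounded E by (simp add: mtop_eq)
  then obtain z B where zB: "E \<subseteq> mcball z B"
    by (auto simp: mbounded_def)
  have bd: "\<pi> base \<subseteq> oball d z (B + T + 1)"
  proof
    fix y assume "y \<in> \<pi> base"
    then obtain L c where c: "lip_curve d L c" "c 0 \<in> E" "L \<le> T" "y = c L"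
      by (auto simp: \<pi>_def base_def)
    have "d (c 0) (c L) \<le> \<bar>0 - L\<bar>" "0 \<le> L"
      using c(1) unfolding lip_curve_def by blast+
    moreover have "d z (c 0) \<le> B"
      using c(2) zB by auto
    ultimately show "y \<in> oball d z (B + T + 1)"
      using tri[of z "c L" "c 0"] c(3,4) by (simp add: oball_def)
  qed
  have fin: "emeasure M S < top" if "S \<subseteq> \<pi> base" "S \<in> sets M" for S
    using emeasure_mono[of S "oball d z (B + T + 1)" M] bd that oball_sets_M oball_fin[of z "B + T + 1"]
    by (meson order_le_less_trans order_trans)
  have outfin: "outer_measure_of M R < \<infinity>"
  proof -
    have "R \<subseteq> oball d z (B + T + 1)"
      using bd by (auto simp: R_def \<pi>_def X0_def)
    from outer_measure_of_mono[OF this, of M] show ?thesis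
      using oball_fin[of z "B + T + 1"] oball_sets_M by (simp add: order_le_less_trans)
  qed
  have "\<exists>K\<in>sets M. K \<subseteq> R \<and> a \<le> emeasure M K" if a: "a < outer_measure_of M R" for a
  proof -
    define cut where "cut m n X = {(L, c). (L, c) \<in> X \<and> arc_int (w n) L c \<le> ennreal (1 / Suc m)}" for m n X
    \<comment> \<open>The thresholds are chosen one at a time, keeping the outer measure of the
      projection above \<open>a\<close>. Outer measure is continuous along increasing sequences of
      arbitrary sets, so the projections of the \<open>X m\<close> need not be known to be
      measurable.\<close>
    have "\<exists>X. \<forall>m. (X m \<subseteq> X0 \<and> a < outer_measure_of M (\<pi> (X m))) \<and> (\<exists>n. X (Suc m) = cut m n (X m))"
    proof (rule dependent_nat_choice)
      show "\<exists>X. X \<subseteq> X0 \<and> a < outer_measure_of M (\<pi> X)"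
        using a by (intro exI[of _ X0]) (simp add: R_def)
      fix X m assume X: "X \<subseteq> X0 \<and> a < outer_measure_of M (\<pi> X)"
      have inc: "incseq (\<lambda>n. \<pi> (cut m n X))"
      proof (rule incseq_SucI)
        fix n
        have "cut m n X \<subseteq> cut m (Suc n) X"
          using gauge_antimono[OF w, of n "Suc n"] by (auto simp: cut_def intro: order_trans)
        then show "\<pi> (cut m n X) \<subseteq> \<pi> (cut m (Suc n) X)"
          unfolding \<pi>_def by (rule image_mono)
      qed
      have "X \<subseteq> (\<Union>n. cut m n X)"
      proof
        fix x assume x: "x \<in> X"
        obtain L c where Lc: "x = (L, c)" by (cases x)
        then have "good w L c" using x X by (auto simp: X0_def)
        then obtain n where "arc_int (w n) L c \<le> ennreal (1 / Suc m)"
          unfolding good_iff by (metis of_nat_0_less_iff zero_less_Suc zero_less_divide_1_iff)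
        then show "x \<in> (\<Union>n. cut m n X)" using x Lc by (auto simp: cut_def)
      qed
      then have "\<pi> X \<subseteq> (\<Union>n. \<pi> (cut m n X))"
        unfolding \<pi>_def image_UN[symmetric] by (rule image_mono)
      then have "a < outer_measure_of M (\<Union>n. \<pi> (cut m n X))"
        using X outer_measure_of_mono order_less_le_trans by metis
      also have "\<dots> = (SUP n. outer_measure_of M (\<pi> (cut m n X)))"
        by (rule SUP_outer_measure_of_incseq[symmetric, OF _ inc]) simp
      finally obtain n where n: "a < outer_measure_of M (\<pi> (cut m n X))"
        by (auto simp: less_SUP_iff)
      have "cut m n X \<subseteq> X0"
        using X by (auto simp: cut_def)
      then show "\<exists>Y. (Y \<subseteq> X0 \<and> a < outer_measure_of M (\<pi> Y)) \<and> (\<exists>n. Y = cut m n X)"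
        using n by auto
    qed
    then obtain X where X: "\<And>m. X m \<subseteq> X0" "\<And>m. a < outer_measure_of M (\<pi> (X m))" "\<And>m. \<exists>n. X (Suc m) = cut m n (X m)"
      by blast
    then obtain n where n: "\<And>m. X (Suc m) = cut m (n m) (X m)"
      by metis
    \<comment> \<open>Goodness is dropped and only the first \<open>m\<close> closed conditions are
      kept. The projections become closed, and they still contain those of
      \<open>X m\<close>.\<close>
    define \<K> where "\<K> m = {(L, c). (L, c) \<in> base \<and> (\<forall>j<m. arc_int (w (n j)) L c \<le> ennreal (1 / Suc j))}" for m
    have XK: "X m \<subseteq> \<K> m" for m
    proof (induction m)
      case 0
      then show ?case using X(1)[of 0] by (auto simp: \<K>_def X0_def)
    next
      case (Suc m)
      then show ?case unfolding n by (auto simp: cut_def \<K>_def less_Suc_eq)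
    qed
    have lscw: "lsc d (w k)" for k
      using w by (simp add: gauge_def)
    have K_base: "\<pi> (\<K> m) \<subseteq> \<pi> base" for m
      unfolding \<pi>_def by (rule image_mono) (auto simp: \<K>_def)
    have closed: "closedin (mtop d) (\<pi> (\<K> m))" for m
      unfolding mtop_eq metric_closedin_iff_sequentially_closed
    proof (intro conjI allI impI)
      fix y l assume "range y \<subseteq> \<pi> (\<K> m) \<and> limitin mtopology y l sequentially"
      then have y: "\<And>i. y i \<in> \<pi> (\<K> m)" and lim: "(\<lambda>i. d (y i) l) \<longlonglongrightarrow> 0"
        using limitin_mtop[of y l] by (auto simp: mtop_eq)
      have "\<exists>L c. (L, c) \<in> \<K> m \<and> y i = c L" for i
        using y[of i] by (auto simp: \<pi>_def)
      then obtain L c where Lc: "\<And>i. (L i, c i) \<in> \<K> m" "\<And>i. y i = c i (L i)"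
        by metis
      obtain L' c' where "lip_curve d L' c'" "c' 0 \<in> E" "L' \<le> T" "c' L' = l"
        "\<And>j. j \<in> {..<m} \<Longrightarrow> arc_int (w (n j)) L' c' \<le> ennreal (1 / Suc j)"
      proof (rule curve_limit[of L c E T l "{..<m}" "\<lambda>j. w (n j)" "\<lambda>j. ennreal (1 / Suc j)"])
        show "(\<lambda>i. d (c i (L i)) l) \<longlonglongrightarrow> 0"
          using lim Lc(2) by simp
      qed (use Lc(1) E lscw in \<open>auto simp: \<K>_def base_def\<close>)
      then have "(L', c') \<in> \<K> m" "l = (\<lambda>(L, c). c L) (L', c')"
        by (auto simp: \<K>_def base_def)
      then show "l \<in> \<pi> (\<K> m)"
        unfolding \<pi>_def by (rule rev_image_eqI)
    qed simp
    have KM: "\<pi> (\<K> m) \<in> sets M" for m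
      using closed by (intro borel_sets_M closed_in_borel)
    have dec: "decseq (\<lambda>m. \<pi> (\<K> m))"
      unfolding decseq_def \<pi>_def by (intro allI impI image_mono) (auto simp: \<K>_def)
    have sub: "(\<Inter>m. \<pi> (\<K> m)) \<subseteq> R"
    proof
      fix y assume y: "y \<in> (\<Inter>m. \<pi> (\<K> m))"
      have "\<exists>L c. (L, c) \<in> \<K> m \<and> y = c L" for m
      proof -
        have "y \<in> \<pi> (\<K> m)" using y by blast
        then show ?thesis by (auto simp: \<pi>_def)
      qed
      then obtain L c where Lc: "\<And>m. (L m, c m) \<in> \<K> m" "\<And>m. y = c m (L m)"
        by metis
      \<comment> \<open>For each \<open>m\<close> some curve of \<open>\<K> m\<close> ends at
        \<open>y\<close>. The j-th condition holds from \<open>m = Suc j\<close> on, so a limit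
        curve satisfies all of them.\<close>
      obtain L' c' where *: "lip_curve d L' c'" "c' 0 \<in> E" "L' \<le> T" "c' L' = y"
        "\<And>j. j \<in> UNIV \<Longrightarrow> arc_int (w (n j)) L' c' \<le> ennreal (1 / Suc j)"
      proof (rule curve_limit[of L c E T y UNIV "\<lambda>j. w (n j)" "\<lambda>j. ennreal (1 / Suc j)"])
        show "(\<lambda>i. d (c i (L i)) y) \<longlonglongrightarrow> 0"
          using Lc(2)[symmetric] by simp
        show "eventually (\<lambda>m. arc_int (w (n j)) (L m) (c m) \<le> ennreal (1 / Suc j)) sequentially" for j
          unfolding eventually_sequentially using Lc(1) by (intro exI[of _ "Suc j"]) (auto simp: \<K>_def)
      qed (use Lc(1) E lscw in \<open>auto simp: \<K>_def base_def\<close>)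
      have "good w L' c'"
        unfolding good_iff
      proof (intro allI impI)
        fix e :: real assume "e > 0"
        then obtain j where "1 / Suc j < e"
          using nat_approx_posE by blast
        then have "ennreal (1 / Suc j) \<le> ennreal e"
          by (intro ennreal_leI) simp
        then show "\<exists>k. arc_int (w k) L' c' \<le> ennreal e"
          using *(5)[of j] order_trans by blast
      qed
      then show "y \<in> R"
        unfolding R_eq using * by blast
    qed
    have "a \<le> emeasure M (\<Inter>m. \<pi> (\<K> m))"
    proof -
      have "a \<le> (INF m. emeasure M (\<pi> (\<K> m)))"
      proof (rule INF_greatest)
        fix m
        have "outer_measure_of M (\<pi> (X m)) \<le> outer_measure_of M (\<pi> (\<K> m))"
          unfolding \<pi>_def by (intro outer_measure_of_mono image_mono XK)
        then show "a \<le> emeasure M (\<pi> (\<K> m))"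
          using X(2)[of m] KM by (simp add: less_imp_le order_trans)
      qed
      also have "\<dots> = emeasure M (\<Inter>m. \<pi> (\<K> m))"
      proof (rule INF_emeasure_decseq[OF _ dec])
        show "emeasure M (\<pi> (\<K> i)) \<noteq> \<infinity>" for i
          using fin[OF K_base KM, of i] by simp
      qed (use KM in auto)
      finally show ?thesis .
    qed
    moreover have "(\<Inter>m. \<pi> (\<K> m)) \<in> sets M"
      using KM by (intro sets.countable_INT) auto
    ultimately show ?thesis using sub by blast
  qed
  then have "R \<in> sets M"
    by (rule measurable_of_inner_approx[OF outfin])
  then show ?thesis unfolding R_eq .
qed

end

section \<open>Null sets along curves\<close>

lemma arc_int_0: "arc_int g 0 c = 0"
proof -
  have "arc_int g 0 c = (\<integral>\<^sup>+ s. 0 \<partial>(lborel :: real measure))"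
    unfolding arc_int_def
    by (rule nn_integral_cong_AE, rule eventually_mono[OF AE_lborel_singleton[of "0 :: real"]]) (simp add: indicator_def)
  then show ?thesis by simp
qed

lemma AE_lborel_point_in_interval:
  fixes l u :: real
  assumes "AE s in lborel. Q s" "l < u"
  shows "\<exists>s\<in>{l<..<u}. Q s"
proof (rule ccontr)
  assume "\<not> ?thesis"
  then have ae: "AE s in lborel. s \<notin> {l<..<u}"
    using assms(1) by (auto elim!: eventually_mono)
  have "{l<..<u} \<in> sets lborel" "{s \<in> space lborel. \<not> s \<notin> {l<..<u}} = {l<..<u}"
    by auto
  from AE_iff_measurable[OF this] ae have "emeasure lborel {l<..<u} = 0"
    by (rule iffD1)
  then show False using assms(2) by simp
qed

context mms_space
begin

text \<open>Together with \<open>null_avoiding\<close>: p-almost every curve spends no time in a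
  given null set. The factor infinity has no cost in energy, yet a finite integral then forces zero
  time in \<open>Z\<close>.\<close>

lemma null_small:
  assumes "Z \<in> sets (borel_of_metric d)" "emeasure M Z = 0"
  shows "small (\<lambda>x. \<infinity> * indicator Z x)"
  unfolding small_def
proof
  show "(\<lambda>x. \<infinity> * indicator Z x :: ennreal) \<in> borel_measurable (borel_of_metric d)"
    using assms(1) by (intro borel_measurable_times_ennreal borel_measurable_indicator) auto
  have ae: "AE x in M. x \<notin> Z"
    using assms borel_sets_M by (intro AE_I[of _ _ Z]) auto
  show "energy p M (\<lambda>x. \<infinity> * indicator Z x) < \<infinity>"
  proof (cases "p = \<infinity>")
    case True
    have "Linf_norm M (\<lambda>x. \<infinity> * indicator Z x) \<le> 0"
      by (rule Linf_norm_le, rule eventually_mono[OF ae]) simp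
    then show ?thesis using True by (simp add: energy_def)
  next
    case False
    have "(\<integral>\<^sup>+ x. enn_pow (\<infinity> * indicator Z x) (enn2real p) \<partial>M) = (\<integral>\<^sup>+ x. 0 \<partial>M)"
      by (rule nn_integral_cong_AE, rule eventually_mono[OF ae]) (simp add: enn_pow_def)
    then show ?thesis using False by (simp add: energy_def)
  qed
qed

lemma null_avoiding:
  assumes c: "lip_curve d L c" and Z: "Z \<in> sets (borel_of_metric d)"
    and fin: "arc_int (\<lambda>x. \<infinity> * indicator Z x) L c < \<infinity>"
  shows "AE s in lborel. s \<in> {0..L} \<longrightarrow> c s \<notin> Z"
proof -
  have Zm: "indicator Z \<in> borel_measurable (borel_of_metric d)"
    using Z by simp
  have "arc_int (\<lambda>x. \<infinity> * indicator Z x) L c = \<infinity> * arc_int (indicator Z) L c"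
    using c Zm by (rule arc_int_cmult)
  then have "arc_int (indicator Z) L c = 0"
    using fin by (simp add: ennreal_top_mult split: if_splits)
  moreover have m: "(\<lambda>s. indicator {0..L} s * indicator Z (c s) :: ennreal) \<in> borel_measurable lborel"
    using arc_integrand_measurable[OF c Zm] by simp
  ultimately have "AE s in lborel. indicator {0..L} s * indicator Z (c s) = (0 :: ennreal)"
    unfolding arc_int_def using nn_integral_0_iff_AE[OF m] by simp
  then show ?thesis
    by (rule eventually_mono) (auto simp: indicator_def split: if_splits)
qed

end

section \<open>Test functions and the metric \<open>dp\<close>\<close>

locale quasiconvex_mms = mms_space d M p for d :: "'a \<Rightarrow> 'a \<Rightarrow> real" and M p +
  fixes C :: real
  assumes C: "1 \<le> C" and thick: "thick_quasiconvex p d M C"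
begin

text \<open>The bound by \<open>C * d x y\<close> holds at all pairs, not just almost all, so test
  functions have definite values at points and the supremum in \<open>dp\<close> is finite. In the
  second clause the exceptional curves are those of infinite \<open>g\<close>-integral.\<close>

definition test_fun :: "('a \<Rightarrow> real) \<Rightarrow> bool" where
  "test_fun u \<longleftrightarrow> (\<forall>x y. \<bar>u x - u y\<bar> \<le> C * d x y) \<and>
     (\<exists>g. small g \<and> (\<forall>L c. lip_curve d L c \<longrightarrow> arc_int g L c < \<infinity> \<longrightarrow> \<bar>u (c 0) - u (c L)\<bar> \<le> L))"

definition dp :: "'a \<Rightarrow> 'a \<Rightarrow> real" where
  "dp x y = (SUP u\<in>Collect test_fun. \<bar>u x - u y\<bar>)"

lemma test_fun_lipschitz: "test_fun u \<Longrightarrow> \<bar>u x - u y\<bar> \<le> C * d x y"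
  by (simp add: test_fun_def)

lemma d_le_Cd: "d x y \<le> C * d x y"
  using mult_right_mono[OF C nonneg[of x y]] by simp

text \<open>Distance functions give \<open>d \<le> dp\<close>, and they make the set over which
  \<open>dp\<close> is a supremum nonempty.\<close>

lemma test_fun_dist: "test_fun (d z)"
  unfolding test_fun_def
\<comment> \<open>The witness is the zero function in the form covered by \<open>null_small\<close>:
  no curve is exceptional.\<close>
proof (intro conjI allI exI[of _ "\<lambda>x. \<infinity> * indicator {} x"] impI)
  have le: "\<bar>d z x - d z y\<bar> \<le> d x y" for x y
    using tri[of z x y] tri[of z y x] by (simp add: commute[of y x])
  then show "\<bar>d z x - d z y\<bar> \<le> C * d x y" for x y
    using d_le_Cd order_trans by blast
  show "small (\<lambda>x. \<infinity> * indicator {} x)"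
    by (rule null_small) auto
  show "\<bar>d z (c 0) - d z (c L)\<bar> \<le> L" if c: "lip_curve d L c" for L c
  proof -
    have "0 \<le> L" "d (c 0) (c L) \<le> \<bar>0 - L\<bar>"
      using c unfolding lip_curve_def by blast+
    then show ?thesis using le[of "c 0" "c L"] by simp
  qed
qed

lemma dp_upper: "test_fun u \<Longrightarrow> \<bar>u x - u y\<bar> \<le> dp x y"
  unfolding dp_def by (rule cSUP_upper) (auto intro!: bdd_aboveI[of _ "C * d x y"] test_fun_lipschitz)

lemma dp_le: "(\<And>u. test_fun u \<Longrightarrow> \<bar>u x - u y\<bar> \<le> B) \<Longrightarrow> dp x y \<le> B"
  unfolding dp_def by (rule cSUP_least) (use test_fun_dist in auto)

lemma dp_le_Cd: "dp x y \<le> C * d x y"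
  by (rule dp_le) (rule test_fun_lipschitz)

lemma d_le_dp: "d x y \<le> dp x y"
  using dp_upper[OF test_fun_dist[of x], of x y] by simp

lemma dp_metric: "Metric_space UNIV dp"
proof
  show "0 \<le> dp x y" for x y
    using d_le_dp[of x y] nonneg[of x y] by linarith
  show "dp x y = dp y x" for x y
    by (simp add: dp_def abs_minus_commute)
  show "dp x y = 0 \<longleftrightarrow> x = y" for x y
  proof
    assume "dp x y = 0"
    then have "d x y = 0"
      using d_le_dp[of x y] nonneg[of x y] by linarith
    then show "x = y" by simp
  next
    assume "x = y"
    then show "dp x y = 0"
      using dp_le_Cd[of x x] d_le_dp[of x x] by simp
  qed
  show "dp x z \<le> dp x y + dp y z" for x y z
  proof (rule dp_le)
    fix u assume "test_fun u"
    then show "\<bar>u x - u z\<bar> \<le> dp x y + dp y z"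
      using dp_upper[of u x y] dp_upper[of u y z] by linarith
  qed
qed

lemma oball_dp_subset: "oball dp x r \<subseteq> oball d x r"
  using d_le_dp by (auto simp: oball_def intro: order_le_less_trans)

lemma oball_subset_dp: "oball d x (r / C) \<subseteq> oball dp x r"
proof
  fix y assume "y \<in> oball d x (r / C)"
  then have "C * d x y < r"
    using C by (simp add: oball_def field_simps)
  then show "y \<in> oball dp x r"
    using dp_le_Cd[of x y] by (simp add: oball_def)
qed

lemma mtop_dp: "mtop dp = mtop d"
proof -
  interpret D: full_metric dp
    using dp_metric by (rule full_metric.intro)
  show ?thesis
    unfolding topology_eq D.openin_mtop openin_mtop
  proof (intro allI iffI ballI)
    fix U x assume "\<forall>x\<in>U. \<exists>r>0. oball dp x r \<subseteq> U" "x \<in> U"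
    then obtain r where "r > 0" "oball dp x r \<subseteq> U" by auto
    then show "\<exists>r>0. oball d x r \<subseteq> U"
      using oball_subset_dp[of x r] C by (intro exI[of _ "r / C"]) auto
  next
    fix U x assume "\<forall>x\<in>U. \<exists>r>0. oball d x r \<subseteq> U" "x \<in> U"
    then obtain r where "r > 0" "oball d x r \<subseteq> U" by auto
    then show "\<exists>r>0. oball dp x r \<subseteq> U"
      using oball_dp_subset[of x r] by (intro exI[of _ r]) auto
  qed
qed

lemma borel_of_dp: "borel_of_metric dp = borel_of_metric d"
  by (simp add: borel_of_metric_def mtop_dp)

lemma mms_dp: "mms dp M"
  unfolding mms_def borel_of_dp mtop_dp
proof (intro conjI allI impI ballI)
  interpret D: full_metric dp
    using dp_metric by (rule full_metric.intro)
  show "Metric_space UNIV dp" by (rule dp_metric)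
  show "compactin (mtop d) S" if S: "closedin (mtop d) S \<and> D.mbounded S" for S
  proof (rule proper)
    show "closedin (mtop d) S" using S by simp
    obtain z B where "S \<subseteq> D.mcball z B"
      using S by (auto simp: D.mbounded_def)
    then have "S \<subseteq> mcball z B"
      using d_le_dp[of z] by (force intro: order_trans)
    then show "mbounded S"
      by (auto simp: mbounded_def)
  qed
  show "space M = UNIV" by simp
  show "sets (borel_of_metric d) \<subseteq> sets M" using borel_sets_M by auto
  show "A \<in> sets M" if "B \<in> sets M \<and> emeasure M B = 0 \<and> A \<subseteq> B" for A B
    using that by (intro complete_M[of B A]) auto
  show "\<exists>B\<in>sets (borel_of_metric d). A \<subseteq> B \<and> emeasure M B = emeasure M A" if "A \<in> sets M" for A
    using that by (rule borel_hull)
  fix x and r :: real assume r: "r > 0"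
  have open_dp: "oball dp x r \<in> sets M"
    using D.openin_oball[of x r] by (intro open_sets_M) (simp add: mtop_dp)
  have "emeasure M (oball d x (r / C)) \<le> emeasure M (oball dp x r)"
    using oball_subset_dp open_dp by (rule emeasure_mono)
  then show "0 < emeasure M (oball dp x r)"
    using oball_pos[of "r / C" x] r C by (auto intro: order_less_le_trans)
  have "emeasure M (oball dp x r) \<le> emeasure M (oball d x r)"
    using oball_dp_subset oball_sets_M by (rule emeasure_mono)
  then show "emeasure M (oball dp x r) < \<infinity>"
    using oball_fin[of x r] by (auto intro: order_le_less_trans)
qed

subsection \<open>Minimality\<close>

text \<open>Thickness for \<open>\<rho>\<close> yields curves between balls, not points, of
  \<open>\<rho>\<close>-length nearly the distance of their ends. They are 1-Lipschitz for
  \<open>d\<close> as well, so a test function grows by at most that length. Returning to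
  \<open>x\<close> and \<open>y\<close> costs \<open>C * \<delta>\<close> at each end.\<close>

lemma dp_minimal:
  assumes \<rho>: "mms \<rho> M" "\<And>x y. d x y \<le> \<rho> x y" "thick_geodesic p \<rho> M"
  shows "dp x y \<le> \<rho> x y"
proof (rule dp_le)
  fix u assume u: "test_fun u"
  then obtain g where g: "small g"
    "\<And>L c. lip_curve d L c \<Longrightarrow> arc_int g L c < \<infinity> \<Longrightarrow> \<bar>u (c 0) - u (c L)\<bar> \<le> L"
    unfolding test_fun_def by auto
  have "Metric_space UNIV \<rho>"
    using \<rho>(1) by (simp add: mms_def)
  then interpret R: mms_space \<rho> M p
    using \<rho>(1) p by (intro mms_space.intro full_metric.intro mms_space_axioms.intro)
  \<comment> \<open>From \<open>d \<le> \<rho>\<close> the topology of \<open>\<rho>\<close> is the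
    finer one, which is what keeps \<open>g\<close> Borel measurable for
    \<open>\<rho>\<close>.\<close>
  have "openin (mtop \<rho>) U" if "openin (mtop d) U" for U
    unfolding R.openin_mtop
  proof
    fix x assume "x \<in> U"
    then obtain r where r: "r > 0" "oball d x r \<subseteq> U"
      using \<open>openin (mtop d) U\<close> by (auto simp: openin_mtop)
    have "oball \<rho> x r \<subseteq> oball d x r"
      using \<rho>(2) by (auto simp: oball_def intro: order_le_less_trans)
    then show "\<exists>r>0. oball \<rho> x r \<subseteq> U" using r by blast
  qed
  then have "sets (borel_of_metric d) \<subseteq> sets (borel_of_metric \<rho>)"
    unfolding sets_borel_of_metric R.sets_borel_of_metric by (intro sigma_sets_mono') auto
  then have "g \<in> borel_measurable (borel_of_metric \<rho>)"
    using g(1) by (auto simp: small_def measurable_def)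
  then have Rg: "R.small g"
    using g(1) by (simp add: small_def R.small_def)
  have le: "\<bar>u x - u y\<bar> \<le> (1 + \<delta>) * (\<rho> x y + 2 * \<delta>) + 2 * C * \<delta>" if \<delta>: "\<delta> > 0" for \<delta>
  proof -
    have "thick_quasiconvex p \<rho> M (1 + \<delta>)"
      using \<rho>(3) \<delta> by (simp add: thick_geodesic_def)
    then have "0 < modulus p \<rho> M (curve_family \<rho> (oball \<rho> x \<delta>) (oball \<rho> y \<delta>) (1 + \<delta>))"
      unfolding thick_quasiconvex_def using R.oball_sets_M R.oball_pos[OF \<delta>] by blast
    then obtain L c where c: "lip_curve \<rho> L c" "c 0 \<in> oball \<rho> x \<delta>" "c L \<in> oball \<rho> y \<delta>"
      "L \<le> (1 + \<delta>) * \<rho> (c 0) (c L)" "arc_int g L c < \<infinity>"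
      by (rule R.good_curve_of_modulus_pos[OF _ Rg]) (rule that)
    have "lip_curve d L c"
      using c(1) \<rho>(2) unfolding lip_curve_def by (meson order_trans)
    then have "\<bar>u (c 0) - u (c L)\<bar> \<le> L"
      using g(2) c(5) by blast
    also have "\<dots> \<le> (1 + \<delta>) * (\<rho> x y + 2 * \<delta>)"
    proof -
      have "\<rho> (c 0) (c L) \<le> \<rho> x y + 2 * \<delta>"
        using R.tri[of "c 0" "c L" x] R.tri[of x "c L" y] c(2,3) by (simp add: oball_def R.commute[of "c 0"])
      then show ?thesis
        using c(4) mult_left_mono[of "\<rho> (c 0) (c L)" "\<rho> x y + 2 * \<delta>" "1 + \<delta>"] \<delta> by linarith
    qed
    finally have 1: "\<bar>u (c 0) - u (c L)\<bar> \<le> (1 + \<delta>) * (\<rho> x y + 2 * \<delta>)" .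
    have near: "\<bar>u a - u b\<bar> \<le> C * \<delta>" if "b \<in> oball \<rho> a \<delta>" for a b
    proof -
      have "d a b \<le> \<delta>"
        using that \<rho>(2)[of a b] by (simp add: oball_def)
      then have "C * d a b \<le> C * \<delta>"
        using C by (intro mult_left_mono) auto
      then show ?thesis using test_fun_lipschitz[OF u, of a b] by linarith
    qed
    show ?thesis
      using 1 near[OF c(2)] near[OF c(3)] by linarith
  qed
  show "\<bar>u x - u y\<bar> \<le> \<rho> x y"
  proof (rule LIMSEQ_le_const)
    have 0: "(\<lambda>n. 1 / real (Suc n)) \<longlonglongrightarrow> 0"
      by (intro LIMSEQ_Suc lim_1_over_n)
    have "(\<lambda>n. (1 + 1 / real (Suc n)) * (\<rho> x y + 2 * (1 / real (Suc n))) + 2 * C * (1 / real (Suc n)))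
      \<longlonglongrightarrow> (1 + 0) * (\<rho> x y + 2 * 0) + 2 * C * 0"
      by (intro tendsto_intros 0)
    then show "(\<lambda>n. (1 + 1 / real (Suc n)) * (\<rho> x y + 2 * (1 / real (Suc n))) + 2 * C * (1 / real (Suc n))) \<longlonglongrightarrow> \<rho> x y"
      by simp
    show "\<exists>N. \<forall>n\<ge>N. \<bar>u x - u y\<bar> \<le> (1 + 1 / real (Suc n)) * (\<rho> x y + 2 * (1 / real (Suc n))) + 2 * C * (1 / real (Suc n))"
      by (intro exI[of _ 0] allI impI le) simp
  qed
qed

section \<open>From length bounds along curves to test functions\<close>

text \<open>Otherwise thickness joins the two sets by a curve of finite \<open>g\<close>-integral
  whose length is at most \<open>C * (d a b + 2 * s)\<close>, hence at most \<open>r - q\<close>,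
  although \<open>v\<close> rises by more than \<open>r - q\<close> along it.\<close>

lemma ball_level_null:
  assumes E: "{x. v x < q} \<in> sets M" and F: "{x. r < v x} \<in> sets M"
    and g: "small g" "\<And>L c. lip_curve d L c \<Longrightarrow> arc_int g L c < \<infinity> \<Longrightarrow> \<bar>v (c 0) - v (c L)\<bar> \<le> L"
    and gap: "C * (d a b + 2 * s) \<le> r - q"
  shows "emeasure M (oball d a s \<inter> {x. v x < q}) = 0 \<or> emeasure M (oball d b s \<inter> {x. r < v x}) = 0"
proof (rule ccontr)
  define E' where "E' = oball d a s \<inter> {x. v x < q}"
  define F' where "F' = oball d b s \<inter> {x. r < v x}"
  assume "\<not> ?thesis"
  then have "0 < emeasure M E'" "0 < emeasure M F'"
    by (auto simp: E'_def F'_def zero_less_iff_neq_zero)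
  moreover have "E' \<in> sets M" "F' \<in> sets M"
    using E F oball_sets_M by (auto simp: E'_def F'_def)
  ultimately have "0 < modulus p d M (curve_family d E' F' C)"
    using thick unfolding thick_quasiconvex_def by blast
  then obtain L c where c: "lip_curve d L c" "c 0 \<in> E'" "c L \<in> F'"
    "L \<le> C * d (c 0) (c L)" "arc_int g L c < \<infinity>"
    by (rule good_curve_of_modulus_pos[OF _ g(1)]) (rule that)
  have "d (c 0) (c L) \<le> d a b + 2 * s"
    using tri[of "c 0" "c L" a] tri[of a "c L" b] c(2,3)
    by (simp add: E'_def F'_def oball_def commute[of "c 0"])
  then have "C * d (c 0) (c L) \<le> C * (d a b + 2 * s)"
    using C by (intro mult_left_mono) auto
  moreover have "\<bar>v (c 0) - v (c L)\<bar> \<le> L"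
    using g(2) c by blast
  ultimately show False
    using c gap by (auto simp: E'_def F'_def)
qed

text \<open>Centres are taken from a countable dense set, radii and levels from the rationals, so
  all null pieces of sublevel and superlevel sets can be removed together. A pair violating the
  bound would lie in pieces to which \<open>ball_level_null\<close> applies.\<close>

lemma essentially_lipschitz:
  assumes E: "\<And>q. {x. v x < q} \<in> sets M" and F: "\<And>r. {x. r < v x} \<in> sets M"
    and g: "small g" "\<And>L c. lip_curve d L c \<Longrightarrow> arc_int g L c < \<infinity> \<Longrightarrow> \<bar>v (c 0) - v (c L)\<bar> \<le> L"
  obtains Z where "Z \<in> sets (borel_of_metric d)" "emeasure M Z = 0"
    "\<And>x y. x \<notin> Z \<Longrightarrow> y \<notin> Z \<Longrightarrow> \<bar>v x - v y\<bar> \<le> C * d x y"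
proof -
  obtain D where D: "countable D" "\<And>x e. e > 0 \<Longrightarrow> \<exists>q\<in>D. d x q < e"
    by (rule countable_dense) (rule that)
  define I where "I = D \<times> (\<rat> :: real set) \<times> (\<rat> :: real set)"
  define A where "A i = (case i of (a, s, q) \<Rightarrow> oball d a s \<inter> {x. v x < q})" for i
  define B where "B i = (case i of (a, s, q) \<Rightarrow> oball d a s \<inter> {x. q < v x})" for i
  define N where "N = (\<Union>i\<in>{i\<in>I. A i \<in> null_sets M}. A i) \<union> (\<Union>i\<in>{i\<in>I. B i \<in> null_sets M}. B i)"
  have "countable I"
    unfolding I_def using D(1) countable_rat by (intro countable_SIGMA) auto
  then have "N \<in> null_sets M"
    unfolding N_def by (intro null_sets.Un null_sets_UN') auto
  then have NM: "N \<in> sets M" "emeasure M N = 0" by auto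
  obtain Z where Z: "Z \<in> sets (borel_of_metric d)" "N \<subseteq> Z" "emeasure M Z = emeasure M N"
    using borel_hull[OF NM(1)] by auto
  have Am: "A i \<in> sets M" and Bm: "B i \<in> sets M" for i
    using E F oball_sets_M by (auto simp: A_def B_def split: prod.split)
  have main: "v y - v x \<le> C * d x y" if x: "x \<notin> Z" and y: "y \<notin> Z" for x y
  proof (rule ccontr)
    assume not: "\<not> ?thesis"
    define \<delta> where "\<delta> = v y - v x - C * d x y"
    have \<delta>: "\<delta> > 0" using not by (simp add: \<delta>_def)
    \<comment> \<open>Moving both centres costs \<open>2 * s\<close> and the two radii another
      \<open>2 * s\<close>; so \<open>C * (4 * s)\<close> uses one third of \<open>\<delta>\<close>,
      and \<open>q\<close> and \<open>r\<close> use the other two.\<close>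
    have "0 < \<delta> / (12 * C)" using \<delta> C by simp
    then obtain s where s: "s \<in> \<rat>" "0 < s" "s < \<delta> / (12 * C)"
      using Rats_dense_in_real by blast
    have s4: "C * (4 * s) < \<delta> / 3"
      using s(3) C by (simp add: field_simps)
    obtain q where q: "q \<in> \<rat>" "v x < q" "q < v x + \<delta> / 3"
      using Rats_dense_in_real[of "v x" "v x + \<delta> / 3"] \<delta> by auto
    obtain r where r: "r \<in> \<rat>" "v y - \<delta> / 3 < r" "r < v y"
      using Rats_dense_in_real[of "v y - \<delta> / 3" "v y"] \<delta> by auto
    obtain a where a: "a \<in> D" "d x a < s" using D(2) s(2) by blast
    obtain b where b: "b \<in> D" "d y b < s" using D(2) s(2) by blast
    have "d a b \<le> d x y + 2 * s"
      using tri[of a b x] tri[of x b y] a b by (simp add: commute[of a])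
    then have "C * (d a b + 2 * s) \<le> C * (d x y + 4 * s)"
      using C by (intro mult_left_mono) auto
    also have "\<dots> = C * d x y + C * (4 * s)"
      by (simp add: distrib_left)
    also have "\<dots> \<le> r - q"
      using s4 q r unfolding \<delta>_def by argo
    finally have gap: "C * (d a b + 2 * s) \<le> r - q" .
    have "emeasure M (oball d a s \<inter> {x. v x < q}) = 0 \<or> emeasure M (oball d b s \<inter> {x. r < v x}) = 0"
      by (rule ball_level_null[OF E F g(1) _ gap]) (rule g(2), assumption+)
    then have null: "emeasure M (A (a, s, q)) = 0 \<or> emeasure M (B (b, s, r)) = 0"
      by (simp add: A_def B_def)
    have xA: "x \<in> A (a, s, q)" and yB: "y \<in> B (b, s, r)"
      using a b q r by (auto simp: A_def B_def oball_def commute[of a] commute[of b])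
    have iI: "(a, s, q) \<in> I" "(b, s, r) \<in> I"
      using a b s q r by (auto simp: I_def)
    have AN: "A i \<subseteq> N" if "i \<in> I" "emeasure M (A i) = 0" for i
      unfolding N_def using that null_setsI[OF that(2) Am] by (intro le_supI1 UN_upper) simp
    have BN: "B i \<subseteq> N" if "i \<in> I" "emeasure M (B i) = 0" for i
      unfolding N_def using that null_setsI[OF that(2) Bm] by (intro le_supI2 UN_upper) simp
    from null have "x \<in> N \<or> y \<in> N"
    proof
      assume "emeasure M (A (a, s, q)) = 0"
      then show ?thesis using subsetD[OF AN[OF iI(1)] xA] by simp
    next
      assume "emeasure M (B (b, s, r)) = 0"
      then show ?thesis using subsetD[OF BN[OF iI(2)] yB] by simp
    qed
    then show False using x y Z(2) by auto
  qed
  have lip: "\<bar>v x - v y\<bar> \<le> C * d x y" if "x \<notin> Z" "y \<notin> Z" for x y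
    using main[OF that] main[OF that(2,1)] by (simp add: commute[of y x] abs_le_iff)
  show thesis
    by (rule that[OF Z(1) _ lip]) (simp_all add: Z(3) NM(2))
qed

lemma null_complement_nonempty:
  assumes "Z \<in> sets M" "emeasure M Z = 0" "E \<in> sets M" "0 < emeasure M E"
  shows "\<exists>x\<in>E. x \<notin> Z"
proof (rule ccontr)
  assume "\<not> ?thesis"
  then have "E \<subseteq> Z" by auto
  then have "emeasure M E \<le> emeasure M Z"
    using assms(1) by (rule emeasure_mono)
  then show False using assms by simp
qed

text \<open>\<open>u\<close> is the McShane extension of \<open>v\<close> from the complement of
  \<open>Z\<close>. For the bound along curves, the ends of a curve are trimmed to parameters
  outside \<open>Z\<close>, where \<open>u\<close> and \<open>v\<close> agree; continuity of
  \<open>u\<close> pays for the trimming.\<close>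

lemma test_fun_representative:
  assumes E: "\<And>q. {x. v x < q} \<in> sets M" and F: "\<And>r. {x. r < v x} \<in> sets M" and v0: "\<And>x. 0 \<le> v x"
    and g: "small g" "\<And>L c. lip_curve d L c \<Longrightarrow> arc_int g L c < \<infinity> \<Longrightarrow> \<bar>v (c 0) - v (c L)\<bar> \<le> L"
  obtains Z u where "Z \<in> sets M" "emeasure M Z = 0" "test_fun u" "\<And>x. x \<notin> Z \<Longrightarrow> u x = v x"
proof -
  obtain Z where Z: "Z \<in> sets (borel_of_metric d)" "emeasure M Z = 0"
    and lip: "\<And>x y. x \<notin> Z \<Longrightarrow> y \<notin> Z \<Longrightarrow> \<bar>v x - v y\<bar> \<le> C * d x y"
    by (rule essentially_lipschitz[OF E F g(1)], rule g(2), assumption, assumption) (rule that)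
  have ZM: "Z \<in> sets M" using Z(1) by (rule borel_sets_M)
  define u where "u x = (INF z\<in>- Z. v z + C * d x z)" for x
  have "\<exists>z\<in>oball d undefined 1. z \<notin> Z"
    using ZM Z(2) oball_sets_M oball_pos[of 1] by (intro null_complement_nonempty) auto
  then have ne: "- Z \<noteq> {}" by auto
  have bdd: "bdd_below ((\<lambda>z. v z + C * d x z) ` (- Z))" for x
    using v0 C by (intro bdd_belowI[of _ 0]) auto
  have uv: "u x = v x" if x: "x \<notin> Z" for x
  proof (rule antisym)
    have "u x \<le> v x + C * d x x"
      unfolding u_def by (rule cINF_lower[OF bdd]) (use x in simp)
    then show "u x \<le> v x" by simp
    show "v x \<le> u x"
      unfolding u_def
    proof (rule cINF_greatest[OF ne])
      fix z assume "z \<in> - Z"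
      then show "v x \<le> v z + C * d x z"
        using lip[of x z] x by simp
    qed
  qed
  have ulip1: "u x \<le> u y + C * d x y" for x y
  proof -
    have "u x - C * d x y \<le> u y"
      unfolding u_def[of y]
    proof (rule cINF_greatest[OF ne])
      fix z assume z: "z \<in> - Z"
      have "u x \<le> v z + C * d x z"
        unfolding u_def by (rule cINF_lower[OF bdd z])
      also have "\<dots> \<le> v z + C * (d x y + d y z)"
        using C tri by (intro add_left_mono mult_left_mono) auto
      finally show "u x - C * d x y \<le> v z + C * d y z"
        by (simp add: distrib_left)
    qed
    then show ?thesis by simp
  qed
  have ulip: "\<bar>u x - u y\<bar> \<le> C * d x y" for x y
    using ulip1[of x y] ulip1[of y x] by (simp add: commute[of y x] abs_le_iff)
  \<comment> \<open>Two kinds of curves are discarded together: those exceptional for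
    \<open>v\<close> and those that spend time in \<open>Z\<close>.\<close>
  define G where "G n = (if n = (0::nat) then g else (\<lambda>x. \<infinity> * indicator Z x))" for n
  have "small (G n)" for n
    using g(1) null_small[OF Z] by (simp add: G_def)
  then obtain h where h: "small h"
    "\<And>n L c. lip_curve d L c \<Longrightarrow> arc_int h L c < \<infinity> \<Longrightarrow> arc_int (G n) L c < \<infinity>"
    by (rule small_countable[of G]) (rule that)
  have curve: "\<bar>u (c 0) - u (c L)\<bar> \<le> L" if c: "lip_curve d L c" and fin: "arc_int h L c < \<infinity>" for L c
  proof (rule field_le_epsilon)
    fix e :: real assume e: "e > 0"
    have L: "0 \<le> L" and cl: "\<And>s t. d (c s) (c t) \<le> \<bar>s - t\<bar>"
      using c by (auto simp: lip_curve_def)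
    have gfin: "arc_int g L c < \<infinity>" and Zfin: "arc_int (\<lambda>x. \<infinity> * indicator Z x) L c < \<infinity>"
      using h(2)[OF c fin, of 0] h(2)[OF c fin, of 1] by (auto simp: G_def)
    show "\<bar>u (c 0) - u (c L)\<bar> \<le> L + e"
    proof (cases "L = 0")
      case False
      \<comment> \<open>At most half the length is trimmed at each end, which keeps
        \<open>a \<le> b\<close>; each trimmed piece changes \<open>u\<close> by at most
        \<open>e / 2\<close>.\<close>
      define \<eta> where "\<eta> = min (L / 2) (e / (2 * C))"
      have \<eta>: "0 < \<eta>" "\<eta> \<le> L / 2" "C * \<eta> \<le> e / 2"
      proof -
        show "0 < \<eta>" "\<eta> \<le> L / 2" using False L e C by (auto simp: \<eta>_def)
        have "C * \<eta> \<le> C * (e / (2 * C))"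
          using C by (intro mult_left_mono) (auto simp: \<eta>_def)
        then show "C * \<eta> \<le> e / 2" using C by simp
      qed
      have ae: "AE s in lborel. s \<in> {0..L} \<longrightarrow> c s \<notin> Z"
        using null_avoiding[OF c Z(1) Zfin] .
      obtain a where a: "0 < a" "a < \<eta>" "c a \<notin> Z"
        using AE_lborel_point_in_interval[OF ae \<eta>(1)] \<eta>(2) L by auto
      obtain b where b: "L - \<eta> < b" "b < L" "c b \<notin> Z"
        using AE_lborel_point_in_interval[OF ae, of "L - \<eta>" L] \<eta>(1,2) L by auto
      have ab: "0 \<le> a" "a \<le> b" "b \<le> L" using a b \<eta>(2) by auto
      have "arc_int g (b - a) (\<lambda>s. c (a + s)) \<le> arc_int g L c"
        using lip_curve_sub(2)[OF c ab] g(1) by (simp add: small_def)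
      then have "\<bar>v (c (a + 0)) - v (c (a + (b - a)))\<bar> \<le> b - a"
        using lip_curve_sub(1)[OF c ab] gfin by (intro g(2)[of "b - a" "\<lambda>s. c (a + s)"]) auto
      then have 1: "\<bar>u (c a) - u (c b)\<bar> \<le> b - a"
        using a b by (simp add: uv)
      have "C * d (c 0) (c a) \<le> C * \<eta>"
        using C cl[of 0 a] a by (intro mult_left_mono) auto
      then have 2: "\<bar>u (c 0) - u (c a)\<bar> \<le> e / 2"
        using ulip[of "c 0" "c a"] \<eta>(3) by linarith
      have "C * d (c b) (c L) \<le> C * \<eta>"
        using C cl[of b L] b by (intro mult_left_mono) auto
      then have 3: "\<bar>u (c b) - u (c L)\<bar> \<le> e / 2"
        using ulip[of "c b" "c L"] \<eta>(3) by linarith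
      show ?thesis using 1 2 3 ab by linarith
    qed (use e in simp)
  qed
  have "test_fun u"
    unfolding test_fun_def using ulip h(1) curve by blast
  then show thesis
    using that[OF ZM Z(2)] uv by blast
qed

subsection \<open>Thick geodesicity\<close>

text \<open>Nearly optimal test functions for all pairs from a countable dense set suffice, since
  \<open>dp\<close> and all test functions are controlled by the same multiple \<open>C\<close> of
  \<open>d\<close>. Countability is what allows their exceptional families to be merged.\<close>

lemma dp_countable:
  obtains u :: "nat \<Rightarrow> 'a \<Rightarrow> real" where "\<And>n. test_fun (u n)" "\<And>x y B. \<forall>n. \<bar>u n x - u n y\<bar> \<le> B \<Longrightarrow> dp x y \<le> B"
proof -
  obtain D where D: "countable D" "\<And>x e. e > 0 \<Longrightarrow> \<exists>q\<in>D. d x q < e"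
    by (rule countable_dense) (rule that)
  have Dne: "D \<noteq> {}" using D(2)[of 1] by auto
  have "\<exists>u. test_fun u \<and> dp a b - 1 / Suc m < \<bar>u a - u b\<bar>" for a b and m :: nat
  proof (rule ccontr)
    assume "\<not> ?thesis"
    then have "dp a b \<le> dp a b - 1 / Suc m"
      by (intro dp_le) (simp add: not_less)
    then show False by simp
  qed
  then obtain U where U: "\<And>a b m. test_fun (U a b m)" "\<And>a b m. dp a b - 1 / Suc m < \<bar>U a b m a - U a b m b\<bar>"
    by metis
  define u where "u n = (case prod_decode n of (i, k) \<Rightarrow> case prod_decode k of (j, m) \<Rightarrow>
      U (from_nat_into D i) (from_nat_into D j) m)" for n
  show thesis
  proof
    show "test_fun (u n)" for n
      using U(1) by (simp add: u_def split: prod.split)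
    fix x y B assume B: "\<forall>n. \<bar>u n x - u n y\<bar> \<le> B"
    show "dp x y \<le> B"
    proof (rule field_le_epsilon)
      fix e :: real assume e: "e > 0"
      \<comment> \<open>Four moves from \<open>x\<close>, \<open>y\<close> to \<open>a\<close>,
        \<open>b\<close>, two for \<open>w\<close> and two for \<open>dp\<close>, cost
        \<open>e / 8\<close> each; the other half of \<open>e\<close> covers the near-optimality of
        \<open>w\<close>.\<close>
      define \<eta> where "\<eta> = e / (8 * C)"
      have \<eta>: "\<eta> > 0" "C * \<eta> = e / 8" using e C by (auto simp: \<eta>_def)
      obtain a where a: "a \<in> D" "d x a < \<eta>" using D(2) \<eta>(1) by blast
      obtain b where b: "b \<in> D" "d y b < \<eta>" using D(2) \<eta>(1) by blast
      have e2: "e / 2 > 0" using e by simp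
      obtain m where m: "1 / Suc m < e / 2" using nat_approx_posE[OF e2] by blast
      obtain i where i: "from_nat_into D i = a" using from_nat_into_surj[OF D(1) a(1)] by blast
      obtain j where j: "from_nat_into D j = b" using from_nat_into_surj[OF D(1) b(1)] by blast
      define w where "w = U a b m"
      have w: "test_fun w" using U(1) by (simp add: w_def)
      have "u (prod_encode (i, prod_encode (j, m))) = w"
        by (simp add: u_def i j w_def)
      then have wB: "\<bar>w x - w y\<bar> \<le> B" using B by metis
      have "C * d x a \<le> e / 8" "C * d y b \<le> e / 8"
        using a b C \<eta>(2) mult_left_mono[of "d x a" \<eta> C] mult_left_mono[of "d y b" \<eta> C] by auto
      then have "\<bar>w x - w a\<bar> \<le> e / 8" "\<bar>w y - w b\<bar> \<le> e / 8" "dp x a \<le> e / 8" "dp y b \<le> e / 8"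
        using test_fun_lipschitz[OF w, of x a] test_fun_lipschitz[OF w, of y b] dp_le_Cd[of x a] dp_le_Cd[of y b] by linarith+
      moreover have "dp x y \<le> dp x a + dp a b + dp y b"
        using Metric_space.triangle[OF dp_metric, of x a y] Metric_space.triangle[OF dp_metric, of a b y]
          Metric_space.commute[OF dp_metric, of b y] by simp
      moreover have "dp a b - 1 / Suc m < \<bar>w a - w b\<bar>"
        using U(2) by (simp add: w_def)
      ultimately show "dp x y \<le> B + e"
        using wB m by linarith
    qed
  qed
qed

lemma compact_small_piece:
  assumes E: "E \<in> sets M" "0 < emeasure M E" and \<eta>: "\<eta> > 0"
  obtains K where "compactin (mtop d) K" "K \<subseteq> E" "0 < emeasure M K" "\<And>x y. x \<in> K \<Longrightarrow> y \<in> K \<Longrightarrow> d x y \<le> \<eta>"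
proof -
  obtain D where D: "countable D" "\<And>x e. e > 0 \<Longrightarrow> \<exists>q\<in>D. d x q < e"
    by (rule countable_dense) (rule that)
  have "\<exists>q\<in>D. emeasure M (E \<inter> oball d q (\<eta> / 2)) \<noteq> 0"
  proof (rule ccontr)
    assume "\<not> ?thesis"
    then have "(\<Union>q\<in>D. E \<inter> oball d q (\<eta> / 2)) \<in> null_sets M"
      using E(1) oball_sets_M by (intro null_sets_UN' D(1)) auto
    moreover have "E \<subseteq> (\<Union>q\<in>D. E \<inter> oball d q (\<eta> / 2))"
    proof
      fix x assume "x \<in> E"
      moreover obtain q where "q \<in> D" "d x q < \<eta> / 2"
        using D(2)[of "\<eta> / 2" x] \<eta> by auto
      ultimately show "x \<in> (\<Union>q\<in>D. E \<inter> oball d q (\<eta> / 2))"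
        by (auto simp: oball_def commute[of x])
    qed
    ultimately have "emeasure M E = 0"
      using E(1) by (metis null_setsD1 null_sets_subset)
    then show False using E(2) by simp
  qed
  then obtain q where q: "0 < emeasure M (E \<inter> oball d q (\<eta> / 2))"
    by (auto simp: zero_less_iff_neq_zero)
  have "E \<inter> oball d q (\<eta> / 2) \<in> sets M"
    using E(1) oball_sets_M by auto
  then obtain K where K: "compactin (mtop d) K" "K \<subseteq> E \<inter> oball d q (\<eta> / 2)" "0 < emeasure M K"
    using q by (rule compact_of_positive_measure) (rule that)
  show thesis
  proof (rule that[OF K(1) _ K(3)])
    show "K \<subseteq> E" using K(2) by simp
    fix x y assume "x \<in> K" "y \<in> K"
    then have "d q x < \<eta> / 2" "d q y < \<eta> / 2"
      using K(2) by (auto simp: oball_def)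
    then show "d x y \<le> \<eta>"
      using tri[of x y q] by (simp add: commute[of x q])
  qed
qed

lemma bounded_piece:
  assumes "F \<in> sets M" "0 < emeasure M F"
  obtains F' R where "F' \<in> sets M" "0 < emeasure M F'" "F' \<subseteq> F" "\<And>x. x \<in> F' \<Longrightarrow> d z x \<le> R"
proof -
  have "\<exists>n::nat. emeasure M (F \<inter> oball d z (real n)) \<noteq> 0"
  proof (rule ccontr)
    assume "\<not> ?thesis"
    then have "emeasure M (\<Union>n::nat. F \<inter> oball d z (real n)) = 0"
      using assms(1) oball_sets_M by (intro emeasure_UN_eq_0) auto
    moreover have "(\<Union>n::nat. F \<inter> oball d z (real n)) = F"
      using UN_oball[of z] by (simp add: Int_UN_distrib[symmetric])
    ultimately show False using assms(2) by simp
  qed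
  then obtain n :: nat where "emeasure M (F \<inter> oball d z (real n)) \<noteq> 0" ..
  then show thesis
    using assms(1) oball_sets_M
    by (intro that[of "F \<inter> oball d z (real n)" "real n"]) (auto simp: oball_def zero_less_iff_neq_zero)
qed

text \<open>Supplies a positive distance \<open>r\<close> against which the diameter of the starting
  set can later be made small. The points of \<open>F\<close> at distance at least
  \<open>1 / Suc n\<close> from \<open>K\<close> exhaust \<open>F\<close>, as \<open>K\<close> is
  closed.\<close>

lemma separated_piece:
  assumes K: "compactin (mtop d) K" and F: "F \<in> sets M" "0 < emeasure M F" "K \<inter> F = {}"
  obtains F' r where "F' \<in> sets M" "0 < emeasure M F'" "F' \<subseteq> F" "0 < r" "\<And>x y. x \<in> K \<Longrightarrow> y \<in> F' \<Longrightarrow> r \<le> d x y"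
proof -
  define G where "G n = F - (\<Union>x\<in>K. oball d x (1 / Suc n))" for n :: nat
  have op: "openin (mtop d) (\<Union>x\<in>K. oball d x (1 / Suc n))" for n :: nat
    by (intro openin_Union) (auto intro: openin_oball)
  have GM: "G n \<in> sets M" for n
    unfolding G_def by (intro sets.Diff F(1) open_sets_M op)
  have opK: "openin (mtop d) (- K)"
    using compactin_closedin[OF K] by (simp add: closedin_def mtop_eq Compl_eq_Diff_UNIV)
  have "F \<subseteq> (\<Union>n. G n)"
  proof
    fix y assume y: "y \<in> F"
    then have "y \<in> - K" using F(3) by auto
    then obtain r where r: "r > 0" "oball d y r \<subseteq> - K"
      using opK unfolding openin_mtop by blast
    obtain n where n: "1 / Suc n < r" using nat_approx_posE[OF r(1)] by blast
    have "y \<notin> oball d x (1 / Suc n)" if "x \<in> K" for x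
    proof
      assume "y \<in> oball d x (1 / Suc n)"
      then have "x \<in> oball d y r" using n by (simp add: oball_def commute[of x])
      then show False using r(2) that by auto
    qed
    then show "y \<in> (\<Union>n. G n)" using y by (auto simp: G_def)
  qed
  then have FG: "emeasure M F \<le> emeasure M (\<Union>n. G n)"
    using GM by (intro emeasure_mono) auto
  have "\<exists>n. emeasure M (G n) \<noteq> 0"
  proof (rule ccontr)
    assume "\<not> ?thesis"
    then have "emeasure M (\<Union>n. G n) = 0"
      using GM by (intro emeasure_UN_eq_0) auto
    then show False using FG F(2) by simp
  qed
  then obtain n where n: "emeasure M (G n) \<noteq> 0" ..
  show thesis
  proof (rule that[of "G n" "1 / Suc n"])
    show "1 / real (Suc n) \<le> d x y" if "x \<in> K" "y \<in> G n" for x y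
    proof -
      have "y \<notin> oball d x (1 / Suc n)" using that by (auto simp: G_def)
      then show ?thesis by (simp add: oball_def)
    qed
  qed (use GM n in \<open>auto simp: zero_less_iff_neq_zero G_def\<close>)
qed

(* v is the infimal length of a good curve from E, capped at T; the cap keeps it finite at points that
   no good curve from E reaches. *)
lemma capped_distance:
  assumes w: "gauge w" and E: "compactin (mtop d) E" and T: "0 \<le> T"
  obtains v :: "'a \<Rightarrow> real" where "\<And>q. {x. v x < q} \<in> sets M" "\<And>q. {x. q < v x} \<in> sets M"
    "\<And>x. 0 \<le> v x" "\<And>x. x \<in> E \<Longrightarrow> v x = 0"
    "\<And>L c. lip_curve d L c \<Longrightarrow> good w L c \<Longrightarrow> \<bar>v (c 0) - v (c L)\<bar> \<le> L"
    "\<And>z B. \<forall>L c. lip_curve d L c \<longrightarrow> good w L c \<longrightarrow> c 0 \<in> E \<longrightarrow> c L = z \<longrightarrow> B \<le> L \<Longrightarrow> B \<le> T \<Longrightarrow> B \<le> v z"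
proof -
  define S where "S z = {L. \<exists>c. lip_curve d L c \<and> good w L c \<and> c 0 \<in> E \<and> c L = z} \<union> {T}" for z
  define v where "v z = Inf (S z)" for z
  have S0: "0 \<le> L" if "L \<in> S z" for L z
    using that T by (auto simp: S_def lip_curve_def)
  have ne: "S z \<noteq> {}" for z by (simp add: S_def)
  have bdd: "bdd_below (S z)" for z
    using S0 by (intro bdd_belowI[of _ 0]) auto
  have vle: "v z \<le> L" if "L \<in> S z" for z L
    unfolding v_def by (rule cInf_lower[OF that bdd])
  have vge: "B \<le> v z" if "\<And>L. L \<in> S z \<Longrightarrow> B \<le> L" for z B
    unfolding v_def using that by (rule cInf_greatest[OF ne])
  \<comment> \<open>The value \<open>T\<close> belongs to every \<open>S x\<close>, hence the first
    part. A rational bound between the length and \<open>q\<close> makes the second part a countable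
    union of sets treated by \<open>reachable_measurable\<close>.\<close>
  have lt: "{x. v x < q} = (if T < q then UNIV else {}) \<union>
      (\<Union>t\<in>{t\<in>\<rat>. t < q}. {c L | L c. lip_curve d L c \<and> c 0 \<in> E \<and> L \<le> t \<and> good w L c})" (is "_ = ?R") for q
  proof
    show "{x. v x < q} \<subseteq> ?R"
    proof
      fix x assume "x \<in> {x. v x < q}"
      then obtain L where L: "L \<in> S x" "L < q"
        unfolding v_def using cInf_less_iff[OF ne bdd] by auto
      show "x \<in> ?R"
      proof (cases "L = T")
        case True
        then show ?thesis using L(2) by simp
      next
        case False
        then obtain c where c: "lip_curve d L c" "good w L c" "c 0 \<in> E" "c L = x"
          using L(1) by (auto simp: S_def)
        obtain t where t: "t \<in> \<rat>" "L < t" "t < q" using Rats_dense_in_real[OF L(2)] by auto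
        have "x \<in> {c L | L c. lip_curve d L c \<and> c 0 \<in> E \<and> L \<le> t \<and> good w L c}"
          using c t(2) by (intro CollectI exI[of _ L] exI[of _ c]) simp
        then show ?thesis using t by blast
      qed
    qed
    show "?R \<subseteq> {x. v x < q}"
    proof
      fix x assume x: "x \<in> ?R"
      show "x \<in> {x. v x < q}"
      proof (cases "T < q")
        case True
        then show ?thesis using vle[of T x] by (simp add: S_def)
      next
        case False
        then obtain t L c where "t < q" "x = c L" "lip_curve d L c" "c 0 \<in> E" "L \<le> t" "good w L c"
          using x by auto
        then have "L \<in> S x" by (auto simp: S_def)
        then show ?thesis using vle[of L x] \<open>L \<le> t\<close> \<open>t < q\<close> by simp
      qed
    qed
  qed
  have ltM: "{x. v x < q} \<in> sets M" for q
    unfolding lt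
  proof (intro sets.Un sets.countable_UN')
    show "countable {t \<in> \<rat>. t < q}"
      using countable_rat by (rule countable_subset[rotated]) auto
    show "(if T < q then UNIV else {}) \<in> sets M"
      using sets.top[of M] by simp
  qed (use reachable_measurable[OF w E] in auto)
  have vm: "v \<in> borel_measurable M"
    unfolding borel_measurable_iff_less using ltM by simp
  have one: "v (c L) \<le> v (c 0) + L" if c: "lip_curve d L c" "good w L c" for L c
  proof -
    have L: "0 \<le> L" using c(1) by (simp add: lip_curve_def)
    have "v (c L) - L \<le> v (c 0)"
    proof (rule vge)
      fix l assume l: "l \<in> S (c 0)"
      show "v (c L) - L \<le> l"
      proof (cases "l = T")
        case True
        then show ?thesis using vle[of T "c L"] L by (simp add: S_def)
      next
        case False
        then obtain b where b: "lip_curve d l b" "good w l b" "b 0 \<in> E" "b l = c 0"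
          using l by (auto simp: S_def)
        have l0: "0 \<le> l" using S0[OF l] .
        \<comment> \<open>At its junction \<open>join\<close> uses the first piece, so a second
          piece of length 0 never contributes and needs the matching condition.\<close>
        have "join l b c (l + L) = c L"
        proof (cases "L = 0")
          case True
          then show ?thesis using b(4) by (simp add: join_def)
        next
          case False
          then show ?thesis using L by (simp add: join_def)
        qed
        moreover have "join l b c 0 = b 0"
          using l0 by (simp add: join_def)
        ultimately have "l + L \<in> S (c L)"
          using lip_curve_join(1)[OF b(1) c(1) b(4)] good_join[OF w b(1,2) c b(4)] b(3)
          unfolding S_def by (intro UnI1 CollectI exI[of _ "join l b c"]) simp
        then show ?thesis using vle by fastforce
      qed
    qed
    then show ?thesis by simp
  qed
  show thesis
  proof (rule that[of v])
    show "{x. v x < q} \<in> sets M" for q by (rule ltM)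
    show "{x. q < v x} \<in> sets M" for q
      using vm unfolding borel_measurable_iff_greater by simp
    show v0: "0 \<le> v x" for x
      by (rule vge) (rule S0)
    show "v x = 0" if "x \<in> E" for x
    proof -
      have "good w 0 (\<lambda>_. x)"
        by (simp add: good_def arc_int_0)
      then have "0 \<in> S x"
        using that by (auto simp: S_def lip_curve_def intro!: exI[of _ "\<lambda>_. x"])
      then show ?thesis using vle[of 0 x] v0[of x] by simp
    qed
    show "\<bar>v (c 0) - v (c L)\<bar> \<le> L" if c: "lip_curve d L c" "good w L c" for L c
      using one[OF c] one[OF lip_curve_reverse(1)[OF c(1)] good_reverse[OF w c]] by (simp add: abs_le_iff)
    show "B \<le> v z"
      if B: "\<forall>L c. lip_curve d L c \<longrightarrow> good w L c \<longrightarrow> c 0 \<in> E \<longrightarrow> c L = z \<longrightarrow> B \<le> L" "B \<le> T" for z B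
    proof (rule vge)
      fix L assume "L \<in> S z"
      then show "B \<le> L" using B by (auto simp: S_def)
    qed
  qed
qed

lemma thick_geodesic_dp: "thick_geodesic p dp M"
  unfolding thick_geodesic_def thick_quasiconvex_def
proof (intro allI impI, rule ccontr)
  fix lam :: real and E0 F0
  assume lam: "1 < lam"
    and EF: "E0 \<in> sets M \<and> F0 \<in> sets M \<and> 0 < emeasure M E0 \<and> 0 < emeasure M F0"
    and "\<not> 0 < modulus p dp M (curve_family dp E0 F0 lam)"
  then have mod0: "modulus p dp M (curve_family dp E0 F0 lam) = 0"
    by (simp add: not_gr_zero)
  interpret D: mms_space dp M p
    using dp_metric mms_dp p by (intro mms_space.intro full_metric.intro mms_space_axioms.intro)
  obtain gB where gB: "D.small gB" and gB_inf: "\<And>L c. lip_curve dp L c \<Longrightarrow> c 0 \<in> E0 \<Longrightarrow> c L \<in> F0 \<Longrightarrow>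
      L \<le> lam * dp (c 0) (c L) \<Longrightarrow> arc_int gB L c = \<infinity>"
    by (rule D.exceptional_of_modulus_0[OF mod0]) (rule that)
  have gB_small: "small gB"
    using gB by (simp add: small_def D.small_def borel_of_dp)
  \<comment> \<open>At a common point the constant curve would belong to the family, but its
    integral is 0.\<close>
  have disj: "E0 \<inter> F0 = {}"
  proof (rule ccontr)
    assume "E0 \<inter> F0 \<noteq> {}"
    then obtain x where "x \<in> E0" "x \<in> F0" by auto
    then have "arc_int gB 0 (\<lambda>_. x) = \<infinity>"
      by (intro gB_inf) (auto simp: lip_curve_def)
    then show False by (simp add: arc_int_0)
  qed
  obtain u :: "nat \<Rightarrow> 'a \<Rightarrow> real" where u: "\<And>n. test_fun (u n)"
    and u_dp: "\<And>x y B. \<forall>n. \<bar>u n x - u n y\<bar> \<le> B \<Longrightarrow> dp x y \<le> B"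
    by (rule dp_countable) (rule that)
  obtain g where g: "\<And>n. small (g n)"
    "\<And>n L c. lip_curve d L c \<Longrightarrow> arc_int (g n) L c < \<infinity> \<Longrightarrow> \<bar>u n (c 0) - u n (c L)\<bar> \<le> L"
    using u unfolding test_fun_def by metis
  define G where "G n = (case n of 0 \<Rightarrow> gB | Suc k \<Rightarrow> g k)" for n
  have "small (G n)" for n
    using g(1) gB_small by (simp add: G_def split: nat.split)
  then obtain h0 where h0: "small h0"
    and h0_G: "\<And>n L c. lip_curve d L c \<Longrightarrow> arc_int h0 L c < \<infinity> \<Longrightarrow> arc_int (G n) L c < \<infinity>"
    by (rule small_countable[of G]) (rule that)
  obtain w h where w: "gauge w" and h: "small h"
    and good_h0: "\<And>L c. lip_curve d L c \<Longrightarrow> good w L c \<Longrightarrow> arc_int h0 L c < \<infinity>"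
    and h_good: "\<And>L c. lip_curve d L c \<Longrightarrow> arc_int h L c < \<infinity> \<Longrightarrow> good w L c"
    by (rule gauge_exists[OF h0]) (rule that)
  \<comment> \<open>Subarcs inherit finite integrals, so the bound holds between any two parameters
    and a good curve is 1-Lipschitz for \<open>dp\<close>, not just at its ends.\<close>
  have good_dp: "dp (c a) (c b) \<le> b - a"
    if c: "lip_curve d L c" "good w L c" and ab: "0 \<le> a" "a \<le> b" "b \<le> L" for L c a b
  proof (rule u_dp, rule allI)
    fix n
    have gm: "g n \<in> borel_measurable (borel_of_metric d)"
      using g(1) by (simp add: small_def)
    have "arc_int (g n) L c < \<infinity>"
      using h0_G[OF c(1) good_h0[OF c], of "Suc n"] by (simp add: G_def)
    then have "arc_int (g n) (b - a) (\<lambda>s. c (a + s)) < \<infinity>"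
      by (rule order_le_less_trans[OF lip_curve_sub(2)[OF c(1) ab gm]])
    from g(2)[OF lip_curve_sub(1)[OF c(1) ab] this]
    show "\<bar>u n (c a) - u n (c b)\<bar> \<le> b - a" by simp
  qed
  have long: "lam * dp (c 0) (c L) < L"
    if c: "lip_curve d L c" "good w L c" "c 0 \<in> E0" "c L \<in> F0" for L c
  proof (rule ccontr)
    assume *: "\<not> ?thesis"
    have L: "0 \<le> L" using c(1) by (simp add: lip_curve_def)
    \<comment> \<open>\<open>good_dp\<close> speaks only of parameters in \<open>{0..L}\<close>,
      while \<open>lip_curve\<close> asks for the whole line. Freezing \<open>c\<close> outside
      leaves the ends and the integral unchanged.\<close>
    define c' where "c' s = c (max 0 (min L s))" for s
    have "dp (c' s) (c' t) \<le> \<bar>s - t\<bar>" for s t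
    proof (induction s t rule: linorder_wlog)
      case (le s t)
      have "dp (c' s) (c' t) \<le> max 0 (min L t) - max 0 (min L s)"
        unfolding c'_def using le L by (intro good_dp[OF c(1,2)]) auto
      then show ?case using le by linarith
    next
      case (sym s t)
      then show ?case by (simp add: D.commute[of "c' t"] abs_minus_commute)
    qed
    then have "lip_curve dp L c'"
      using L by (simp add: lip_curve_def)
    moreover have ends: "c' 0 = c 0" "c' L = c L"
      using L by (auto simp: c'_def)
    ultimately have "arc_int gB L c' = \<infinity>"
      using c(3,4) * by (intro gB_inf) auto
    moreover have "arc_int gB L c' = arc_int gB L c"
      unfolding arc_int_def by (intro nn_integral_cong) (auto simp: indicator_def c'_def)
    moreover have "arc_int gB L c < \<infinity>"
      using h0_G[OF c(1) good_h0[OF c(1,2)], of 0] by (simp add: G_def)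
    ultimately show False by simp
  qed
  have E0: "E0 \<in> sets M" "0 < emeasure M E0"
    using EF by auto
  \<comment> \<open>The distance \<open>r\<close> is fixed by a first compact piece, because the
    diameter \<open>\<eta>\<close> of the final starting set depends on it. The starting set must
    again be compact for \<open>capped_distance\<close>.\<close>
  obtain K where K: "compactin (mtop d) K" "K \<subseteq> E0" "0 < emeasure M K"
    by (rule compact_of_positive_measure[OF E0]) (rule that)
  obtain F1 r where F1: "F1 \<in> sets M" "0 < emeasure M F1" "F1 \<subseteq> F0" and r: "0 < r"
    and sep: "\<And>x y. x \<in> K \<Longrightarrow> y \<in> F1 \<Longrightarrow> r \<le> d x y"
  proof (rule separated_piece[OF K(1)])
    show "F0 \<in> sets M" "0 < emeasure M F0" using EF by auto
    show "K \<inter> F0 = {}" using K(2) disj by auto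
  qed (rule that)
  \<comment> \<open>Chosen so that \<open>lam * (C * \<eta>)\<close> is half of
    \<open>(lam - 1) * r\<close>, which leaves the strict gap at the end.\<close>
  define \<eta> where "\<eta> = (lam - 1) * r / (2 * lam * C)"
  have \<eta>: "\<eta> > 0" using lam r C by (simp add: \<eta>_def)
  have KM: "K \<in> sets M"
    by (intro borel_sets_M closed_in_borel compactin_closedin K(1))
  obtain E1 where E1: "compactin (mtop d) E1" "E1 \<subseteq> K" "0 < emeasure M E1"
    and diam: "\<And>x y. x \<in> E1 \<Longrightarrow> y \<in> E1 \<Longrightarrow> d x y \<le> \<eta>"
    by (rule compact_small_piece[OF KM K(3) \<eta>]) (rule that)
  have E1M: "E1 \<in> sets M"
    by (intro borel_sets_M closed_in_borel compactin_closedin E1(1))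
  obtain e0 where e0: "e0 \<in> E1" using E1(3) by fastforce
  obtain F2 R where F2: "F2 \<in> sets M" "0 < emeasure M F2" "F2 \<subseteq> F1" and R: "\<And>x. x \<in> F2 \<Longrightarrow> d e0 x \<le> R"
    by (rule bounded_piece[OF F1(1,2), of e0]) (rule that)
  \<comment> \<open>\<open>C * (\<eta> + R)\<close> bounds \<open>dp\<close> between
    \<open>E1\<close> and \<open>F2\<close>, so the cap lies above the lower bound wanted for
    \<open>v\<close>; this is why the target was cut down to a bounded set.\<close>
  define T where "T = max 0 (lam * (C * (\<eta> + R)))"
  obtain v where v: "\<And>q. {x. v x < q} \<in> sets M" "\<And>q. {x. q < v x} \<in> sets M"
    "\<And>x. 0 \<le> v x" and vE: "\<And>x. x \<in> E1 \<Longrightarrow> v x = 0"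
    and vc: "\<And>L c. lip_curve d L c \<Longrightarrow> good w L c \<Longrightarrow> \<bar>v (c 0) - v (c L)\<bar> \<le> L"
    and vge: "\<And>z B. \<forall>L c. lip_curve d L c \<longrightarrow> good w L c \<longrightarrow> c 0 \<in> E1 \<longrightarrow> c L = z \<longrightarrow> B \<le> L \<Longrightarrow> B \<le> T \<Longrightarrow> B \<le> v z"
    by (rule capped_distance[OF w E1(1), of T]) (simp add: T_def, rule that)
  \<comment> \<open>\<open>v\<close> obeys the length bound along good curves; the small function
    \<open>h\<close> of the gauge turns this into a bound off an exceptional family.\<close>
  obtain Z u' where Z: "Z \<in> sets M" "emeasure M Z = 0" and u': "test_fun u'" "\<And>x. x \<notin> Z \<Longrightarrow> u' x = v x"
    by (rule test_fun_representative[OF v h], rule vc, assumption, rule h_good, assumption, assumption) (rule that)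
  obtain e where e: "e \<in> E1" "e \<notin> Z"
    using null_complement_nonempty[OF Z E1M E1(3)] by auto
  obtain z where z: "z \<in> F2" "z \<notin> Z"
    using null_complement_nonempty[OF Z F2(1,2)] by auto
  define \<delta> where "\<delta> = dp e z"
  have \<delta>: "r \<le> \<delta>"
    using sep[of e z] e z E1(2) F2(3) d_le_dp[of e z] by (force simp: \<delta>_def)
  have vz: "v z \<le> \<delta>"
    using dp_upper[OF u'(1), of e z] u'(2)[OF e(2)] u'(2)[OF z(2)] vE[OF e(1)] v(3)[of z] by (simp add: \<delta>_def)
  \<comment> \<open>A good curve may start at a point of \<open>E1\<close> other than
    \<open>e\<close>; this lowers the distance to \<open>z\<close> by at most
    \<open>C * \<eta>\<close>.\<close>
  have "lam * (\<delta> - C * \<eta>) \<le> v z"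
  proof (rule vge, intro allI impI)
    fix L c assume c: "lip_curve d L c" "good w L c" "c 0 \<in> E1" "c L = z"
    have "dp e (c 0) \<le> C * \<eta>"
      using dp_le_Cd[of e "c 0"] mult_left_mono[OF diam[OF e(1) c(3)], of C] C by linarith
    then have "\<delta> - C * \<eta> \<le> dp (c 0) (c L)"
      using D.tri[of e z "c 0"] c(4) by (simp add: \<delta>_def)
    then have "lam * (\<delta> - C * \<eta>) \<le> lam * dp (c 0) (c L)"
      using lam by (intro mult_left_mono) auto
    also have "\<dots> < L"
      using c E1(2) K(2) z(1) F2(3) F1(3) by (intro long) auto
    finally show "lam * (\<delta> - C * \<eta>) \<le> L" by simp
  next
    have "d e z \<le> \<eta> + R"
      using tri[of e z e0] diam[OF e(1) e0] R[OF z(1)] by linarith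
    then have "\<delta> \<le> C * (\<eta> + R)"
      using dp_le_Cd[of e z] mult_left_mono[of "d e z" "\<eta> + R" C] C unfolding \<delta>_def by linarith
    moreover have "0 \<le> C * \<eta>" using C \<eta> by simp
    ultimately have "lam * (\<delta> - C * \<eta>) \<le> lam * (C * (\<eta> + R))"
      using lam by (intro mult_left_mono) auto
    then show "lam * (\<delta> - C * \<eta>) \<le> T" by (simp add: T_def)
  qed
  then have "(lam - 1) * \<delta> \<le> lam * (C * \<eta>)"
    using vz by (simp add: algebra_simps)
  also have "\<dots> = (lam - 1) * r / 2"
    using lam C by (simp add: \<eta>_def)
  also have "\<dots> < (lam - 1) * r"
    using lam r by simp
  also have "\<dots> \<le> (lam - 1) * \<delta>"
    using lam \<delta> by (intro mult_left_mono) auto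
  finally show False by simp
qed

end

theorem theorem1p4:
  fixes d :: "'a \<Rightarrow> 'a \<Rightarrow> real" and M :: "'a measure" and p :: ennreal and C :: real
  assumes "mms d M" and "inf_doubling d M"
    and "1 \<le> p" and "1 \<le> C"
    and "thick_quasiconvex p d M C"
  shows "\<exists>dp :: 'a \<Rightarrow> 'a \<Rightarrow> real.
           mms dp M \<and> thick_geodesic p dp M \<and>
           (\<forall>x y. d x y \<le> dp x y \<and> dp x y \<le> C * d x y) \<and>
           (\<forall>\<rho> :: 'a \<Rightarrow> 'a \<Rightarrow> real. mms \<rho> M \<and> (\<forall>x y. d x y \<le> \<rho> x y) \<and> thick_geodesic p \<rho> M
               \<longrightarrow> (\<forall>x y. dp x y \<le> \<rho> x y))"
proof -
  have "Metric_space UNIV d"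
    using assms(1) by (simp add: mms_def)
  then interpret quasiconvex_mms d M p C
    using assms by (intro quasiconvex_mms.intro mms_space.intro full_metric.intro
        mms_space_axioms.intro quasiconvex_mms_axioms.intro)
  show ?thesis
    using mms_dp thick_geodesic_dp d_le_dp dp_le_Cd dp_minimal by (intro exI[of _ dp]) blast
qed

end
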